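(* Let $G$ be a connected graph. Then the inverse limit $\|G\|=\varprojlim(G.F\mid F\in\mathcal E)$ is homeomorphic to the quotient space $\vartheta G/{\sim}$ of the tangle compactification $\vartheta G$. In particular, $\vartheta G/{\sim}$ is homeomorphic to $(\mathcal EG,\mathrm{ETOP})$.
   Context: $G$ is regarded as a 1-complex: edges are copies of $[0,1]$; inner edge points have their usual neighbourhoods, a basic open neighbourhood of a vertex $u$ is a union of half-open intervals $[u,j_e)$, one for each edge $e$ at $u$. Tangle compactification: $\mathcal X$ is the set of finite subsets of $V(G)$; $\mathcal C_X$ the set of components of $G-X$; for $X\subseteq X'$, $\phi_{X',X}$ sends a component of $G-X'$ to the component of $G-X$ containing it; $\mathcal U_X$ is the set of ultrafilters on $\mathcal C_X$; $f_{X',X}(U')=\{\mathcal C\subseteq\mathcal C_X:\exists\mathcal C'\in U',\ \mathcal C\supseteq\phi_{X',X}[\mathcal C']\}$; $\mathcal U$ is the set of compatible families $(U_X)_{X\in\mathcal X}$ (i.e. $f_{X',X}(U_{X'})=U_X$). $\vartheta G=G\cup\mathcal U$ carries the topology generated by the open sets of the 1-complex $G$ and the sets $\bigcup\mathcal C\cup\mathring E(X,\bigcup\mathcal C)\cup\{(U_Y)_Y:\mathcal C\in U_X\}$ ($X\in\mathcal X$, $\mathcal C\subseteq\mathcal C_X$; $\mathring E(X,\bigcup\mathcal C)$ the inner points of edges between $X$ and $\bigcup\mathcal C$). The relation $\sim$: two points $x,y\in V(G)\cup\mathcal U$ are finitely separable if there is a finite cut $F$ of $G$ with sides $V_1,V_2$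 such that $x\in\overline{G[V_1]}$ and $y\in\overline{G[V_2]}$ (closures in $\vartheta G$); $x\sim y$ iff $x,y$ are not finitely separable. This is an equivalence relation on $V(G)\cup\mathcal U$, extended to $\vartheta G$ by making each inner edge point equivalent only to itself. $\|G\|$: let $\mathcal E$ be the set of finite subsets of $E(G)$ ordered by inclusion. For $F\in\mathcal E$, $G.F$ is the multigraph obtained from $G$ by contracting the vertex set of each component of $G-F$ to a single vertex (edges of these components become loops). $G.F$ is topologised as follows: inner edge points have their usual neighbourhoods; for a vertex $d$ with set of loops $\ell(d)$, the basic open sets are $\{d\}\cup\bigcup_{e}(j_e,d]\cup\bigcup_{e\in L}(e\setminus I_e)\cup\bigcup(\ell(d)\setminus L)$, where $e$ ranges over the non-loop edges at $d$ with $j_e$ an inner point of $e$, $L$ is a finite subset of $\ell(d)$, and each $I_e$ is a closed interval contained in the interior of $e$. For $F\subseteq F'$, the bonding map $f_{F',F}:G.F'\to G.F$ is the identity on inner edge points and sends each vertex of $G.F'$ to the vertex of $G.F$ whose component of $G-F$ includes the corresponding component of $G-F'$. $(\mathcal EG,\mathrm{ETOP})$: an edge-end of $G$ is an equivalence class of rays, two rays being equivalent if no finite edge set separates them; let $\Omega'$ be the set of edge-ends. Topologise $G\cup\Omega'$ by: inner edge points have their usual neighbourhoods; for every finite $F\subseteq E(G)$, component $C$ of $G-F$ and choice of inner points $\lambda_e$ of $e$ ($e\in F$), the set $C\cup\Omega'(F,C)\cup\bigcup_{e=xy\in F,\,x\in C}[x,\lambda_e)$ is open, where $\Omega'(F,C)$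 is the set of edge-ends having a ray in $C$. $\mathcal EG$ is obtained from this space by identifying any two points that have the same open neighbourhoods.
   Formalization: In ETOP, for an edge e of F with both ends in C, the inner points bounding the intervals at its two ends are chosen independently; with one common point λ_e the space would fail to be Hausdorff (e.g. for the infinite complete graph) and the last claim would be false. *)

theory Defs
  imports "HOL-Analysis.Analysis"
begin

section \<open>Graphs\<close>

text \<open>Graphs are simple, of arbitrary cardinality, with edges given as two-element vertex sets.\<close>

definition sgraph :: "'a set \<Rightarrow> 'a set set \<Rightarrow> bool" where
  "sgraph V E \<longleftrightarrow> (\<forall>e\<in>E. \<exists>u\<in>V. \<exists>v\<in>V. u \<noteq> v \<and> e = {u, v})"

definition adjacent :: "'a set set \<Rightarrow> 'a \<Rightarrow> 'a \<Rightarrow> bool" where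
  "adjacent E u v \<longleftrightarrow> {u, v} \<in> E"

definition connected_sgraph :: "'a set \<Rightarrow> 'a set set \<Rightarrow> bool" where
  "connected_sgraph V E \<longleftrightarrow> V \<noteq> {} \<and> (\<forall>u\<in>V. \<forall>v\<in>V. (adjacent E)\<^sup>*\<^sup>* u v)"

text \<open>Components are represented by their vertex sets.\<close>

definition comps :: "'a set \<Rightarrow> 'a set set \<Rightarrow> 'a set set" where
  "comps V E = {{u \<in> V. (adjacent E)\<^sup>*\<^sup>* v u} | v. v \<in> V}"

definition comps_del_verts :: "'a set \<Rightarrow> 'a set set \<Rightarrow> 'a set \<Rightarrow> 'a set set" where
  "comps_del_verts V E X = comps (V - X) {e \<in> E. e \<inter> X = {}}"

definition comps_del_edges :: "'a set \<Rightarrow> 'a set set \<Rightarrow> 'a set set \<Rightarrow> 'a set set" where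
  "comps_del_edges V E F = comps V (E - F)"

section \<open>The 1-complex of a graph\<close>

text \<open>
  The inner points of an edge \<open>e\<close> are \<open>Inner e t\<close> with \<open>0 < t < 1\<close>, where \<open>t\<close> is the distance
  from an arbitrarily chosen end \<open>edge_origin e\<close> of \<open>e\<close>. The type of vertices is kept separate
  from that of the ends of edges, since the vertices of a contraction are vertex sets.
\<close>

datatype ('v, 'a) cpoint = Vert 'v | Inner "'a set" real

definition edge_origin :: "'a set \<Rightarrow> 'a" where
  "edge_origin e = (SOME v. v \<in> e)"

definition dist_from :: "'a set \<Rightarrow> 'a \<Rightarrow> real \<Rightarrow> real" where
  "dist_from e x t = (if x = edge_origin e then t else 1 - t)"

definition inner_edge :: "'a set \<Rightarrow> ('v, 'a) cpoint set" where
  "inner_edge e = Inner e ` {0<..<1}"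

text \<open>For an end \<open>x\<close> of \<open>e\<close>, this is \<open>[x, j)\<close> without \<open>x\<close>, where \<open>j\<close> has distance \<open>r\<close> from \<open>x\<close>.\<close>

definition half_edge :: "'a set \<Rightarrow> 'a \<Rightarrow> real \<Rightarrow> ('v, 'a) cpoint set" where
  "half_edge e x r = Inner e ` {t \<in> {0<..<1}. dist_from e x t < r}"

definition graph_points :: "'v set \<Rightarrow> 'a set set \<Rightarrow> ('v, 'a) cpoint set" where
  "graph_points W D = Vert ` W \<union> (\<Union>e\<in>D. inner_edge e)"

definition inner_opens :: "'a set set \<Rightarrow> ('v, 'a) cpoint set set" where
  "inner_opens E = {Inner e ` T | e T. e \<in> E \<and> open T \<and> T \<subseteq> {0<..<1}}"

definition vertex_nbhds :: "'a set \<Rightarrow> 'a set set \<Rightarrow> ('a, 'a) cpoint set set" where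
  "vertex_nbhds V E =
     {insert (Vert u) (\<Union>e\<in>{e \<in> E. u \<in> e}. half_edge e u (j e)) | u j.
        u \<in> V \<and> (\<forall>e. 0 < j e \<and> j e < 1)}"

definition one_complex :: "'a set \<Rightarrow> 'a set set \<Rightarrow> ('a, 'a) cpoint topology" where
  "one_complex V E = topology_generated_by (inner_opens E \<union> vertex_nbhds V E)"

section \<open>The tangle compactification\<close>

definition ultrafilter_on :: "'b set \<Rightarrow> 'b set set \<Rightarrow> bool" where
  "ultrafilter_on S U \<longleftrightarrow>
     U \<subseteq> Pow S \<and> S \<in> U \<and> {} \<notin> U \<and>
     (\<forall>A\<in>U. \<forall>B\<in>U. A \<inter> B \<in> U) \<and>
     (\<forall>A\<in>U. \<forall>B. A \<subseteq> B \<and> B \<subseteq> S \<longrightarrow> B \<in> U) \<and>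
     (\<forall>A. A \<subseteq> S \<longrightarrow> A \<in> U \<or> S - A \<in> U)"

definition fin_verts :: "'a set \<Rightarrow> 'a set set" where
  "fin_verts V = {X. finite X \<and> X \<subseteq> V}"

definition comp_map :: "'a set \<Rightarrow> 'a set set \<Rightarrow> 'a set \<Rightarrow> 'a set \<Rightarrow> 'a set" where
  "comp_map V E X C' = (THE C. C \<in> comps_del_verts V E X \<and> C' \<subseteq> C)"

definition ultra_map ::
  "'a set \<Rightarrow> 'a set set \<Rightarrow> 'a set \<Rightarrow> 'a set set set \<Rightarrow> 'a set set set" where
  "ultra_map V E X U' =
     {\<C>. \<C> \<subseteq> comps_del_verts V E X \<and> (\<exists>\<C>'\<in>U'. comp_map V E X ` \<C>' \<subseteq> \<C>)}"

definition ultra_families :: "'a set \<Rightarrow> 'a set set \<Rightarrow> ('a set \<Rightarrow> 'a set set set) set" where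
  "ultra_families V E =
     {U \<in> (\<Pi>\<^sub>E X\<in>fin_verts V. {W. ultrafilter_on (comps_del_verts V E X) W}).
        \<forall>X\<in>fin_verts V. \<forall>X'\<in>fin_verts V. X \<subseteq> X' \<longrightarrow> ultra_map V E X (U X') = U X}"

type_synonym 'a tpoint = "('a, 'a) cpoint + ('a set \<Rightarrow> 'a set set set)"

definition tangle_nbhd :: "'a set \<Rightarrow> 'a set set \<Rightarrow> 'a set \<Rightarrow> 'a set set \<Rightarrow> 'a tpoint set" where
  "tangle_nbhd V E X \<C> =
     Inl ` (graph_points (\<Union>\<C>) {e \<in> E. e \<subseteq> \<Union>\<C>} \<union>
            (\<Union>e\<in>{e \<in> E. e \<inter> X \<noteq> {} \<and> e \<inter> \<Union>\<C> \<noteq> {}}. inner_edge e)) \<union>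
     Inr ` {U \<in> ultra_families V E. \<C> \<in> U X}"

definition tangle_space :: "'a set \<Rightarrow> 'a set set \<Rightarrow> 'a tpoint topology" where
  "tangle_space V E = topology_generated_by
     ({Inl ` W | W. openin (one_complex V E) W} \<union>
      {tangle_nbhd V E X \<C> | X \<C>. X \<in> fin_verts V \<and> \<C> \<subseteq> comps_del_verts V E X})"

section \<open>The quotient of the tangle compactification\<close>

definition quotient_topology :: "'b topology \<Rightarrow> ('b \<times> 'b) set \<Rightarrow> 'b set topology" where
  "quotient_topology T r =
     topology (\<lambda>\<S>. \<S> \<subseteq> topspace T // r \<and> openin T {x \<in> topspace T. r `` {x} \<in> \<S>})"

lemma openin_quotient_topology:
  "openin (quotient_topology T r) \<S> \<longleftrightarrow>
     \<S> \<subseteq> topspace T // r \<and> openin T {x \<in> topspace T. r `` {x} \<in> \<S>}"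
proof -
  have "istopology (\<lambda>\<S>. \<S> \<subseteq> topspace T // r \<and> openin T {x \<in> topspace T. r `` {x} \<in> \<S>})"
    unfolding istopology_def
  proof (intro conjI allI impI, goal_cases)
    case (2 A B)
    have "{x \<in> topspace T. r `` {x} \<in> A \<inter> B} =
      {x \<in> topspace T. r `` {x} \<in> A} \<inter> {x \<in> topspace T. r `` {x} \<in> B}" by auto
    then show ?case using 2 by auto
  next
    case (4 K)
    have "{x \<in> topspace T. r `` {x} \<in> \<Union>K} = (\<Union>A\<in>K. {x \<in> topspace T. r `` {x} \<in> A})" by auto
    then show ?case using 4 by auto
  qed auto
  then show ?thesis unfolding quotient_topology_def by (simp add: topology_inverse')
qed

lemma topspace_quotient_topology: "topspace (quotient_topology T r) = topspace T // r"
proof -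
  have "{x \<in> topspace T. r `` {x} \<in> topspace T // r} = topspace T"
    by (auto simp: quotient_def)
  then have "openin (quotient_topology T r) (topspace T // r)"
    by (simp add: openin_quotient_topology)
  then show ?thesis
    by (metis openin_quotient_topology openin_subset openin_topspace subset_antisym)
qed

definition cut_edges :: "'a set set \<Rightarrow> 'a set \<Rightarrow> 'a set \<Rightarrow> 'a set set" where
  "cut_edges E V\<^sub>1 V\<^sub>2 = {e \<in> E. e \<inter> V\<^sub>1 \<noteq> {} \<and> e \<inter> V\<^sub>2 \<noteq> {}}"

definition finite_cut_sides :: "'a set \<Rightarrow> 'a set set \<Rightarrow> 'a set \<Rightarrow> 'a set \<Rightarrow> bool" where
  "finite_cut_sides V E V\<^sub>1 V\<^sub>2 \<longleftrightarrow>
     V\<^sub>1 \<noteq> {} \<and> V\<^sub>2 \<noteq> {} \<and> V\<^sub>1 \<inter> V\<^sub>2 = {} \<and> V\<^sub>1 \<union> V\<^sub>2 = V \<and> finite (cut_edges E V\<^sub>1 V\<^sub>2)"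

definition induced_closure :: "'a set \<Rightarrow> 'a set set \<Rightarrow> 'a set \<Rightarrow> 'a tpoint set" where
  "induced_closure V E W =
     tangle_space V E closure_of (Inl ` graph_points W {e \<in> E. e \<subseteq> W})"

definition finitely_separable :: "'a set \<Rightarrow> 'a set set \<Rightarrow> 'a tpoint \<Rightarrow> 'a tpoint \<Rightarrow> bool" where
  "finitely_separable V E x y \<longleftrightarrow>
     (\<exists>V\<^sub>1 V\<^sub>2. finite_cut_sides V E V\<^sub>1 V\<^sub>2 \<and>
        x \<in> induced_closure V E V\<^sub>1 \<and> y \<in> induced_closure V E V\<^sub>2)"

definition verts_and_tangles :: "'a set \<Rightarrow> 'a set set \<Rightarrow> 'a tpoint set" where
  "verts_and_tangles V E = Inl ` Vert ` V \<union> Inr ` ultra_families V E"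

definition insep_rel :: "'a set \<Rightarrow> 'a set set \<Rightarrow> ('a tpoint \<times> 'a tpoint) set" where
  "insep_rel V E =
     {(x, y). x \<in> verts_and_tangles V E \<and> y \<in> verts_and_tangles V E \<and>
              \<not> finitely_separable V E x y} \<union>
     Id_on (Inl ` (\<Union>e\<in>E. inner_edge e))"

definition tangle_quotient :: "'a set \<Rightarrow> 'a set set \<Rightarrow> 'a tpoint set topology" where
  "tangle_quotient V E = quotient_topology (tangle_space V E) (insep_rel V E)"

section \<open>The inverse limit of the finite contractions\<close>

definition fin_edges :: "'a set set \<Rightarrow> 'a set set set" where
  "fin_edges E = {F. finite F \<and> F \<subseteq> E}"

text \<open>
  The vertices of \<open>G.F\<close> are the components of \<open>G - F\<close>, and its edges are those of \<open>G\<close>. An edge is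
  a loop at \<open>d\<close> iff both its ends lie in \<open>d\<close>, and a non-loop at \<open>d\<close> iff exactly one end does.
\<close>

definition loops :: "'a set set \<Rightarrow> 'a set \<Rightarrow> 'a set set" where
  "loops E d = {e \<in> E. e \<subseteq> d}"

definition contraction_nbhds ::
  "'a set \<Rightarrow> 'a set set \<Rightarrow> 'a set set \<Rightarrow> ('a set, 'a) cpoint set set" where
  "contraction_nbhds V E F =
     {{Vert d} \<union>
      (\<Union>e\<in>{e \<in> E - loops E d. e \<inter> d \<noteq> {}}. \<Union>x\<in>e \<inter> d. half_edge e x (j e)) \<union>
      (\<Union>e\<in>L. inner_edge e - Inner e ` {a e..b e}) \<union>
      (\<Union>e\<in>loops E d - L. inner_edge e) | d j L a b.
        d \<in> comps_del_edges V E F \<and> (\<forall>e. 0 < j e \<and> j e < 1) \<and>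
        finite L \<and> L \<subseteq> loops E d \<and> (\<forall>e. 0 < a e \<and> a e \<le> b e \<and> b e < 1)}"

definition contraction ::
  "'a set \<Rightarrow> 'a set set \<Rightarrow> 'a set set \<Rightarrow> ('a set, 'a) cpoint topology" where
  "contraction V E F = topology_generated_by (inner_opens E \<union> contraction_nbhds V E F)"

fun bonding ::
  "'a set \<Rightarrow> 'a set set \<Rightarrow> 'a set set \<Rightarrow> ('a set, 'a) cpoint \<Rightarrow> ('a set, 'a) cpoint" where
  "bonding V E F (Vert C') = Vert (THE C. C \<in> comps_del_edges V E F \<and> C' \<subseteq> C)"
| "bonding V E F (Inner e t) = Inner e t"

definition inverse_limit ::
  "'a set \<Rightarrow> 'a set set \<Rightarrow> ('a set set \<Rightarrow> ('a set, 'a) cpoint) topology" where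
  "inverse_limit V E =
     subtopology (product_topology (contraction V E) (fin_edges E))
       {p. \<forall>F\<in>fin_edges E. \<forall>F'\<in>fin_edges E. F \<subseteq> F' \<longrightarrow> bonding V E F (p F') = p F}"

section \<open>The edge-end space\<close>

definition ray :: "'a set \<Rightarrow> 'a set set \<Rightarrow> (nat \<Rightarrow> 'a) \<Rightarrow> bool" where
  "ray V E R \<longleftrightarrow> inj R \<and> range R \<subseteq> V \<and> (\<forall>n. {R n, R (Suc n)} \<in> E)"

text \<open>
  A finite edge set separates two rays if they have tails in distinct components of the rest.
\<close>

definition edge_separates ::
  "'a set \<Rightarrow> 'a set set \<Rightarrow> 'a set set \<Rightarrow> (nat \<Rightarrow> 'a) \<Rightarrow> (nat \<Rightarrow> 'a) \<Rightarrow> bool" where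
  "edge_separates V E F R S \<longleftrightarrow>
     (\<exists>C\<in>comps_del_edges V E F. \<exists>D\<in>comps_del_edges V E F. C \<noteq> D \<and>
        (\<exists>m. ray C (E - F) (\<lambda>i. R (m + i))) \<and> (\<exists>n. ray D (E - F) (\<lambda>i. S (n + i))))"

definition ray_equiv :: "'a set \<Rightarrow> 'a set set \<Rightarrow> ((nat \<Rightarrow> 'a) \<times> (nat \<Rightarrow> 'a)) set" where
  "ray_equiv V E =
     {(R, S). ray V E R \<and> ray V E S \<and> \<not> (\<exists>F\<in>fin_edges E. edge_separates V E F R S)}"

definition edge_ends :: "'a set \<Rightarrow> 'a set set \<Rightarrow> (nat \<Rightarrow> 'a) set set" where
  "edge_ends V E = {R. ray V E R} // ray_equiv V E"

definition edge_ends_in ::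
  "'a set \<Rightarrow> 'a set set \<Rightarrow> 'a set set \<Rightarrow> 'a set \<Rightarrow> (nat \<Rightarrow> 'a) set set" where
  "edge_ends_in V E F C = {\<omega> \<in> edge_ends V E. \<exists>R\<in>\<omega>. ray C (E - F) R}"

type_synonym 'a epoint = "('a, 'a) cpoint + (nat \<Rightarrow> 'a) set"

text \<open>
  An edge \<open>e \<in> F\<close> may have both its ends \<open>x, y\<close> in \<open>C\<close>. The inner points bounding the intervals at
  \<open>x\<close> and at \<open>y\<close> are chosen independently, whence \<open>l\<close> depends on the edge and its end. (With one
  common point, neighbourhoods of \<open>x\<close> would omit only finitely many points of any edge whose
  ends are not separated by finitely many edges, and the space would not be Hausdorff.)
\<close>

definition edge_end_nbhds :: "'a set \<Rightarrow> 'a set set \<Rightarrow> 'a epoint set set" where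
  "edge_end_nbhds V E =
     {Inl ` (graph_points C {e \<in> E - F. e \<subseteq> C} \<union>
             (\<Union>e\<in>F. \<Union>x\<in>e \<inter> C. half_edge e x (l e x))) \<union>
      Inr ` edge_ends_in V E F C | F C l.
        F \<in> fin_edges E \<and> C \<in> comps_del_edges V E F \<and> (\<forall>e x. 0 < l e x \<and> l e x < 1)}"

definition edge_end_pretopology :: "'a set \<Rightarrow> 'a set set \<Rightarrow> 'a epoint topology" where
  "edge_end_pretopology V E =
     topology_generated_by ({Inl ` W | W. W \<in> inner_opens E} \<union> edge_end_nbhds V E)"

definition indistinguishable :: "'b topology \<Rightarrow> ('b \<times> 'b) set" where
  "indistinguishable T =
     {(x, y). x \<in> topspace T \<and> y \<in> topspace T \<and> (\<forall>W. openin T W \<longrightarrow> (x \<in> W \<longleftrightarrow> y \<in> W))}"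

definition edge_end_space :: "'a set \<Rightarrow> 'a set set \<Rightarrow> 'a epoint set topology" where
  "edge_end_space V E =
     quotient_topology (edge_end_pretopology V E) (indistinguishable (edge_end_pretopology V E))"

end

theory Submission
  imports Defs
begin

text \<open>
  A point of the inverse limit that is not an inner edge point is a compatible choice of components
  \<open>C F\<close> of \<open>G - F\<close>, for all finite edge sets \<open>F\<close>. Either some vertex lies in all of them, or there is
  a ray with a tail in each of them. The vertices, the edge-ends and the ultrafilter families all
  live in a unique component of \<open>G - F\<close> for every \<open>F\<close>, which maps both the space \<open>G \<union> \<Omega>'\<close> and
  the tangle compactification onto the inverse limit. In the first case the topology is the one
  induced by this map, and since the limit is Hausdorff the map identifies precisely the
  topologically indistinguishable points. In the second case it is a closed map, since the tangle
  compactification is compact, and it identifies precisely the points that are not finitely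
  separable.
\<close>

section \<open>Quotient maps\<close>

text \<open>The space \<open>tangle_space\<close> is compact but in general not Hausdorff: every
  neighbourhood of an ultrafilter family may contain inner points arbitrarily close to a vertex of
  infinite degree. The separation needed for a quotient map therefore has to come from the target,
  and it does: two components of G - F can be told apart in G.F by halving the edges between them.
  Compactness in turn comes from the source, through ultrafilters on the set of its points. What
  ties ultrafilter families to components of G - F is finiteness: as G is connected and F finite, G
  - F has finitely many components, and an ultrafilter on the components of G - X, where X consists
  of the ends of F, must select one of them. If no vertex lies in all components of a compatible
  family, a countable chain of finite edge sets already determines the whole family, and along such
  a chain a ray can be built even when degrees are infinite.\<close>

lemma quotient_topology_homeomorphic_space:
  assumes q: "quotient_map X Y q"
    and r: "\<And>x. x \<in> topspace X \<Longrightarrow> r `` {x} = {y \<in> topspace X. q y = q x}"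
  shows "quotient_topology X r homeomorphic_space Y"
proof -
  \<comment> \<open>Only the classes of points of \<open>X\<close> matter, and these are the fibres
    of \<open>q\<close>; so an arbitrary member of a class has the right image.\<close>
  define f where "f c = q (SOME x. x \<in> c)" for c
  define g where "g y = {x \<in> topspace X. q x = y}" for y
  have f: "f (r `` {x}) = q x" if "x \<in> topspace X" for x
  proof -
    have "x \<in> r `` {x}" using r that by auto
    then have "(SOME y. y \<in> r `` {x}) \<in> r `` {x}" by (rule someI)
    then show ?thesis using r[OF that] unfolding f_def by auto
  qed
  have g: "g (q x) = r `` {x}" if "x \<in> topspace X" for x
    using r[OF that] by (auto simp: g_def)
  have surj: "q ` topspace X = topspace Y" using q by (rule quotient_imp_surjective_map)
  have opn: "openin X {x \<in> topspace X. q x \<in> W} \<longleftrightarrow> openin Y W" if "W \<subseteq> topspace Y" for W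
    using q that unfolding quotient_map_def by blast
  have "homeomorphic_maps (quotient_topology X r) Y f g"
    unfolding homeomorphic_maps_def
  proof (intro conjI ballI)
    show "continuous_map (quotient_topology X r) Y f"
      unfolding continuous_map_def
    proof (intro conjI allI impI)
      show "f \<in> topspace (quotient_topology X r) \<rightarrow> topspace Y"
        using f surj by (auto simp: topspace_quotient_topology quotient_def)
      fix W assume W: "openin Y W"
      have "{x \<in> topspace X. r `` {x} \<in> {c \<in> topspace X // r. f c \<in> W}} = {x \<in> topspace X. q x \<in> W}"
        using f by (auto simp: quotientI)
      then show "openin (quotient_topology X r) {c \<in> topspace (quotient_topology X r). f c \<in> W}"
        using opn[OF openin_subset[OF W]] W
        by (simp add: openin_quotient_topology topspace_quotient_topology)
    qed
    show "continuous_map Y (quotient_topology X r) g"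
      unfolding continuous_map_def
    proof (intro conjI allI impI)
      show "g \<in> topspace Y \<rightarrow> topspace (quotient_topology X r)"
        using g surj[symmetric] by (auto simp: topspace_quotient_topology quotientI)
      fix W assume W: "openin (quotient_topology X r) W"
      have "{x \<in> topspace X. q x \<in> {y \<in> topspace Y. g y \<in> W}} = {x \<in> topspace X. r `` {x} \<in> W}"
        using g surj by auto
      then show "openin Y {y \<in> topspace Y. g y \<in> W}"
        using W opn[of "{y \<in> topspace Y. g y \<in> W}"] by (simp add: openin_quotient_topology)
    qed
  next
    fix c assume "c \<in> topspace (quotient_topology X r)"
    then show "g (f c) = c" using f g by (auto simp: topspace_quotient_topology quotient_def)
  next
    fix y assume "y \<in> topspace Y"
    then obtain x where "x \<in> topspace X" "y = q x" using surj by blast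
    then show "f (g y) = y" using f g by simp
  qed
  then show ?thesis unfolding homeomorphic_space_def by blast
qed

text \<open>Preimages under \<open>q\<close> are closed under finite intersections and unions, so
  every open set, not only a generator, is the preimage of an open set. Hence the surjection
  \<open>q\<close> is open, and it identifies exactly the indistinguishable points: points with
  equal images cannot be told apart by preimages, and points with different images can because
  \<open>Y\<close> is Hausdorff.\<close>

lemma indistinguishable_quotient_homeomorphic_space:
  assumes cont: "continuous_map (topology_generated_by S) Y q"
    and surj: "q ` topspace (topology_generated_by S) = topspace Y"
    and gen: "\<And>A. A \<in> S \<Longrightarrow> \<exists>B. openin Y B \<and> A = {x \<in> topspace (topology_generated_by S). q x \<in> B}"
    and Haus: "Hausdorff_space Y"
  shows "quotient_topology (topology_generated_by S) (indistinguishable (topology_generated_by S))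
      homeomorphic_space Y"
proof (rule quotient_topology_homeomorphic_space)
  let ?X = "topology_generated_by S"
  have pull: "\<exists>B. openin Y B \<and> A = {x \<in> topspace ?X. q x \<in> B}" if "openin ?X A" for A
  proof -
    have "generate_topology_on S A" using that by (simp add: openin_topology_generated_by_iff)
    then show ?thesis
    proof induction
      case Empty
      then show ?case by (intro exI[of _ "{}"]) auto
    next
      case (Int a b)
      then obtain B C where "openin Y B" "a = {x \<in> topspace ?X. q x \<in> B}"
        "openin Y C" "b = {x \<in> topspace ?X. q x \<in> C}" by blast
      then show ?case by (intro exI[of _ "B \<inter> C"]) auto
    next
      case (UN K)
      then obtain B where B: "\<And>k. k \<in> K \<Longrightarrow> openin Y (B k) \<and> k = {x \<in> topspace ?X. q x \<in> B k}"
        by metis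
      have "\<Union>K = {x \<in> topspace ?X. q x \<in> \<Union>(B ` K)}"
      proof (intro set_eqI iffI)
        fix x assume "x \<in> \<Union>K"
        then obtain k where k: "k \<in> K" "x \<in> k" by blast
        then have "x \<in> {x \<in> topspace ?X. q x \<in> B k}" using B by blast
        then show "x \<in> {x \<in> topspace ?X. q x \<in> \<Union>(B ` K)}" using k by blast
      next
        fix x assume "x \<in> {x \<in> topspace ?X. q x \<in> \<Union>(B ` K)}"
        then obtain k where "k \<in> K" "x \<in> {x \<in> topspace ?X. q x \<in> B k}" by blast
        then show "x \<in> \<Union>K" using B by blast
      qed
      moreover have "openin Y (\<Union>(B ` K))" using B by blast
      ultimately show ?case by blast
    next
      case (Basis s)
      then show ?case by (rule gen)
    qed
  qed
  have "open_map ?X Y q"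
    unfolding open_map_def
  proof (intro allI impI)
    fix A assume "openin ?X A"
    then obtain B where B: "openin Y B" "A = {x \<in> topspace ?X. q x \<in> B}" using pull by blast
    have "q ` A = B"
    proof
      show "q ` A \<subseteq> B" using B(2) by blast
      show "B \<subseteq> q ` A"
      proof
        fix y assume y: "y \<in> B"
        then have "y \<in> q ` topspace ?X" using surj openin_subset[OF B(1)] by blast
        then show "y \<in> q ` A" using y B(2) by blast
      qed
    qed
    then show "openin Y (q ` A)" using B by simp
  qed
  then show "quotient_map ?X Y q" using cont surj by (intro continuous_open_imp_quotient_map)
  fix x assume x: "x \<in> topspace ?X"
  show "indistinguishable ?X `` {x} = {y \<in> topspace ?X. q y = q x}"
  proof (intro set_eqI iffI)
    fix y assume "y \<in> indistinguishable ?X `` {x}"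
    then have y: "y \<in> topspace ?X" and ind: "\<And>W. openin ?X W \<Longrightarrow> x \<in> W \<longleftrightarrow> y \<in> W"
      by (auto simp: indistinguishable_def)
    have "q y = q x"
    proof (rule ccontr)
      assume ne: "q y \<noteq> q x"
      have "q y \<in> topspace Y" "q x \<in> topspace Y" using surj x y by auto
      with ne Haus obtain A B where AB: "openin Y A" "q x \<in> A" "q y \<in> B" "disjnt A B"
        unfolding Hausdorff_space_def by metis
      have "openin ?X {z \<in> topspace ?X. q z \<in> A}"
        using cont AB(1) by (rule openin_continuous_map_preimage)
      from ind[OF this] AB x y show False by (auto simp: disjnt_def)
    qed
    with y show "y \<in> {y \<in> topspace ?X. q y = q x}" by simp
  next
    fix y assume y: "y \<in> {y \<in> topspace ?X. q y = q x}"
    have "x \<in> W \<longleftrightarrow> y \<in> W" if W: "openin ?X W" for W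
    proof -
      obtain B where "W = {x \<in> topspace ?X. q x \<in> B}" using pull[OF W] by blast
      then show ?thesis using x y by simp
    qed
    then show "y \<in> indistinguishable ?X `` {x}" using x y by (simp add: indistinguishable_def)
  qed
qed

section \<open>Ultrafilters\<close>

text \<open>The ultrafilter lemma, by Zorn's lemma on the families of subsets of \<open>S\<close>
  that extend \<open>\<B>\<close> and have the finite intersection property. The factor
  \<open>S\<close> in \<open>S \<inter> \<Inter>\<G>\<close> covers the empty \<open>\<G>\<close>,
  whose intersection is the whole type.\<close>

lemma ultrafilter_on_exists:
  assumes fip: "\<And>\<G>. finite \<G> \<Longrightarrow> \<G> \<subseteq> \<B> \<Longrightarrow> S \<inter> \<Inter>\<G> \<noteq> {}" and sub: "\<B> \<subseteq> Pow S"
  shows "\<exists>\<F>. ultrafilter_on S \<F> \<and> \<B> \<subseteq> \<F>"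
proof -
  define P where "P = {\<A>. \<B> \<subseteq> \<A> \<and> \<A> \<subseteq> Pow S \<and> (\<forall>\<G>. finite \<G> \<longrightarrow> \<G> \<subseteq> \<A> \<longrightarrow> S \<inter> \<Inter>\<G> \<noteq> {})}"
  have BP: "\<B> \<in> P" using assms by (auto simp: P_def)
  have "\<exists>U\<in>P. \<forall>A\<in>\<C>. A \<subseteq> U" if ch: "subset.chain P \<C>" for \<C>
  proof (cases "\<C> = {}")
    case True
    then show ?thesis using BP by blast
  next
    case False
    have "S \<inter> \<Inter>\<G> \<noteq> {}" if fin: "finite \<G>" "\<G> \<subseteq> \<Union>\<C>" for \<G>
    proof -
      obtain A where "A \<in> \<C>" "\<G> \<subseteq> A"
        using finite_subset_Union_chain[OF fin False ch] by blast
      then show ?thesis using fin ch by (auto simp: P_def subset_chain_def)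
    qed
    moreover have "\<B> \<subseteq> A \<and> A \<subseteq> Pow S" if "A \<in> \<C>" for A
      using ch that by (auto simp: P_def subset_chain_def)
    then have "\<B> \<subseteq> \<Union>\<C>" "\<Union>\<C> \<subseteq> Pow S" using False by blast+
    ultimately have "\<Union>\<C> \<in> P" unfolding P_def by blast
    then show ?thesis by blast
  qed
  then obtain M where M: "M \<in> P" and max: "\<And>X. X \<in> P \<Longrightarrow> M \<subseteq> X \<Longrightarrow> X = M"
    using subset_Zorn[of P] by metis
  have MS: "\<B> \<subseteq> M" "M \<subseteq> Pow S" and Mf: "\<And>\<G>. finite \<G> \<Longrightarrow> \<G> \<subseteq> M \<Longrightarrow> S \<inter> \<Inter>\<G> \<noteq> {}"
    using M by (auto simp: P_def)
  \<comment> \<open>Maximality: a subset of \<open>S\<close> that meets all finite intersections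
    from \<open>M\<close> can be added to \<open>M\<close>, so it is already there.\<close>
  have ext: "A \<in> M" if "A \<subseteq> S" and A: "\<And>\<G>. finite \<G> \<Longrightarrow> \<G> \<subseteq> M \<Longrightarrow> A \<inter> \<Inter>\<G> \<noteq> {}" for A
  proof -
    have "S \<inter> \<Inter>\<G> \<noteq> {}" if G: "finite \<G>" "\<G> \<subseteq> insert A M" for \<G>
    proof -
      have "finite (\<G> - {A})" "\<G> - {A} \<subseteq> M" using G by auto
      then have "A \<inter> \<Inter>(\<G> - {A}) \<noteq> {}" by (rule A)
      then show ?thesis using \<open>A \<subseteq> S\<close> by blast
    qed
    moreover have "\<B> \<subseteq> insert A M" "insert A M \<subseteq> Pow S" using MS \<open>A \<subseteq> S\<close> by auto
    ultimately have "insert A M \<in> P" by (simp only: P_def mem_Collect_eq) simp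
    then show ?thesis using max by blast
  qed
  have up: "B \<in> M" if "\<G> \<subseteq> M" "finite \<G>" "S \<inter> \<Inter>\<G> \<subseteq> B" "B \<subseteq> S" for B \<G>
  proof (rule ext)
    fix \<H> assume "finite \<H>" "\<H> \<subseteq> M"
    then have "S \<inter> \<Inter>(\<G> \<union> \<H>) \<noteq> {}" using that by (intro Mf) auto
    then show "B \<inter> \<Inter>\<H> \<noteq> {}" using that by blast
  qed fact
  have "ultrafilter_on S M"
    unfolding ultrafilter_on_def
  proof (intro conjI ballI allI impI)
    show "M \<subseteq> Pow S" by fact
    show "S \<in> M" using up[of "{}"] by auto
    show "{} \<notin> M" using Mf[of "{{}}"] by auto
    show "A \<inter> B \<in> M" if "A \<in> M" "B \<in> M" for A B using up[of "{A, B}"] that MS by auto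
    show "B \<in> M" if "A \<in> M" "A \<subseteq> B \<and> B \<subseteq> S" for A B using up[of "{A}" B] that by auto
    show "A \<in> M \<or> S - A \<in> M" if "A \<subseteq> S" for A
    proof (rule ccontr)
      assume n: "\<not> (A \<in> M \<or> S - A \<in> M)"
      then have "A \<notin> M" by simp
      \<comment> \<open>A finite intersection from \<open>M\<close> that misses \<open>A\<close>
        lies, within \<open>S\<close>, in the complement of \<open>A\<close>.\<close>
      then obtain \<G> where G: "finite \<G>" "\<G> \<subseteq> M" "A \<inter> \<Inter>\<G> = {}" using ext[OF \<open>A \<subseteq> S\<close>] by meson
      have "S - A \<in> M" using G by (intro up[of \<G>]) auto
      then show False using n by blast
    qed
  qed
  then show ?thesis using MS by blast
qed

lemma ultrafilter_on_superset:
  "ultrafilter_on S U \<Longrightarrow> A \<in> U \<Longrightarrow> A \<subseteq> B \<Longrightarrow> B \<subseteq> S \<Longrightarrow> B \<in> U"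
  unfolding ultrafilter_on_def by blast

lemma ultrafilter_on_Int_nonempty:
  "ultrafilter_on S U \<Longrightarrow> A \<in> U \<Longrightarrow> B \<in> U \<Longrightarrow> A \<inter> B \<noteq> {}"
  unfolding ultrafilter_on_def by metis

text \<open>If no set of the finite cover were in \<open>U\<close>, all complements would be, and so
  would their intersection, which is empty. Later this selects one of finitely many
  components.\<close>

lemma ultrafilter_on_finite_Union:
  assumes U: "ultrafilter_on S U" and "finite \<A>" "\<Union>\<A> = S"
  shows "\<exists>A\<in>\<A>. A \<in> U"
proof (rule ccontr)
  assume n: "\<not> (\<exists>A\<in>\<A>. A \<in> U)"
  have "S - \<Union>\<B> \<in> U" if "finite \<B>" "\<B> \<subseteq> \<A>" for \<B>
    using that
  proof (induction \<B>)
    case empty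
    then show ?case using U by (simp add: ultrafilter_on_def)
  next
    case (insert B \<B>)
    then have "B \<notin> U" "B \<subseteq> S" using n assms(3) by auto
    then have "S - B \<in> U" using U unfolding ultrafilter_on_def by blast
    moreover have "S - \<Union>\<B> \<in> U" using insert by simp
    ultimately have "(S - B) \<inter> (S - \<Union>\<B>) \<in> U" using U unfolding ultrafilter_on_def by blast
    moreover have "(S - B) \<inter> (S - \<Union>\<B>) = S - \<Union>(insert B \<B>)" by blast
    ultimately show ?case by simp
  qed
  from this[OF assms(2) order_refl] assms(3) U show False by (simp add: ultrafilter_on_def)
qed

text \<open>If a cover has no finite subcover, the complements of its members have the finite
  intersection property and lie in an ultrafilter, which then has no limit. Such an ultrafilter
  contains no compact set either, since finitely many members of the cover would cover it. So limits
  are only required of ultrafilters that avoid all compact sets; in the tangle compactification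
  these are the ones that tend to an ultrafilter family.\<close>

lemma compact_space_ultrafilterI:
  assumes lim: "\<And>\<FF>. ultrafilter_on (topspace T) \<FF> \<Longrightarrow> (\<And>K. compactin T K \<Longrightarrow> K \<notin> \<FF>) \<Longrightarrow>
    \<exists>x\<in>topspace T. \<forall>W. openin T W \<and> x \<in> W \<longrightarrow> (\<exists>N\<in>\<FF>. N \<subseteq> W)"
  shows "compact_space T"
  unfolding compact_space_def compactin_def
proof (intro conjI allI impI)
  fix \<U> assume \<U>: "(\<forall>W\<in>\<U>. openin T W) \<and> topspace T \<subseteq> \<Union>\<U>"
  show "\<exists>\<F>. finite \<F> \<and> \<F> \<subseteq> \<U> \<and> topspace T \<subseteq> \<Union>\<F>"
  proof (rule ccontr)
    assume n: "\<not> (\<exists>\<F>. finite \<F> \<and> \<F> \<subseteq> \<U> \<and> topspace T \<subseteq> \<Union>\<F>)"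
    have "\<exists>\<FF>. ultrafilter_on (topspace T) \<FF> \<and> (\<lambda>W. topspace T - W) ` \<U> \<subseteq> \<FF>"
    proof (rule ultrafilter_on_exists)
      fix \<G> assume "finite \<G>" "\<G> \<subseteq> (\<lambda>W. topspace T - W) ` \<U>"
      then obtain \<F> where F: "\<F> \<subseteq> \<U>" "finite \<F>" "\<G> = (\<lambda>W. topspace T - W) ` \<F>"
        by (meson finite_subset_image)
      then have "\<not> topspace T \<subseteq> \<Union>\<F>" using n by blast
      then show "topspace T \<inter> \<Inter>\<G> \<noteq> {}" using F(3) by blast
    qed blast
    then obtain \<FF> where FF: "ultrafilter_on (topspace T) \<FF>" and co: "\<And>W. W \<in> \<U> \<Longrightarrow> topspace T - W \<in> \<FF>"
      by blast
    have "K \<notin> \<FF>" if K: "compactin T K" for K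
    proof
      assume KF: "K \<in> \<FF>"
      have KS: "K \<subseteq> topspace T" using K by (rule compactin_subset_topspace)
      then have "K \<subseteq> \<Union>\<U>" using \<U> by (meson order_trans)
      then have "\<exists>\<F>. finite \<F> \<and> \<F> \<subseteq> \<U> \<and> K \<subseteq> \<Union>\<F>"
        using \<U> by (intro compactinD[OF K]) simp_all
      then obtain \<F> where F: "finite \<F>" "\<F> \<subseteq> \<U>" "K \<subseteq> \<Union>\<F>" by (elim exE conjE)
      have "\<Union>(insert (topspace T - K) ((\<lambda>W. topspace T \<inter> W) ` \<F>)) = topspace T"
        using F(3) by blast
      then have "\<exists>A\<in>insert (topspace T - K) ((\<lambda>W. topspace T \<inter> W) ` \<F>). A \<in> \<FF>"
        using F(1) by (intro ultrafilter_on_finite_Union[OF FF]) auto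
      then consider "topspace T - K \<in> \<FF>" | W where "W \<in> \<U>" "topspace T \<inter> W \<in> \<FF>" using F(2) by blast
      then show False
      proof cases
        case 1
        then show False using ultrafilter_on_Int_nonempty[OF FF KF] by blast
      next
        case 2
        then show False using ultrafilter_on_Int_nonempty[OF FF 2(2) co[OF 2(1)]] by blast
      qed
    qed
    then have "\<exists>x\<in>topspace T. \<forall>W. openin T W \<and> x \<in> W \<longrightarrow> (\<exists>N\<in>\<FF>. N \<subseteq> W)"
      by (rule lim[OF FF])
    then obtain x where x: "x \<in> topspace T"
      "\<And>W. openin T W \<Longrightarrow> x \<in> W \<Longrightarrow> \<exists>N\<in>\<FF>. N \<subseteq> W" by blast
    have "x \<in> \<Union>\<U>" using \<U> x(1) by blast
    then obtain W where W: "W \<in> \<U>" "x \<in> W" by blast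
    then obtain N where "N \<in> \<FF>" "N \<subseteq> W" using x(2)[of W] \<U> by blast
    then show False using ultrafilter_on_Int_nonempty[OF FF _ co[OF W(1)], of N] by blast
  qed
qed simp

section \<open>Components\<close>

definition comp_at :: "'a set \<Rightarrow> 'a set set \<Rightarrow> 'a \<Rightarrow> 'a set" where
  "comp_at V D v = {u \<in> V. (adjacent D)\<^sup>*\<^sup>* v u}"

lemma adjacent_rtranclp_sym: "(adjacent D)\<^sup>*\<^sup>* u v \<Longrightarrow> (adjacent D)\<^sup>*\<^sup>* v u"
proof -
  have "symp (adjacent D)" by (auto simp: symp_def adjacent_def insert_commute)
  then show "(adjacent D)\<^sup>*\<^sup>* u v \<Longrightarrow> (adjacent D)\<^sup>*\<^sup>* v u" by (metis symp_rtranclp sympD)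
qed

lemma comp_at_in_comps: "v \<in> V \<Longrightarrow> comp_at V D v \<in> comps V D"
  by (auto simp: comps_def comp_at_def)

lemma in_comp_at: "v \<in> V \<Longrightarrow> v \<in> comp_at V D v"
  by (simp add: comp_at_def)

lemma comps_subset: "C \<in> comps V D \<Longrightarrow> C \<subseteq> V"
  by (auto simp: comps_def)

lemma comps_nonempty: "C \<in> comps V D \<Longrightarrow> C \<noteq> {}"
  by (auto simp: comps_def)

lemma comps_eq_comp_at: "C \<in> comps V D \<Longrightarrow> v \<in> C \<Longrightarrow> C = comp_at V D v"
proof -
  assume "C \<in> comps V D" "v \<in> C"
  then obtain x where C: "C = {u \<in> V. (adjacent D)\<^sup>*\<^sup>* x u}" and "(adjacent D)\<^sup>*\<^sup>* x v"
    by (auto simp: comps_def)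
  then have "(adjacent D)\<^sup>*\<^sup>* x u \<longleftrightarrow> (adjacent D)\<^sup>*\<^sup>* v u" for u
    by (meson adjacent_rtranclp_sym rtranclp_trans)
  then show ?thesis unfolding C comp_at_def by simp
qed

lemma comps_disjoint: "C \<in> comps V D \<Longrightarrow> C' \<in> comps V D \<Longrightarrow> v \<in> C \<Longrightarrow> v \<in> C' \<Longrightarrow> C = C'"
  using comps_eq_comp_at[of C V D v] comps_eq_comp_at[of C' V D v] by simp

lemma Union_comps: "\<Union>(comps V D) = V"
proof
  show "\<Union>(comps V D) \<subseteq> V" by (simp add: Sup_le_iff comps_subset)
  show "V \<subseteq> \<Union>(comps V D)" using comp_at_in_comps in_comp_at by (metis UnionI subsetI)
qed

lemma comps_step: "C \<in> comps V D \<Longrightarrow> u \<in> C \<Longrightarrow> {u, w} \<in> D \<Longrightarrow> w \<in> V \<Longrightarrow> w \<in> C"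
  unfolding comps_def by (auto simp: adjacent_def intro: rtranclp.rtrancl_into_rtrancl)

text \<open>A component is connected, so a set that contains one of its vertices and is never left
  along its edges contains all of it. The closure step may assume that both ends of the edge lie in
  \<open>C\<close>.\<close>

lemma comps_subset_closed:
  assumes C: "C \<in> comps V D" and "\<Union>D \<subseteq> V" and v: "v \<in> C" "v \<in> A"
    and step: "\<And>u w. u \<in> A \<Longrightarrow> u \<in> C \<Longrightarrow> {u, w} \<in> D \<Longrightarrow> w \<in> C \<Longrightarrow> w \<in> A"
  shows "C \<subseteq> A"
proof
  fix u assume "u \<in> C"
  then have "(adjacent D)\<^sup>*\<^sup>* v u" using comps_eq_comp_at[OF C v(1)] by (simp add: comp_at_def)
  then have "u \<in> A \<and> u \<in> C"
  proof induction
    case base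
    then show ?case using v by simp
  next
    case (step y z)
    then have "{y, z} \<in> D" by (simp add: adjacent_def)
    moreover from this have "z \<in> C" using step comps_step[OF C, of y z] assms(2) by blast
    ultimately show ?case using assms(5)[of y z] step by blast
  qed
  then show "u \<in> A" by simp
qed

text \<open>Only the edges inside \<open>C'\<close> have to survive in \<open>D\<close>. This one
  statement therefore compares deletions of edges, deletions of vertices, and the two kinds with
  each other.\<close>

lemma comps_subset_comps:
  assumes C': "C' \<in> comps V' D'" and C: "C \<in> comps V D" and "\<Union>D' \<subseteq> V'" "V' \<subseteq> V"
    and D: "\<And>e. e \<in> D' \<Longrightarrow> e \<subseteq> C' \<Longrightarrow> e \<in> D" and v: "v \<in> C'" "v \<in> C"
  shows "C' \<subseteq> C"
proof (rule comps_subset_closed[OF C' assms(3) v])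
  fix u w assume "u \<in> C" "u \<in> C'" "{u, w} \<in> D'" "w \<in> C'"
  then show "w \<in> C" using D[of "{u, w}"] comps_subset[OF C'] assms(4)
    by (intro comps_step[OF C, of u w]) auto
qed

text \<open>Evaluates the descriptions in \<open>comp_map\<close> and \<open>bonding\<close>, whose
  argument is a nonempty set inside a single component.\<close>

lemma the_comps:
  assumes "C \<in> comps V D" "S \<noteq> {}" "S \<subseteq> C"
  shows "(THE C. C \<in> comps V D \<and> S \<subseteq> C) = C"
proof (rule the_equality)
  show "C \<in> comps V D \<and> S \<subseteq> C" using assms by simp
  fix C' assume "C' \<in> comps V D \<and> S \<subseteq> C'"
  then show "C' = C" using assms comps_disjoint[of C' V D C] by blast
qed

section \<open>Components and rays of a connected graph\<close>

locale conn_graph =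
  fixes V :: "'a set" and E :: "'a set set"
  assumes graph: "sgraph V E" and conn: "connected_sgraph V E"
begin

abbreviation "CE F \<equiv> comps_del_edges V E F"
abbreviation "CX X \<equiv> comps_del_verts V E X"

lemma edgeE:
  assumes "e \<in> E"
  obtains u v where "e = {u, v}" "u \<noteq> v" "u \<in> V" "v \<in> V"
proof -
  have "\<exists>u\<in>V. \<exists>v\<in>V. u \<noteq> v \<and> e = {u, v}" using graph assms by (simp add: sgraph_def)
  then show ?thesis using that by blast
qed

lemma edge_subset: "e \<in> E \<Longrightarrow> e \<subseteq> V"
  using edgeE by blast

lemma Union_edges_subset: "\<Union>(E - F) \<subseteq> V"
  using edge_subset by auto

lemma Union_edges_avoiding_subset: "\<Union>{e \<in> E. e \<inter> X = {}} \<subseteq> V - X"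
  using edge_subset by fastforce

text \<open>The form in which the connectedness of the graph enters the later arguments.\<close>

lemma V_subset_closed:
  assumes "v \<in> V" "v \<in> A" and step: "\<And>u w. u \<in> A \<Longrightarrow> {u, w} \<in> E \<Longrightarrow> w \<in> A"
  shows "V \<subseteq> A"
proof
  fix u assume "u \<in> V"
  then have "(adjacent E)\<^sup>*\<^sup>* v u" using conn assms by (auto simp: connected_sgraph_def)
  then show "u \<in> A"
    by induction (use assms in \<open>auto simp: adjacent_def\<close>)
qed

definition compE :: "'a set set \<Rightarrow> 'a \<Rightarrow> 'a set" where
  "compE F v = comp_at V (E - F) v"

lemma compE_in: "v \<in> V \<Longrightarrow> compE F v \<in> CE F"
  by (simp add: compE_def comps_del_edges_def comp_at_in_comps)

lemma in_compE: "v \<in> V \<Longrightarrow> v \<in> compE F v"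
  by (simp add: compE_def in_comp_at)

lemma compE_eq: "C \<in> CE F \<Longrightarrow> v \<in> C \<Longrightarrow> compE F v = C"
  using comps_eq_comp_at[of C V "E - F" v] by (simp add: compE_def comps_del_edges_def)

lemma CE_subset: "C \<in> CE F \<Longrightarrow> C \<subseteq> V"
  by (simp add: comps_del_edges_def comps_subset)

lemma CE_nonempty: "C \<in> CE F \<Longrightarrow> C \<noteq> {}"
  by (simp add: comps_del_edges_def comps_nonempty)

lemma CE_disjoint: "C \<in> CE F \<Longrightarrow> D \<in> CE F \<Longrightarrow> v \<in> C \<Longrightarrow> v \<in> D \<Longrightarrow> C = D"
  unfolding comps_del_edges_def by (rule comps_disjoint)

lemma CE_mono:
  assumes "C' \<in> CE F'" "C \<in> CE F" "F \<subseteq> F'" "v \<in> C'" "v \<in> C"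
  shows "C' \<subseteq> C"
  using assms Union_edges_subset
  by (intro comps_subset_comps[of C' V "E - F'" C V "E - F" v]) (auto simp: comps_del_edges_def)

lemma CE_edge:
  assumes C: "C \<in> CE F" and e: "e \<in> E" "e \<notin> F" "x \<in> e" "x \<in> C"
  shows "e \<subseteq> C"
proof -
  obtain w where w: "e = {x, w}" "w \<in> V" using edgeE[OF e(1)] e(3) by (metis insert_commute insertE singletonD)
  then have "w \<in> C" using e C unfolding comps_del_edges_def by (intro comps_step[of C V "E - F" x w]) auto
  then show ?thesis using w e by simp
qed

lemma fin_edges_Union: "F \<in> fin_edges E \<Longrightarrow> \<Union>F \<in> fin_verts V"
proof -
  assume F: "F \<in> fin_edges E"
  have "finite e" if "e \<in> E" for e using edgeE[OF that] by (metis finite.emptyI finite_insert)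
  then have "finite (\<Union>F)" using F by (intro finite_Union) (auto simp: fin_edges_def)
  moreover have "\<Union>F \<subseteq> V" using F edge_subset by (auto simp: fin_edges_def)
  ultimately show ?thesis by (simp add: fin_verts_def)
qed

lemma fin_edges_Un: "F \<in> fin_edges E \<Longrightarrow> F' \<in> fin_edges E \<Longrightarrow> F \<union> F' \<in> fin_edges E"
  by (auto simp: fin_edges_def)

text \<open>A component that contains no end of a deleted edge is closed under all edges of the
  graph and hence is \<open>V\<close>. Every other component is that of one of the finitely many
  ends of \<open>F\<close>.\<close>

lemma finite_CE:
  assumes "F \<in> fin_edges E"
  shows "finite (CE F)"
proof (rule finite_subset)
  show "CE F \<subseteq> insert V (compE F ` \<Union>F)"
  proof
    fix C assume C: "C \<in> CE F"
    show "C \<in> insert V (compE F ` \<Union>F)"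
    proof (cases "C \<inter> \<Union>F = {}")
      case True
      obtain v where v: "v \<in> C" using CE_nonempty[OF C] by blast
      have "V \<subseteq> C"
      proof (rule V_subset_closed)
        show "v \<in> V" "v \<in> C" using v CE_subset[OF C] by auto
        fix u w assume "u \<in> C" "{u, w} \<in> E"
        then show "w \<in> C" using CE_edge[OF C, of "{u, w}" u] True by blast
      qed
      then show ?thesis using CE_subset[OF C] by auto
    next
      case False
      then show ?thesis using compE_eq[OF C] by blast
    qed
  qed
  show "finite (insert V (compE F ` \<Union>F))" using fin_edges_Union[OF assms] by (simp add: fin_verts_def)
qed

lemma CX_subset: "c \<in> CX X \<Longrightarrow> c \<subseteq> V - X"
  unfolding comps_del_verts_def by (rule comps_subset)

lemma CX_nonempty: "c \<in> CX X \<Longrightarrow> c \<noteq> {}"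
  unfolding comps_del_verts_def by (rule comps_nonempty)

lemma CX_disjoint: "c \<in> CX X \<Longrightarrow> d \<in> CX X \<Longrightarrow> v \<in> c \<Longrightarrow> v \<in> d \<Longrightarrow> c = d"
  unfolding comps_del_verts_def by (rule comps_disjoint)

lemma Union_CX: "\<Union>(CX X) = V - X"
  unfolding comps_del_verts_def by (rule Union_comps)

lemma CX_edge:
  assumes c: "c \<in> CX X" and e: "e \<in> E" "e \<inter> X = {}" "x \<in> e" "x \<in> c"
  shows "e \<subseteq> c"
proof -
  obtain w where w: "e = {x, w}" "w \<in> V" using edgeE[OF e(1)] e(3) by (metis insert_commute insertE singletonD)
  then have "w \<in> c" using e c unfolding comps_del_verts_def
    by (intro comps_step[of c "V - X" "{e \<in> E. e \<inter> X = {}}" x w]) auto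
  then show ?thesis using w e by simp
qed

lemma CX_mono:
  assumes "c' \<in> CX X'" "c \<in> CX X" "X \<subseteq> X'" "v \<in> c'" "v \<in> c"
  shows "c' \<subseteq> c"
  using assms Union_edges_avoiding_subset
  by (intro comps_subset_comps[of c' "V - X'" "{e \<in> E. e \<inter> X' = {}}" c "V - X" "{e \<in> E. e \<inter> X = {}}" v])
     (auto simp: comps_del_verts_def)

text \<open>Deleting \<open>X\<close> removes every edge of \<open>F\<close> as well, since
  \<open>X\<close> contains the ends of \<open>F\<close>. This is the bridge from vertex deletions,
  on which ultrafilter families are defined, to edge deletions.\<close>

lemma CX_subset_CE:
  assumes "c \<in> CX X" "C \<in> CE F" "\<Union>F \<subseteq> X" "v \<in> c" "v \<in> C"
  shows "c \<subseteq> C"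
proof (rule comps_subset_comps[of c "V - X" "{e \<in> E. e \<inter> X = {}}" C V "E - F" v])
  fix e assume e: "e \<in> {e \<in> E. e \<inter> X = {}}"
  obtain u where "u \<in> e" using e edgeE by blast
  then show "e \<in> E - F" using assms(3) e by auto
qed (use assms Union_edges_avoiding_subset in \<open>auto simp: comps_del_verts_def comps_del_edges_def\<close>)

lemma comp_map_eq:
  assumes "c' \<in> CX X'" "c \<in> CX X" "X \<subseteq> X'" "v \<in> c'" "v \<in> c"
  shows "comp_map V E X c' = c"
  using the_comps[of c "V - X" "{e \<in> E. e \<inter> X = {}}" c'] CX_mono[OF assms] assms CX_nonempty[OF assms(1)]
  by (simp add: comp_map_def comps_del_verts_def)

lemma comp_map_in:
  assumes "c' \<in> CX X'" "X \<subseteq> X'"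
  shows "comp_map V E X c' \<in> CX X \<and> c' \<subseteq> comp_map V E X c'"
proof -
  obtain v where v: "v \<in> c'" using CX_nonempty[OF assms(1)] by blast
  then have "v \<in> V - X" using CX_subset[OF assms(1)] assms(2) by blast
  then obtain c where c: "c \<in> CX X" "v \<in> c" using Union_CX by blast
  then show ?thesis using comp_map_eq[OF assms(1) c(1) assms(2) v c(2)] CX_mono[OF assms(1) c(1) assms(2) v c(2)]
    by simp
qed

section \<open>Rays and the components containing their tails\<close>

lemma ray_eventually_notin:
  assumes "ray V E R" "finite S"
  shows "\<exists>m. \<forall>i\<ge>m. R i \<notin> S"
proof -
  have "finite (R -` S)" using assms by (simp add: ray_def finite_vimageI)
  then obtain m where "\<forall>i\<in>R -` S. i < m" using finite_nat_set_iff_bounded by blast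
  then have "\<forall>i\<ge>m. R i \<notin> S" by (meson leD vimageI2)
  then show ?thesis ..
qed

definition tailE :: "(nat \<Rightarrow> 'a) \<Rightarrow> 'a set set \<Rightarrow> 'a set" where
  "tailE R F = (THE C. C \<in> CE F \<and> (\<exists>m. \<forall>i\<ge>m. R i \<in> C))"

definition tailX :: "(nat \<Rightarrow> 'a) \<Rightarrow> 'a set \<Rightarrow> 'a set" where
  "tailX R X = (THE c. c \<in> CX X \<and> (\<exists>m. \<forall>i\<ge>m. R i \<in> c))"

lemma tails_meet:
  fixes m n :: nat
  assumes "\<forall>i\<ge>m. R i \<in> C" "\<forall>i\<ge>n. R i \<in> D"
  shows "R (max m n) \<in> C \<inter> D"
  using assms by (meson IntI max.cobounded1 max.cobounded2)

lemma tailE_eq: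
  assumes C: "C \<in> CE F" and m: "\<forall>i\<ge>m. R i \<in> C"
  shows "tailE R F = C"
  unfolding tailE_def
proof (rule the_equality)
  fix D assume D: "D \<in> CE F \<and> (\<exists>m. \<forall>i\<ge>m. R i \<in> D)"
  then obtain n where "\<forall>i\<ge>n. R i \<in> D" by blast
  then show "D = C" using D C CE_disjoint tails_meet[OF m] by blast
qed (use C m in blast)

lemma tailX_eq:
  assumes C: "C \<in> CX X" and m: "\<forall>i\<ge>m. R i \<in> C"
  shows "tailX R X = C"
  unfolding tailX_def
proof (rule the_equality)
  fix D assume D: "D \<in> CX X \<and> (\<exists>m. \<forall>i\<ge>m. R i \<in> D)"
  then obtain n where "\<forall>i\<ge>n. R i \<in> D" by blast
  then show "D = C" using D C CX_disjoint tails_meet[OF m] by blast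
qed (use C m in blast)

text \<open>After its last vertex in the finite set \<open>\<Union>F\<close> the ray uses no edge of
  \<open>F\<close> and so cannot change its component. The tail is also recorded to avoid
  \<open>\<Union>F\<close>, so that its edges lie in \<open>E - F\<close>.\<close>

lemma tailE:
  assumes R: "ray V E R" and F: "F \<in> fin_edges E"
  shows "tailE R F \<in> CE F" and "\<exists>m. (\<forall>i\<ge>m. R i \<in> tailE R F \<and> R i \<notin> \<Union>F)"
proof -
  have "finite (\<Union>F)" using fin_edges_Union[OF F] by (simp add: fin_verts_def)
  from ray_eventually_notin[OF R this] obtain m where m: "\<forall>i\<ge>m. R i \<notin> \<Union>F" ..
  have RV: "R i \<in> V" for i using R by (auto simp: ray_def)
  have "R i \<in> compE F (R m)" if "m \<le> i" for i
    using that
  proof (induction i rule: dec_induct)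
    case base
    then show ?case using RV by (simp add: in_compE)
  next
    case (step n)
    have "{R n, R (Suc n)} \<in> E" using R by (simp add: ray_def)
    then show ?case using CE_edge[OF compE_in[OF RV], of "{R n, R (Suc n)}" F "R n" m] step m by blast
  qed
  then have *: "\<forall>i\<ge>m. R i \<in> compE F (R m)" by simp
  then have eq: "tailE R F = compE F (R m)" by (intro tailE_eq compE_in RV)
  then show "tailE R F \<in> CE F" using compE_in RV by simp
  show "\<exists>m. (\<forall>i\<ge>m. R i \<in> tailE R F \<and> R i \<notin> \<Union>F)" using * eq m by auto
qed

lemma tailX:
  assumes R: "ray V E R" and X: "X \<in> fin_verts V"
  shows "tailX R X \<in> CX X" and "\<exists>m. (\<forall>i\<ge>m. R i \<in> tailX R X)"
proof -
  have "finite X" using X by (simp add: fin_verts_def)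
  from ray_eventually_notin[OF R this] obtain m where m: "\<forall>i\<ge>m. R i \<notin> X" ..
  have RV: "R i \<in> V" for i using R by (auto simp: ray_def)
  have "R m \<in> \<Union>(CX X)" unfolding Union_CX using RV m by simp
  then obtain c where c: "c \<in> CX X" "R m \<in> c" by blast
  have "R i \<in> c" if "m \<le> i" for i
    using that
  proof (induction i rule: dec_induct)
    case (step n)
    have "{R n, R (Suc n)} \<in> E" using R by (simp add: ray_def)
    then show ?case using CX_edge[OF c(1), of "{R n, R (Suc n)}" "R n"] step m by auto
  qed (fact c)
  then have *: "\<forall>i\<ge>m. R i \<in> c" by simp
  then have "tailX R X = c" by (intro tailX_eq c)
  then show "tailX R X \<in> CX X" "\<exists>m. (\<forall>i\<ge>m. R i \<in> tailX R X)" using * c by auto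
qed

text \<open>
  From a vertex of \<open>C n - C (Suc n)\<close> one moves to a neighbour in \<open>C n\<close> that is closer to \<open>C (Suc n)\<close>.
  The pair of level and distance increases lexicographically, so no vertex is visited twice.
\<close>

lemma ray_in_nested_components:
  fixes C :: "nat \<Rightarrow> 'a set" and F :: "nat \<Rightarrow> 'a set set"
  assumes C: "\<And>n. C n \<in> CE (F n)" and dec: "\<And>n. C (Suc n) \<subseteq> C n" and empty: "(\<Inter>n. C n) = {}"
  shows "\<exists>R. ray V E R \<and> (\<forall>n. \<exists>m. \<forall>i\<ge>m. R i \<in> C n)"
proof -
  have decm: "C n \<subseteq> C m" if "m \<le> n" for m n
    using lift_Suc_antimono_le[of C, OF dec that] .
  \<comment> \<open>For \<open>x\<close> in \<open>C 0\<close> this is the last index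
    \<open>n\<close> with \<open>x \<in> C n\<close>; it exists as the intersection of the sets is
    empty.\<close>
  define lev where "lev x = (LEAST n. x \<notin> C (Suc n))" for x
  have lev: "x \<in> C (lev x) \<and> x \<notin> C (Suc (lev x))" if x: "x \<in> C 0" for x
  proof
    obtain n where n: "x \<notin> C n" using empty by blast
    then obtain k where "n = Suc k" using x by (cases n) auto
    with n have "\<exists>n. x \<notin> C (Suc n)" by blast
    then show "x \<notin> C (Suc (lev x))" unfolding lev_def by (rule LeastI_ex)
    show "x \<in> C (lev x)"
    proof (cases "lev x")
      case (Suc k)
      then have "\<not> x \<notin> C (Suc k)" unfolding lev_def by (intro not_less_Least) simp
      then show ?thesis using Suc by simp
    qed (use x in simp)
  qed
  have lev_ge: "n \<le> lev x" if "x \<in> C n" for n x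
  proof (rule ccontr)
    assume "\<not> n \<le> lev x"
    then have "x \<in> C (Suc (lev x))" using decm[of "Suc (lev x)" n] that by auto
    then show False using lev[of x] decm[of 0 n] that by auto
  qed
  \<comment> \<open>\<open>P x k\<close> says that \<open>k\<close> steps along edges outside
    \<open>F (lev x)\<close> lead from \<open>x\<close> into the next set
    \<open>C (Suc (lev x))\<close>; thus \<open>d x\<close> is the distance to that set.\<close>
  define P where "P x k \<longleftrightarrow> (\<exists>y\<in>C (Suc (lev x)). (adjacent (E - F (lev x)) ^^ k) x y)" for x k
  define d where "d x = (LEAST k. P x k)" for x
  have ex: "\<exists>k. P x k" if x: "x \<in> C 0" for x
  proof -
    obtain y where y: "y \<in> C (Suc (lev x))" using CE_nonempty[OF C] by blast
    then have "y \<in> C (lev x)" using dec by blast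
    then have "y \<in> compE (F (lev x)) x" using compE_eq[OF C, of x "lev x"] lev[OF x] by simp
    then have "(adjacent (E - F (lev x)))\<^sup>*\<^sup>* x y" by (simp add: compE_def comp_at_def)
    then show ?thesis using y unfolding P_def by (meson rtranclp_imp_relpowp)
  qed
  \<comment> \<open>The next vertex \<open>z\<close> is the first step of a shortest such walk. It
    stays in \<open>C (lev x)\<close> because the walk uses no deleted edge; if its level is still
    the same, the rest of the walk shows that its distance has dropped.\<close>
  have "\<exists>z. {x, z} \<in> E \<and> z \<in> C 0 \<and> (lev x < lev z \<or> lev z = lev x \<and> d z < d x)" if x: "x \<in> C 0" for x
  proof -
    have "P x (d x)" unfolding d_def using ex[OF x] by (rule LeastI_ex)
    then obtain y where y: "y \<in> C (Suc (lev x))" "(adjacent (E - F (lev x)) ^^ d x) x y"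
      unfolding P_def by blast
    have "d x \<noteq> 0"
    proof
      assume "d x = 0"
      then show False using y lev[OF x] by simp
    qed
    then obtain k where k: "d x = Suc k" using not0_implies_Suc by blast
    with y(2) obtain z where z: "adjacent (E - F (lev x)) x z" "(adjacent (E - F (lev x)) ^^ k) z y"
      by (metis relpowp_Suc_D2)
    have xz: "{x, z} \<in> E - F (lev x)" using z(1) by (simp add: adjacent_def)
    then have zC: "z \<in> C (lev x)" using CE_edge[OF C, of "{x, z}" "lev x" x] lev[OF x] by auto
    have "d z < d x" if "lev z = lev x"
    proof -
      have "P z k" using y(1) z(2) that unfolding P_def by auto
      then have "d z \<le> k" unfolding d_def by (rule Least_le)
      then show ?thesis using k by simp
    qed
    then show ?thesis using xz zC lev_ge[OF zC] decm[of 0 "lev x"] by (intro exI[of _ z]) auto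
  qed
  then obtain N where N: "\<And>x. x \<in> C 0 \<Longrightarrow>
      {x, N x} \<in> E \<and> N x \<in> C 0 \<and> (lev x < lev (N x) \<or> lev (N x) = lev x \<and> d (N x) < d x)"
    by metis
  obtain x0 where x0: "x0 \<in> C 0" using CE_nonempty[OF C] by blast
  define R where "R i = (N ^^ i) x0" for i
  have RS: "R (Suc i) = N (R i)" for i by (simp add: R_def)
  have R0: "R i \<in> C 0" for i by (induction i) (use x0 N RS in \<open>auto simp: R_def\<close>)
  have lt: "lev (R i) < lev (R j) \<or> lev (R j) = lev (R i) \<and> d (R j) < d (R i)" if "i < j" for i j
    using that
  proof (induction i j rule: less_Suc_induct)
    case (1 i)
    then show ?case using N[OF R0[of i]] RS by simp
  qed auto
  have inj: "inj R"
  proof (rule linorder_injI)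
    fix i j :: nat assume "i < j"
    then show "R i \<noteq> R j" using lt[of i j] by auto
  qed
  have levm: "lev (R i) \<le> lev (R j)" if "i \<le> j" for i j
    using lt[of i j] that by (cases "i = j") auto
  have prog: "\<exists>i. n \<le> lev (R i)" for n
  proof (induction n)
    case (Suc n)
    then obtain i where i: "n \<le> lev (R i)" by blast
    have "\<exists>j. lev (R i) < lev (R j)"
    proof (rule ccontr)
      assume n: "\<not> (\<exists>j. lev (R i) < lev (R j))"
      \<comment> \<open>On a constant level the distance drops by at least one at each step, which
        is impossible \<open>Suc (d (R i))\<close> times.\<close>
      have "d (R (i + k)) + k \<le> d (R i)" for k
      proof (induction k)
        case (Suc k)
        have "lev (R (i + k)) = lev (R i)" using n levm[of i "i + k"] by (metis le_add1 le_neq_implies_less)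
        then have "d (R (i + Suc k)) < d (R (i + k))" using lt[of "i + k" "i + Suc k"] n by auto
        then show ?case using Suc by simp
      qed simp
      from this[of "Suc (d (R i))"] show False by simp
    qed
    then show ?case using i by (meson Suc_leI le_less_trans)
  qed simp
  have "ray V E R"
    using inj R0 CE_subset[OF C[of 0]] N[OF R0] RS by (auto simp: ray_def)
  moreover have "\<exists>m. \<forall>i\<ge>m. R i \<in> C n" for n
  proof -
    obtain m where "n \<le> lev (R m)" using prog by blast
    then have "R i \<in> C n" if "m \<le> i" for i
      using levm[OF that] lev[OF R0[of i]] decm[of n "lev (R i)"] by auto
    then show ?thesis by blast
  qed
  ultimately show ?thesis by blast
qed

text \<open>Without a common vertex, every finite set of vertices is avoided by some
  \<open>C F\<close>. This yields a sequence of edge sets whose components shrink to nothing; the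
  ray found along this countable chain works for all finite \<open>F\<close> at once, because the
  components of the chain eventually miss the ends of \<open>F\<close>.\<close>

lemma compatible_family_cases:
  assumes C: "\<And>F. F \<in> fin_edges E \<Longrightarrow> C F \<in> CE F"
    and mono: "\<And>F F'. F \<in> fin_edges E \<Longrightarrow> F' \<in> fin_edges E \<Longrightarrow> F \<subseteq> F' \<Longrightarrow> C F' \<subseteq> C F"
  shows "(\<exists>v\<in>V. \<forall>F\<in>fin_edges E. v \<in> C F) \<or>
         (\<exists>R. ray V E R \<and> (\<forall>F\<in>fin_edges E. tailE R F = C F))"
proof (rule disjCI)
  assume "\<not> (\<exists>R. ray V E R \<and> (\<forall>F\<in>fin_edges E. tailE R F = C F))"
  then have noray: "\<And>R. ray V E R \<Longrightarrow> \<exists>F\<in>fin_edges E. tailE R F \<noteq> C F" by blast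
  show "\<exists>v\<in>V. \<forall>F\<in>fin_edges E. v \<in> C F"
  proof (rule ccontr)
    assume "\<not> (\<exists>v\<in>V. \<forall>F\<in>fin_edges E. v \<in> C F)"
    then have out: "\<exists>F\<in>fin_edges E. v \<notin> C F" if "v \<in> V" for v using that by blast
    have avoid: "\<exists>F'. F' \<in> fin_edges E \<and> F \<subseteq> F' \<and> C F' \<inter> S = {}"
      if "finite S" "S \<subseteq> V" "F \<in> fin_edges E" for S F
      using that
    proof (induction S)
      case (insert v S)
      then obtain F1 where F1: "F1 \<in> fin_edges E" "F \<subseteq> F1" "C F1 \<inter> S = {}" by auto
      obtain F2 where F2: "F2 \<in> fin_edges E" "v \<notin> C F2" using insert out by blast
      have "C (F1 \<union> F2) \<subseteq> C F1 \<inter> C F2"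
        using mono[OF F1(1) fin_edges_Un[OF F1(1) F2(1)]] mono[OF F2(1) fin_edges_Un[OF F1(1) F2(1)]]
        by blast
      then show ?case using F1 F2 fin_edges_Un[OF F1(1) F2(1)] by (intro exI[of _ "F1 \<union> F2"]) auto
    qed auto
    obtain v0 where v0: "v0 \<in> V" using conn by (auto simp: connected_sgraph_def)
    obtain F0 where F0: "F0 \<in> fin_edges E" "v0 \<notin> C F0" using out[OF v0] by blast
    \<comment> \<open>As \<open>C (Fs (Suc n))\<close> avoids the ends of \<open>Fs n\<close>, no
      edge deleted at stage \<open>n\<close> has an end in a later component. The vertex
      \<open>v0\<close> is kept outside so that the intersection of the components is not all of
      \<open>V\<close>.\<close>
    have "\<exists>Fs. \<forall>n. (Fs n \<in> fin_edges E \<and> v0 \<notin> C (Fs n)) \<and>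
        (Fs n \<subseteq> Fs (Suc n) \<and> C (Fs (Suc n)) \<inter> \<Union>(Fs n) = {})"
    proof (rule dependent_nat_choice)
      show "\<exists>F. F \<in> fin_edges E \<and> v0 \<notin> C F" using F0 by blast
      fix F and n :: nat assume F: "F \<in> fin_edges E \<and> v0 \<notin> C F"
      then obtain F' where F': "F' \<in> fin_edges E" "F \<subseteq> F'" "C F' \<inter> \<Union>F = {}"
        using avoid[of "\<Union>F" F] fin_edges_Union[of F] by (auto simp: fin_verts_def)
      moreover have "v0 \<notin> C F'" using F mono[of F F'] F' by blast
      ultimately show "\<exists>F'. (F' \<in> fin_edges E \<and> v0 \<notin> C F') \<and> F \<subseteq> F' \<and> C F' \<inter> \<Union>F = {}" by blast
    qed
    then obtain Fs where Fs: "\<And>n. Fs n \<in> fin_edges E" "\<And>n. v0 \<notin> C (Fs n)" "\<And>n. Fs n \<subseteq> Fs (Suc n)"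
      "\<And>n. C (Fs (Suc n)) \<inter> \<Union>(Fs n) = {}" by metis
    define D where "D n = C (Fs n)" for n
    have D: "D n \<in> CE (Fs n)" for n unfolding D_def by (rule C[OF Fs(1)])
    have Ddec: "D (Suc n) \<subseteq> D n" for n unfolding D_def using mono[OF Fs(1) Fs(1) Fs(3)] .
    have Ddecm: "D n \<subseteq> D m" if "m \<le> n" for m n using lift_Suc_antimono_le[of D, OF Ddec that] .
    \<comment> \<open>An edge leaving the intersection at \<open>u\<close> would lie in some
      \<open>Fs n\<close>, whereas \<open>u\<close> lies in \<open>D (Suc n)\<close>. So the
      intersection is closed under taking neighbours, and if it were nonempty it would contain
      \<open>v0\<close>.\<close>
    have Dempty: "(\<Inter>n. D n) = {}"
    proof (rule ccontr)
      assume "(\<Inter>n. D n) \<noteq> {}"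
      then obtain v where v: "v \<in> (\<Inter>n. D n)" by blast
      have "V \<subseteq> (\<Inter>n. D n)"
      proof (rule V_subset_closed[OF _ v])
        show "v \<in> V" using v CE_subset[OF D] by blast
        fix u w assume u: "u \<in> (\<Inter>n. D n)" and uw: "{u, w} \<in> E"
        have "w \<in> D n" for n
        proof (rule ccontr)
          assume "w \<notin> D n"
          then have "{u, w} \<in> Fs n" using CE_edge[OF D uw, of n u] u by blast
          then have "u \<notin> D (Suc n)" using Fs(4)[of n] by (auto simp: D_def)
          then show False using u by blast
        qed
        then show "w \<in> (\<Inter>n. D n)" by blast
      qed
      then show False using v0 Fs(2) by (auto simp: D_def)
    qed
    obtain R where R: "ray V E R" "\<And>n. \<exists>m. \<forall>i\<ge>m. R i \<in> D n"
      using ray_in_nested_components[of D Fs, OF D Ddec Dempty] by blast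
    obtain F where F: "F \<in> fin_edges E" "tailE R F \<noteq> C F" using noray[OF R(1)] by blast
    have fin: "\<exists>n. D n \<inter> S = {}" if "finite S" for S
      using that
    proof (induction S)
      case (insert v S)
      then obtain m where m: "D m \<inter> S = {}" by blast
      obtain n where "v \<notin> D n" using Dempty by blast
      then show ?case using m Ddecm[of m "max m n"] Ddecm[of n "max m n"] by (intro exI[of _ "max m n"]) auto
    qed simp
    have "finite (\<Union>F)" using fin_edges_Union[OF F(1)] by (simp add: fin_verts_def)
    from fin[OF this] obtain n where n: "D n \<inter> \<Union>F = {}" ..
    \<comment> \<open>A vertex of the component for \<open>F \<union> Fs n\<close> is common to
      \<open>D n\<close> and \<open>C F\<close>. As \<open>D n\<close> contains no end of
      \<open>F\<close>, it stays connected when \<open>F\<close> is deleted and so lies in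
      \<open>C F\<close>.\<close>
    have Un: "F \<union> Fs n \<in> fin_edges E" using fin_edges_Un F(1) Fs(1) by blast
    obtain v where v: "v \<in> C (F \<union> Fs n)" using CE_nonempty[OF C[OF Un]] by blast
    have "v \<in> C F" "v \<in> D n" using v mono[OF F(1) Un] mono[OF Fs(1) Un] by (auto simp: D_def)
    have "D n \<subseteq> C F"
    proof (rule comps_subset_comps[of "D n" V "E - Fs n" "C F" V "E - F" v])
      fix e assume e: "e \<in> E - Fs n" "e \<subseteq> D n"
      obtain u where "u \<in> e" using e edgeE by blast
      then show "e \<in> E - F" using e n by blast
    qed (use D C[OF F(1)] Union_edges_subset \<open>v \<in> C F\<close> \<open>v \<in> D n\<close> in \<open>auto simp: comps_del_edges_def\<close>)
    moreover obtain m where "\<forall>i\<ge>m. R i \<in> D n" using R(2) by blast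
    ultimately have "\<forall>i\<ge>m. R i \<in> C F" by blast
    then show False using tailE_eq[OF C[OF F(1)]] F(2) by blast
  qed
qed

end

section \<open>The contractions and their inverse limit\<close>

lemma Inner_in_inner_edge [simp]: "Inner e t \<in> inner_edge e' \<longleftrightarrow> e = e' \<and> 0 < t \<and> t < 1"
  by (auto simp: inner_edge_def)

lemma Vert_in_inner_edge [simp]: "Vert v \<notin> inner_edge e"
  by (auto simp: inner_edge_def)

lemma Inner_in_half_edge [simp]:
  "Inner e t \<in> half_edge e' x r \<longleftrightarrow> e = e' \<and> 0 < t \<and> t < 1 \<and> dist_from e x t < r"
  by (auto simp: half_edge_def)

lemma Vert_in_half_edge [simp]: "Vert v \<notin> half_edge e x r"
  by (auto simp: half_edge_def)

lemma Vert_in_graph_points [simp]: "Vert v \<in> graph_points W D \<longleftrightarrow> v \<in> W"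
  by (auto simp: graph_points_def)

lemma Inner_in_graph_points [simp]: "Inner e t \<in> graph_points W D \<longleftrightarrow> e \<in> D \<and> 0 < t \<and> t < 1"
  by (auto simp: graph_points_def)

lemma open_dist_from: "open {t. dist_from e x t < r}"
  by (cases "x = edge_origin e") (auto simp: dist_from_def intro!: open_Collect_less continuous_intros)

lemma open_half_edge_times: "open {t \<in> {0<..<1}. dist_from e x t < r}"
  using open_Int[OF open_greaterThanLessThan open_dist_from] by (simp add: Int_def)

definition contraction_nbhd ::
  "'a set set \<Rightarrow> 'a set \<Rightarrow> ('a set \<Rightarrow> real) \<Rightarrow> 'a set set \<Rightarrow> ('a set \<Rightarrow> real) \<Rightarrow> ('a set \<Rightarrow> real)
    \<Rightarrow> ('a set, 'a) cpoint set" where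
  "contraction_nbhd E d j L a b =
     {Vert d} \<union>
      (\<Union>e\<in>{e \<in> E - loops E d. e \<inter> d \<noteq> {}}. \<Union>x\<in>e \<inter> d. half_edge e x (j e)) \<union>
      (\<Union>e\<in>L. inner_edge e - Inner e ` {a e..b e}) \<union>
      (\<Union>e\<in>loops E d - L. inner_edge e)"

lemma Vert_in_contraction_nbhd [simp]: "Vert d' \<in> contraction_nbhd E d j L a b \<longleftrightarrow> d' = d"
  by (auto simp: contraction_nbhd_def)

lemma Inner_in_contraction_nbhd:
  assumes "L \<subseteq> loops E d"
  shows "Inner e t \<in> contraction_nbhd E d j L a b \<longleftrightarrow> e \<in> E \<and> 0 < t \<and> t < 1 \<and>
    (if e \<subseteq> d then e \<in> L \<longrightarrow> t < a e \<or> b e < t else \<exists>x\<in>e \<inter> d. dist_from e x t < j e)"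
  using assms by (auto simp: contraction_nbhd_def loops_def)

context conn_graph
begin

lemma edge_origin_in: "e \<in> E \<Longrightarrow> edge_origin e \<in> e"
  using edgeE[of e] unfolding edge_origin_def by (metis insertI1 someI)

lemma dist_from_add:
  assumes "e \<in> E" "x \<in> e" "y \<in> e" "x \<noteq> y"
  shows "dist_from e x t + dist_from e y t = 1"
proof -
  obtain u v where "e = {u, v}" using edgeE[OF assms(1)] by blast
  then show ?thesis using edge_origin_in[OF assms(1)] assms by (auto simp: dist_from_def)
qed

definition nbhd_data ::
  "'a set \<Rightarrow> ('a set \<Rightarrow> real) \<Rightarrow> 'a set set \<Rightarrow> ('a set \<Rightarrow> real) \<Rightarrow> ('a set \<Rightarrow> real) \<Rightarrow> bool" where
  "nbhd_data d j L a b \<longleftrightarrow> (\<forall>e. 0 < j e \<and> j e < 1) \<and> finite L \<and> L \<subseteq> loops E d \<and>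
     (\<forall>e. 0 < a e \<and> a e \<le> b e \<and> b e < 1)"

lemma contraction_nbhds_eq:
  "contraction_nbhds V E F =
     {contraction_nbhd E d j L a b | d j L a b. d \<in> CE F \<and> nbhd_data d j L a b}"
  unfolding contraction_nbhds_def contraction_nbhd_def nbhd_data_def by (rule refl)

lemma nbhd_data_half: "nbhd_data d (\<lambda>_. 1/2) {} (\<lambda>_. 1/2) (\<lambda>_. 1/2)"
  by (simp add: nbhd_data_def)

lemma openin_contraction_inner:
  "e \<in> E \<Longrightarrow> open T \<Longrightarrow> T \<subseteq> {0<..<1} \<Longrightarrow> openin (contraction V E F) (Inner e ` T)"
  unfolding contraction_def by (intro topology_generated_by_Basis) (auto simp: inner_opens_def)

lemma openin_contraction_nbhd:
  "d \<in> CE F \<Longrightarrow> nbhd_data d j L a b \<Longrightarrow> openin (contraction V E F) (contraction_nbhd E d j L a b)"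
  unfolding contraction_def
  by (intro topology_generated_by_Basis UnI2) (unfold contraction_nbhds_eq, blast)

lemma inner_edge_eq: "inner_edge e = Inner e ` {0<..<1}"
  by (simp add: inner_edge_def)

lemma topspace_contraction: "topspace (contraction V E F) = graph_points (CE F) E"
proof -
  have "p \<in> \<Union>(inner_opens E \<union> contraction_nbhds V E F) \<longleftrightarrow> p \<in> graph_points (CE F) E"
    for p :: "('a set, 'a) cpoint"
  proof
    assume "p \<in> \<Union>(inner_opens E \<union> contraction_nbhds V E F)"
    then consider "p \<in> \<Union>(inner_opens E)" | "p \<in> \<Union>(contraction_nbhds V E F)" by blast
    then show "p \<in> graph_points (CE F) E"
    proof cases
      case 1
      then show ?thesis by (auto simp: inner_opens_def)
    next
      case 2
      then obtain d j L a b where d: "d \<in> CE F" "nbhd_data d j L a b" "p \<in> contraction_nbhd E d j L a b"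
        unfolding contraction_nbhds_eq by blast
      then have "L \<subseteq> loops E d" by (simp add: nbhd_data_def)
      then show ?thesis using d by (cases p) (auto simp: Inner_in_contraction_nbhd)
    qed
  next
    assume p: "p \<in> graph_points (CE F) E"
    have "\<exists>S. openin (contraction V E F) S \<and> p \<in> S"
    proof (cases p)
      case (Vert d)
      then show ?thesis using p openin_contraction_nbhd[OF _ nbhd_data_half, of d F]
        by (intro exI[of _ "contraction_nbhd E d (\<lambda>_. 1/2) {} (\<lambda>_. 1/2) (\<lambda>_. 1/2)"]) simp
    next
      case (Inner e t)
      then show ?thesis using p openin_contraction_inner[of e "{0<..<1}" F]
        by (intro exI[of _ "inner_edge e"]) (auto simp: inner_edge_eq)
    qed
    then have "p \<in> topspace (contraction V E F)" using openin_subset by blast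
    then show "p \<in> \<Union>(inner_opens E \<union> contraction_nbhds V E F)"
      by (simp only: contraction_def topology_generated_by_topspace)
  qed
  then show ?thesis unfolding contraction_def topology_generated_by_topspace by blast
qed

text \<open>Two vertices are separated by halving the edges between them: the distances of an inner
  point to the two ends add up to 1, so they are not both below 1/2. A vertex and an inner point are
  separated because a neighbourhood of the vertex may omit a closed interval from a loop and may be
  kept short on the other edges.\<close>

lemma Hausdorff_contraction: "Hausdorff_space (contraction V E F)"
  unfolding Hausdorff_space_def
proof (intro allI impI)
  fix p q :: "('a set, 'a) cpoint"
  assume "p \<in> topspace (contraction V E F) \<and> q \<in> topspace (contraction V E F) \<and> p \<noteq> q"
  then have p: "p \<in> graph_points (CE F) E" and q: "q \<in> graph_points (CE F) E" and pq: "p \<noteq> q"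
    by (simp_all add: topspace_contraction)
  let ?sep = "\<lambda>p q. \<exists>S T. openin (contraction V E F) S \<and> openin (contraction V E F) T \<and>
                p \<in> S \<and> q \<in> T \<and> disjnt S T"
  have IV: "?sep (Inner e s) (Vert d)" if "e \<in> E" and s: "0 < s" "s < 1" and d: "d \<in> CE F" for e s d
  proof -
    \<comment> \<open>The ends of \<open>?T\<close> lie half way from \<open>s\<close> to 0 and to
      1. If \<open>e\<close> is a loop at \<open>d\<close>, the closed interval is removed from it;
      if not, the radius \<open>?j\<close> is at most the distance of \<open>?T\<close> from either
      end of \<open>e\<close>.\<close>
    let ?T = "{s/2<..<(1+s)/2}"
    let ?j = "\<lambda>_. min (s/2) ((1-s)/2)" and ?L = "{e} \<inter> loops E d"
    let ?N = "contraction_nbhd E d ?j ?L (\<lambda>_. s/2) (\<lambda>_. (1+s)/2)"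
    have "openin (contraction V E F) (Inner e ` ?T)"
      using that s by (intro openin_contraction_inner) auto
    moreover have data: "nbhd_data d ?j ?L (\<lambda>_. s/2) (\<lambda>_. (1+s)/2)"
      using s by (auto simp: nbhd_data_def)
    then have "openin (contraction V E F) ?N" using d by (intro openin_contraction_nbhd)
    moreover have "disjnt (Inner e ` ?T) ?N"
    proof -
      have "Inner e t \<notin> ?N" if "t \<in> ?T" for t
        using that s \<open>e \<in> E\<close>
        by (auto simp: Inner_in_contraction_nbhd dist_from_def loops_def)
      then show ?thesis by (auto simp: disjnt_def)
    qed
    ultimately show ?thesis using s by (intro exI[of _ "Inner e ` ?T"] exI[of _ ?N]) auto
  qed
  show "?sep p q"
  proof (cases p)
    case p': (Vert d)
    show ?thesis
    proof (cases q)
      case q': (Vert d')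
      let ?N = "\<lambda>d. contraction_nbhd E d (\<lambda>_. 1/2) {} (\<lambda>_. 1/2) (\<lambda>_. 1/2)"
      have d: "d \<in> CE F" "d' \<in> CE F" "d \<noteq> d'" using p q pq p' q' by auto
      have "\<not> (r \<in> ?N d \<and> r \<in> ?N d')" for r
      proof (cases r)
        case (Vert x)
        then show ?thesis using d by auto
      next
        case (Inner e t)
        have disj: "x \<notin> d \<or> x \<notin> d'" for x using d CE_disjoint by blast
        show ?thesis
        proof
          assume "r \<in> ?N d \<and> r \<in> ?N d'"
          then have e: "e \<in> E" and 1: "e \<subseteq> d \<or> (\<exists>x\<in>e \<inter> d. dist_from e x t < 1/2)"
            and 2: "e \<subseteq> d' \<or> (\<exists>x\<in>e \<inter> d'. dist_from e x t < 1/2)"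
            unfolding Inner Inner_in_contraction_nbhd[OF empty_subsetI] by meson+
          obtain u where "u \<in> e" using e edgeE by blast
          then have "\<not> e \<subseteq> d" "\<not> e \<subseteq> d'" using 1 2 disj by auto
          then obtain x y where "x \<in> e \<inter> d" "y \<in> e \<inter> d'" "dist_from e x t < 1/2" "dist_from e y t < 1/2"
            using 1 2 by auto
          moreover from this have "x \<noteq> y" using disj by auto
          ultimately show False using dist_from_add[OF e, of x y t] by auto
        qed
      qed
      then have "disjnt (?N d) (?N d')" by (auto simp: disjnt_def)
      then show ?thesis using d p' q' openin_contraction_nbhd[OF _ nbhd_data_half]
        by (intro exI[of _ "?N d"] exI[of _ "?N d'"]) auto
    next
      case (Inner e s)
      then have "?sep q p" using IV[of e s d] p q p' by auto
      then show ?thesis by (metis disjnt_sym)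
    qed
  next
    case p': (Inner e s)
    show ?thesis
    proof (cases q)
      case (Vert d)
      then show ?thesis using IV[of e s d] p q p' by auto
    next
      case q': (Inner e' t)
      show ?thesis
      proof (cases "e = e'")
        case True
        then have "s \<noteq> t" using pq p' q' by auto
        then obtain S T where ST: "open S" "open T" "s \<in> S" "t \<in> T" "S \<inter> T = {}"
          using hausdorff by metis
        then have "openin (contraction V E F) (Inner e ` (S \<inter> {0<..<1}))"
          "openin (contraction V E F) (Inner e ` (T \<inter> {0<..<1}))"
          using p p' by (auto intro!: openin_contraction_inner)
        then show ?thesis using ST p q p' q' True
          by (intro exI[of _ "Inner e ` (S \<inter> {0<..<1})"] exI[of _ "Inner e ` (T \<inter> {0<..<1})"])
             (auto simp: disjnt_def)
      next
        case False
        then show ?thesis using p q p' q' openin_contraction_inner[of e "{0<..<1}" F]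
            openin_contraction_inner[of e' "{0<..<1}" F]
          by (intro exI[of _ "inner_edge e"] exI[of _ "inner_edge e'"])
             (auto simp: inner_edge_eq disjnt_def)
      qed
    qed
  qed
qed

section \<open>Points of the inverse limit\<close>

lemma Hausdorff_inverse_limit: "Hausdorff_space (inverse_limit V E)"
  unfolding inverse_limit_def
  by (intro Hausdorff_space_subtopology) (simp add: Hausdorff_space_product_topology Hausdorff_contraction)

lemma topspace_inverse_limit:
  "p \<in> topspace (inverse_limit V E) \<longleftrightarrow>
     p \<in> (\<Pi>\<^sub>E F\<in>fin_edges E. graph_points (CE F) E) \<and>
     (\<forall>F\<in>fin_edges E. \<forall>F'\<in>fin_edges E. F \<subseteq> F' \<longrightarrow> bonding V E F (p F') = p F)"
  by (simp add: inverse_limit_def topspace_contraction)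

lemma bonding_Vert:
  assumes "C' \<in> CE F'" "C \<in> CE F" "C' \<subseteq> C"
  shows "bonding V E F (Vert C') = Vert C"
  using the_comps[of C V "E - F" C'] assms CE_nonempty[OF assms(1)] by (simp add: comps_del_edges_def)

lemma CE_supercomponent:
  assumes "C' \<in> CE F'" "F \<subseteq> F'"
  shows "\<exists>C\<in>CE F. C' \<subseteq> C"
proof -
  obtain v where v: "v \<in> C'" "v \<in> V" using CE_nonempty[OF assms(1)] CE_subset[OF assms(1)] by blast
  then show ?thesis using CE_mono[OF assms(1) compE_in assms(2) v(1) in_compE] compE_in by blast
qed

lemma empty_fin_edges: "{} \<in> fin_edges E"
  by (simp add: fin_edges_def)

text \<open>Bonding maps send inner points to inner points and vertices to vertices, so the
  coordinate at the empty edge set determines of which kind all others are.\<close>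

lemma inverse_limit_point_cases:
  assumes p: "p \<in> topspace (inverse_limit V E)"
  obtains e t where "e \<in> E" "0 < t" "t < 1" "p = (\<lambda>F\<in>fin_edges E. Inner e t)"
  | C where "\<And>F. F \<in> fin_edges E \<Longrightarrow> C F \<in> CE F"
      "\<And>F F'. F \<in> fin_edges E \<Longrightarrow> F' \<in> fin_edges E \<Longrightarrow> F \<subseteq> F' \<Longrightarrow> C F' \<subseteq> C F"
      "p = (\<lambda>F\<in>fin_edges E. Vert (C F))"
proof -
  have ext: "p \<in> extensional (fin_edges E)" and pF: "\<And>F. F \<in> fin_edges E \<Longrightarrow> p F \<in> graph_points (CE F) E"
    and bond: "\<And>F F'. F \<in> fin_edges E \<Longrightarrow> F' \<in> fin_edges E \<Longrightarrow> F \<subseteq> F' \<Longrightarrow> bonding V E F (p F') = p F"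
    using p by (auto simp: topspace_inverse_limit PiE_def)
  show ?thesis
  proof (cases "p {}")
    case (Inner e t)
    have "p F = Inner e t" if "F \<in> fin_edges E" for F
      using bond[OF empty_fin_edges that] Inner by (cases "p F") auto
    then have "p = (\<lambda>F\<in>fin_edges E. Inner e t)" using ext by (intro extensionalityI[of _ "fin_edges E"]) auto
    then show ?thesis using that(1) pF[OF empty_fin_edges] Inner by auto
  next
    case (Vert d)
    have "\<exists>c. p F = Vert c" if "F \<in> fin_edges E" for F
      using bond[OF empty_fin_edges that] Vert by (cases "p F") auto
    then obtain C where C: "\<And>F. F \<in> fin_edges E \<Longrightarrow> p F = Vert (C F)" by metis
    show ?thesis
    proof (rule that(2))
      show CC: "C F \<in> CE F" if "F \<in> fin_edges E" for F using pF[OF that] C[OF that] by simp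
      show "p = (\<lambda>F\<in>fin_edges E. Vert (C F))"
        using ext C by (intro extensionalityI[of _ "fin_edges E"]) auto
      fix F F' assume F: "F \<in> fin_edges E" "F' \<in> fin_edges E" "F \<subseteq> F'"
      obtain D where D: "D \<in> CE F" "C F' \<subseteq> D" using CE_supercomponent[OF CC[OF F(2)] F(3)] by blast
      then have "D = C F" using bond[OF F] bonding_Vert[OF CC[OF F(2)] D] C F by simp
      then show "C F' \<subseteq> C F" using D by simp
    qed
  qed
qed

section \<open>Lifting points to the inverse limit\<close>

text \<open>
  Both the tangle compactification and the edge-end space add points \<open>z\<close> to the 1-complex that
  live in a component \<open>K z F\<close> of \<open>G - F\<close> for every finite \<open>F\<close>.
\<close>

definition pcomp :: "('z \<Rightarrow> 'a set set \<Rightarrow> 'a set) \<Rightarrow> ('a, 'a) cpoint + 'z \<Rightarrow> 'a set set \<Rightarrow> 'a set" where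
  "pcomp K x F = (case x of Inl (Vert v) \<Rightarrow> compE F v | Inr z \<Rightarrow> K z F)"

definition lift_coord ::
  "('z \<Rightarrow> 'a set set \<Rightarrow> 'a set) \<Rightarrow> 'a set set \<Rightarrow> ('a, 'a) cpoint + 'z \<Rightarrow> ('a set, 'a) cpoint" where
  "lift_coord K F x = (case x of Inl (Inner e t) \<Rightarrow> Inner e t | _ \<Rightarrow> Vert (pcomp K x F))"

definition lift :: "('z \<Rightarrow> 'a set set \<Rightarrow> 'a set) \<Rightarrow> ('a, 'a) cpoint + 'z \<Rightarrow> 'a set set \<Rightarrow> ('a set, 'a) cpoint" where
  "lift K x = (\<lambda>F\<in>fin_edges E. lift_coord K F x)"

lemma lift_coord_simps [simp]:
  "lift_coord K F (Inl (Inner e t)) = Inner e t"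
  "lift_coord K F (Inl (Vert v)) = Vert (compE F v)"
  "lift_coord K F (Inr z) = Vert (K z F)"
  by (simp_all add: lift_coord_def pcomp_def)

definition lives_in_comps :: "'z set \<Rightarrow> ('z \<Rightarrow> 'a set set \<Rightarrow> 'a set) \<Rightarrow> bool" where
  "lives_in_comps Z K \<longleftrightarrow> (\<forall>z\<in>Z. \<forall>F\<in>fin_edges E. K z F \<in> CE F \<and>
     (\<forall>F'\<in>fin_edges E. F \<subseteq> F' \<longrightarrow> K z F' \<subseteq> K z F))"

abbreviation "points Z \<equiv> Inl ` graph_points V E \<union> Inr ` Z"

lemma lift_in_inverse_limit:
  assumes K: "lives_in_comps Z K" and x: "x \<in> points Z"
  shows "lift K x \<in> topspace (inverse_limit V E)"
proof -
  have "lift_coord K F x \<in> graph_points (CE F) E" if "F \<in> fin_edges E" for F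
    using x K that compE_in by (elim UnE imageE; cases x; cases "projl x") (auto simp: lives_in_comps_def)
  moreover have "bonding V E F (lift_coord K F' x) = lift_coord K F x"
    if F: "F \<in> fin_edges E" "F' \<in> fin_edges E" "F \<subseteq> F'" for F F'
  proof -
    have *: "bonding V E F (Vert C') = Vert C" if "C' \<in> CE F'" "C \<in> CE F" "C' \<subseteq> C" for C C'
      using that by (rule bonding_Vert)
    show ?thesis
    proof (cases x)
      case (Inl y)
      show ?thesis
      proof (cases y)
        case (Vert v)
        then have v: "v \<in> V" using x Inl by auto
        then have "compE F' v \<subseteq> compE F v"
          using CE_mono[OF compE_in compE_in F(3) in_compE in_compE] by blast
        then show ?thesis using *[OF compE_in[OF v] compE_in[OF v]] Inl Vert by simp
      qed (use Inl in simp)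
    next
      case (Inr z)
      then have "z \<in> Z" using x by auto
      then show ?thesis using *[of "K z F'" "K z F"] K F Inr by (simp add: lives_in_comps_def)
    qed
  qed
  ultimately show ?thesis by (auto simp: topspace_inverse_limit lift_def)
qed

text \<open>A compatible family of components with a common vertex is the image of that vertex; any
  other is given by a ray. So it suffices that \<open>Z\<close> holds a point for each ray.\<close>

lemma lift_surj:
  assumes K: "lives_in_comps Z K"
    and rays: "\<And>R. ray V E R \<Longrightarrow> \<exists>z\<in>Z. \<forall>F\<in>fin_edges E. K z F = tailE R F"
  shows "lift K ` points Z = topspace (inverse_limit V E)"
proof
  show "lift K ` points Z \<subseteq> topspace (inverse_limit V E)"
    using lift_in_inverse_limit[OF K] by blast
  show "topspace (inverse_limit V E) \<subseteq> lift K ` points Z"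
  proof
    fix p assume "p \<in> topspace (inverse_limit V E)"
    then show "p \<in> lift K ` points Z"
    proof (cases rule: inverse_limit_point_cases)
      case (1 e t)
      then have "p = lift K (Inl (Inner e t))" "Inl (Inner e t) \<in> points Z"
        by (auto simp: lift_def)
      then show ?thesis by blast
    next
      case (2 C)
      have "(\<exists>v\<in>V. \<forall>F\<in>fin_edges E. v \<in> C F) \<or>
          (\<exists>R. ray V E R \<and> (\<forall>F\<in>fin_edges E. tailE R F = C F))"
        by (rule compatible_family_cases; rule 2)
      then have "\<exists>x\<in>points Z. \<forall>F\<in>fin_edges E. lift_coord K F x = Vert (C F)"
      proof (elim disjE)
        assume "\<exists>v\<in>V. \<forall>F\<in>fin_edges E. v \<in> C F"
        then obtain v where v: "v \<in> V" "\<And>F. F \<in> fin_edges E \<Longrightarrow> v \<in> C F" by blast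
        then have "lift_coord K F (Inl (Vert v)) = Vert (C F)" if "F \<in> fin_edges E" for F
          using that compE_eq[OF 2(1)] by simp
        then show ?thesis using v by (intro bexI[of _ "Inl (Vert v)"]) auto
      next
        assume "\<exists>R. ray V E R \<and> (\<forall>F\<in>fin_edges E. tailE R F = C F)"
        then obtain R where R: "ray V E R" "\<And>F. F \<in> fin_edges E \<Longrightarrow> tailE R F = C F" by blast
        then obtain z where "z \<in> Z" "\<And>F. F \<in> fin_edges E \<Longrightarrow> K z F = tailE R F" using rays by blast
        then show ?thesis using R by (intro bexI[of _ "Inr z"]) auto
      qed
      then obtain x where x: "x \<in> points Z" "\<And>F. F \<in> fin_edges E \<Longrightarrow> lift_coord K F x = Vert (C F)"
        by blast
      then have "p = lift K x" unfolding 2(3) lift_def by (auto intro!: restrict_ext)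
      then show ?thesis using x by blast
    qed
  qed
qed

text \<open>Continuity is checked coordinatewise. At an inner edge point every open set of G.F
  contains an open piece of the edge, which is handled here once for both spaces. At the remaining
  points it suffices to treat the basic neighbourhoods of the image vertex, since these are the only
  generators containing it.\<close>

lemma lift_continuous:
  assumes K: "lives_in_comps Z K" and top: "topspace T = points Z"
    and inner: "\<And>e U. e \<in> E \<Longrightarrow> open U \<Longrightarrow> U \<subseteq> {0<..<1} \<Longrightarrow> openin T (Inl ` Inner e ` U)"
    and nbhd: "\<And>F x j L a b. F \<in> fin_edges E \<Longrightarrow> x \<in> Inl ` Vert ` V \<union> Inr ` Z \<Longrightarrow>
       nbhd_data (pcomp K x F) j L a b \<Longrightarrow>
       \<exists>W. openin T W \<and> x \<in> W \<and> lift_coord K F ` W \<subseteq> contraction_nbhd E (pcomp K x F) j L a b"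
  shows "continuous_map T (inverse_limit V E) (lift K)"
proof -
  have "continuous_map T (contraction V E F) (lift_coord K F)" if F: "F \<in> fin_edges E" for F
    unfolding contraction_def
  proof (rule continuous_on_generated_topo)
    have inn: "\<exists>W. openin T W \<and> Inl (Inner e t) \<in> W \<and> W \<subseteq> lift_coord K F -` U \<inter> topspace T"
      if "e \<in> E" "0 < t" "t < 1" "openin (contraction V E F) U" "Inner e t \<in> U" for e t and U
    proof -
      have "\<exists>S. open S \<and> t \<in> S \<and> S \<subseteq> {0<..<1} \<and> Inner e ` S \<subseteq> U"
      proof -
        have g: "generate_topology_on (inner_opens E \<union> contraction_nbhds V E F) U"
          using that(4) by (simp add: contraction_def openin_topology_generated_by_iff)
        then show ?thesis using that(5)
        proof induction
          case (Int A B)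
          then obtain S S' where "open S" "t \<in> S" "S \<subseteq> {0<..<1}" "Inner e ` S \<subseteq> A"
            "open S'" "t \<in> S'" "S' \<subseteq> {0<..<1}" "Inner e ` S' \<subseteq> B" by blast
          then show ?case by (intro exI[of _ "S \<inter> S'"]) auto
        next
          case (UN \<K>)
          then obtain k where k: "k \<in> \<K>" "Inner e t \<in> k" by blast
          from UN.IH[OF k] obtain S where "open S" "t \<in> S" "S \<subseteq> {0<..<1}" "Inner e ` S \<subseteq> k" by blast
          then show ?case using k(1) by (intro exI[of _ S]) auto
        next
          case (Basis s)
          from Basis(1) show ?case
          proof
            assume "s \<in> inner_opens E"
            then show ?thesis using Basis(2) by (auto simp: inner_opens_def)
          next
            assume "s \<in> contraction_nbhds V E F"
            then obtain d j L a b where d: "nbhd_data d j L a b" "s = contraction_nbhd E d j L a b"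
              unfolding contraction_nbhds_eq by blast
            then have L: "L \<subseteq> loops E d" by (simp add: nbhd_data_def)
            \<comment> \<open>The set of parameters at which \<open>e\<close> runs inside
              \<open>s\<close>.\<close>
            define S where "S = {0<..<1} \<inter> (if e \<subseteq> d then if e \<in> L then {..<a e} \<union> {b e<..} else UNIV
               else (\<Union>x\<in>e \<inter> d. {t. dist_from e x t < j e}))"
            have oS: "open S" unfolding S_def by (auto intro!: open_Int open_UN open_dist_from)
            have mem: "Inner e r \<in> s \<longleftrightarrow> r \<in> S" for r
              using d(2) \<open>e \<in> E\<close> by (auto simp: Inner_in_contraction_nbhd[OF L] S_def)
            have "t \<in> S" using mem Basis(2) by simp
            moreover have "Inner e ` S \<subseteq> s" using mem by auto
            moreover have "S \<subseteq> {0<..<1}" by (simp add: S_def)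
            ultimately show ?thesis using oS by (intro exI[of _ S] conjI)
          qed
        qed simp
      qed
      then obtain S where S: "open S" "t \<in> S" "S \<subseteq> {0<..<1}" "Inner e ` S \<subseteq> U" by blast
      then show ?thesis using inner[OF that(1) S(1,3)] openin_subset[OF inner[OF that(1) S(1,3)]]
        by (intro exI[of _ "Inl ` Inner e ` S"]) auto
    qed
    fix U assume U: "U \<in> inner_opens E \<union> contraction_nbhds V E F"
    then have opU: "openin (contraction V E F) U"
      unfolding contraction_def by (intro topology_generated_by_Basis)
    show "openin T (lift_coord K F -` U \<inter> topspace T)"
    proof (subst openin_subopen, intro ballI)
      fix x assume x: "x \<in> lift_coord K F -` U \<inter> topspace T"
      show "\<exists>W. openin T W \<and> x \<in> W \<and> W \<subseteq> lift_coord K F -` U \<inter> topspace T"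
      proof (cases "\<exists>e t. x = Inl (Inner e t)")
        case True
        then show ?thesis using inn x opU top by (force simp: graph_points_def inner_edge_def)
      next
        case False
        then have x': "x \<in> Inl ` Vert ` V \<union> Inr ` Z"
          using x top by (auto simp: graph_points_def inner_edge_def)
        then have Ux: "Vert (pcomp K x F) \<in> U" using x by (auto simp: pcomp_def)
        then have "U \<notin> inner_opens E" by (auto simp: inner_opens_def)
        then obtain d j L a b where d: "nbhd_data d j L a b" "U = contraction_nbhd E d j L a b"
          using U unfolding contraction_nbhds_eq by blast
        then have dx: "d = pcomp K x F" using Ux by simp
        from nbhd[OF F x' d(1)[unfolded dx]] d(2)[unfolded dx]
        obtain W where W: "openin T W" "x \<in> W" "lift_coord K F ` W \<subseteq> U" by auto
        then show ?thesis using openin_subset[OF W(1)] by (intro exI[of _ W]) auto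
      qed
    qed
  next
    show "lift_coord K F ` topspace T \<subseteq> \<Union>(inner_opens E \<union> contraction_nbhds V E F)"
    proof -
      have "lift_coord K F x \<in> topspace (contraction V E F)" if "x \<in> topspace T" for x
        using that F top compE_in K
        by (cases x; cases "projl x") (auto simp: topspace_contraction lives_in_comps_def)
      then show ?thesis by (auto simp: contraction_def)
    qed
  qed
  then show ?thesis
    unfolding inverse_limit_def continuous_map_in_subtopology
    using lift_in_inverse_limit[OF K] top
    by (auto simp: continuous_map_componentwise lift_def topspace_inverse_limit image_subset_iff)
qed

section \<open>The edge-end space\<close>

lemma lift_coord_pcomp:
  "x \<in> Inl ` Vert ` V \<union> Inr ` Z \<Longrightarrow> lift_coord K F x = Vert (pcomp K x F)"
  by (auto simp: pcomp_def)

lemma pcomp_in: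
  assumes "lives_in_comps Z K" "x \<in> Inl ` Vert ` V \<union> Inr ` Z" "F \<in> fin_edges E"
  shows "pcomp K x F \<in> CE F"
  using assms compE_in by (auto simp: pcomp_def lives_in_comps_def)

lemma pcomp_mono:
  assumes K: "lives_in_comps Z K" and x: "x \<in> Inl ` Vert ` V \<union> Inr ` Z"
    and F: "F \<in> fin_edges E" "F' \<in> fin_edges E" "F \<subseteq> F'"
  shows "pcomp K x F' \<subseteq> pcomp K x F"
  using x
proof
  assume "x \<in> Inl ` Vert ` V"
  then obtain v where v: "v \<in> V" "x = Inl (Vert v)" by blast
  then show ?thesis using CE_mono[OF compE_in compE_in F(3) in_compE in_compE] by (simp add: pcomp_def)
next
  assume "x \<in> Inr ` Z"
  then obtain z where "z \<in> Z" "x = Inr z" by blast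
  then show ?thesis using K F by (simp add: pcomp_def lives_in_comps_def)
qed

lemma pcomp_eqI:
  assumes K: "lives_in_comps Z K" and x: "x \<in> Inl ` Vert ` V \<union> Inr ` Z"
    and F: "F \<in> fin_edges E" "F' \<in> fin_edges E" "F \<subseteq> F'"
    and d: "d \<in> CE F" "pcomp K x F' \<subseteq> d"
  shows "pcomp K x F = d"
proof -
  obtain v where v: "v \<in> pcomp K x F'" using CE_nonempty[OF pcomp_in[OF K x F(2)]] by blast
  then show ?thesis using pcomp_mono[OF K x F] d CE_disjoint[OF pcomp_in[OF K x F(1)] d(1), of v] by blast
qed

section \<open>Rays, edge-ends and the components they live in\<close>

lemma ray_shift: "ray V E R \<Longrightarrow> ray V E (\<lambda>i. R (m + i))"
  by (auto simp: ray_def inj_eq intro!: injI)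

lemma ray_tail_ray:
  assumes R: "ray V E R" and F: "F \<in> fin_edges E"
  shows "\<exists>m. ray (tailE R F) (E - F) (\<lambda>i. R (m + i))"
proof -
  obtain m where m: "\<forall>i\<ge>m. R i \<in> tailE R F \<and> R i \<notin> \<Union>F" using tailE(2)[OF R F] ..
  have "{R (m + i), R (m + Suc i)} \<in> E - F" for i
  proof -
    have "R (m + i) \<notin> \<Union>F" using m by simp
    moreover have "{R (m + i), R (m + Suc i)} \<in> E" using R by (simp add: ray_def)
    ultimately show ?thesis by blast
  qed
  moreover have "inj (\<lambda>i. R (m + i))" using ray_shift[OF R] by (simp add: ray_def)
  moreover have "range (\<lambda>i. R (m + i)) \<subseteq> tailE R F" using m by auto
  ultimately show ?thesis unfolding ray_def by (intro exI[of _ m]) blast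
qed

lemma ray_in_tailE:
  assumes "C \<in> CE F" "ray C (E - F) (\<lambda>i. R (m + i))"
  shows "tailE R F = C"
proof (rule tailE_eq[OF assms(1)])
  show "\<forall>i\<ge>m. R i \<in> C"
  proof (intro allI impI)
    fix i assume "m \<le> i"
    then have "R i = R (m + (i - m))" by simp
    then show "R i \<in> C" using assms(2) by (auto simp: ray_def)
  qed
qed

lemma edge_separates_iff:
  assumes "ray V E R" "ray V E S" "F \<in> fin_edges E"
  shows "edge_separates V E F R S \<longleftrightarrow> tailE R F \<noteq> tailE S F"
proof
  assume "edge_separates V E F R S"
  then show "tailE R F \<noteq> tailE S F" unfolding edge_separates_def using ray_in_tailE by metis
next
  assume "tailE R F \<noteq> tailE S F"
  then show "edge_separates V E F R S"
    unfolding edge_separates_def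
    using tailE(1)[OF assms(1,3)] tailE(1)[OF assms(2,3)] ray_tail_ray[OF assms(1,3)] ray_tail_ray[OF assms(2,3)]
    by blast
qed

text \<open>Equality of tails is visibly an equivalence relation, and it makes the components of an
  end independent of the chosen ray.\<close>

lemma ray_equiv_iff:
  "(R, S) \<in> ray_equiv V E \<longleftrightarrow> ray V E R \<and> ray V E S \<and> (\<forall>F\<in>fin_edges E. tailE R F = tailE S F)"
  using edge_separates_iff unfolding ray_equiv_def by auto

definition endK :: "(nat \<Rightarrow> 'a) set \<Rightarrow> 'a set set \<Rightarrow> 'a set" where
  "endK \<omega> F = tailE (SOME R. R \<in> \<omega>) F"

lemma edge_ends_cases:
  assumes "\<omega> \<in> edge_ends V E"
  obtains R where "ray V E R" "\<omega> = ray_equiv V E `` {R}" "R \<in> \<omega>"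
proof -
  obtain R where "ray V E R" "\<omega> = ray_equiv V E `` {R}"
    using assms unfolding edge_ends_def quotient_def by blast
  moreover from this have "R \<in> \<omega>" by (simp add: ray_equiv_iff)
  ultimately show ?thesis using that by blast
qed

lemma endK_eq:
  assumes \<omega>: "\<omega> \<in> edge_ends V E" and R: "R \<in> \<omega>"
  shows "ray V E R" and "F \<in> fin_edges E \<Longrightarrow> endK \<omega> F = tailE R F"
proof -
  obtain S where S: "ray V E S" "\<omega> = ray_equiv V E `` {S}" "S \<in> \<omega>" using edge_ends_cases[OF \<omega>] .
  show "ray V E R" using R S by (simp add: ray_equiv_iff)
  define Q where "Q = (SOME R. R \<in> \<omega>)"
  have "Q \<in> \<omega>" unfolding Q_def by (rule someI[of "\<lambda>R. R \<in> \<omega>", OF R])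
  then have "(S, Q) \<in> ray_equiv V E" "(S, R) \<in> ray_equiv V E" using R S(2) by auto
  then show "F \<in> fin_edges E \<Longrightarrow> endK \<omega> F = tailE R F"
    unfolding endK_def Q_def[symmetric] ray_equiv_iff by simp
qed

lemma endK_lives: "lives_in_comps (edge_ends V E) endK"
  unfolding lives_in_comps_def
proof (intro ballI conjI impI)
  fix \<omega> F assume \<omega>: "\<omega> \<in> edge_ends V E" and F: "F \<in> fin_edges E"
  obtain R where R: "ray V E R" "\<omega> = ray_equiv V E `` {R}" "R \<in> \<omega>" using edge_ends_cases[OF \<omega>] .
  show "endK \<omega> F \<in> CE F" using endK_eq(2)[OF \<omega> R(3) F] tailE(1)[OF R(1) F] by simp
  fix F' assume F': "F' \<in> fin_edges E" "F \<subseteq> F'"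
  obtain m where m: "\<forall>i\<ge>m. R i \<in> tailE R F" using tailE(2)[OF R(1) F] by blast
  obtain n where n: "\<forall>i\<ge>n. R i \<in> tailE R F'" using tailE(2)[OF R(1) F'(1)] by blast
  have "tailE R F' \<subseteq> tailE R F"
    using CE_mono[OF tailE(1)[OF R(1) F'(1)] tailE(1)[OF R(1) F] F'(2), of "R (max m n)"] tails_meet[OF m n]
    by blast
  then show "endK \<omega> F' \<subseteq> endK \<omega> F" using endK_eq(2)[OF \<omega> R(3)] F F' by simp
qed

lemma endK_rays:
  assumes "ray V E R"
  shows "\<exists>\<omega>\<in>edge_ends V E. \<forall>F\<in>fin_edges E. endK \<omega> F = tailE R F"
proof -
  have "ray_equiv V E `` {R} \<in> edge_ends V E" using assms unfolding edge_ends_def by (intro quotientI) simp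
  moreover have "R \<in> ray_equiv V E `` {R}" using assms by (simp add: ray_equiv_iff)
  ultimately show ?thesis using endK_eq(2) by blast
qed

text \<open>The definition of \<open>edge_ends_in\<close> asks for a ray that lies in
  \<open>C\<close> entirely, not merely with a tail. As the tails of a ray are equivalent to the
  ray, this makes no difference.\<close>

lemma edge_ends_in_iff:
  assumes F: "F \<in> fin_edges E" and C: "C \<in> CE F"
  shows "\<omega> \<in> edge_ends_in V E F C \<longleftrightarrow> \<omega> \<in> edge_ends V E \<and> endK \<omega> F = C"
proof
  assume "\<omega> \<in> edge_ends_in V E F C"
  then obtain R where R: "\<omega> \<in> edge_ends V E" "R \<in> \<omega>" "ray C (E - F) R" by (auto simp: edge_ends_in_def)
  then show "\<omega> \<in> edge_ends V E \<and> endK \<omega> F = C"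
    using endK_eq(2)[OF R(1,2) F] ray_in_tailE[OF C, of R 0] by simp
next
  assume \<omega>: "\<omega> \<in> edge_ends V E \<and> endK \<omega> F = C"
  then obtain R where R: "ray V E R" "\<omega> = ray_equiv V E `` {R}" "R \<in> \<omega>" using edge_ends_cases by blast
  have "tailE R F = C" using \<omega> endK_eq(2)[OF _ R(3) F] by simp
  then obtain m where m: "ray C (E - F) (\<lambda>i. R (m + i))" using ray_tail_ray[OF R(1) F] by auto
  have ray: "ray V E (\<lambda>i. R (m + i))" using R(1) by (rule ray_shift)
  have "tailE R F' = tailE (\<lambda>i. R (m + i)) F'" if F': "F' \<in> fin_edges E" for F'
  proof -
    obtain n where "\<forall>i\<ge>n. R i \<in> tailE R F'" using tailE(2)[OF R(1) F'] by blast
    then have "\<forall>i\<ge>n. R (m + i) \<in> tailE R F'" by simp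
    then show ?thesis using tailE_eq[OF tailE(1)[OF R(1) F'], of n "\<lambda>i. R (m + i)"] by simp
  qed
  then have "(\<lambda>i. R (m + i)) \<in> \<omega>" using R ray by (simp add: ray_equiv_iff)
  then show "\<omega> \<in> edge_ends_in V E F C" using \<omega> m by (auto simp: edge_ends_in_def)
qed

section \<open>The topology on the graph with its edge-ends\<close>

definition end_nbhd :: "'a set set \<Rightarrow> 'a set \<Rightarrow> ('a set \<Rightarrow> 'a \<Rightarrow> real) \<Rightarrow> 'a epoint set" where
  "end_nbhd F C l =
     Inl ` (graph_points C {e \<in> E - F. e \<subseteq> C} \<union>
             (\<Union>e\<in>F. \<Union>x\<in>e \<inter> C. half_edge e x (l e x))) \<union>
      Inr ` edge_ends_in V E F C"

lemma edge_end_nbhds_eq: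
  "edge_end_nbhds V E = {end_nbhd F C l | F C l.
     F \<in> fin_edges E \<and> C \<in> CE F \<and> (\<forall>e x. 0 < l e x \<and> l e x < 1)}"
  unfolding edge_end_nbhds_def end_nbhd_def by (rule refl)

lemma in_end_nbhd [simp]:
  "Inl (Vert v) \<in> end_nbhd F C l \<longleftrightarrow> v \<in> C"
  "Inl (Inner e t) \<in> end_nbhd F C l \<longleftrightarrow> 0 < t \<and> t < 1 \<and>
     (e \<in> E - F \<and> e \<subseteq> C \<or> e \<in> F \<and> (\<exists>x\<in>e \<inter> C. dist_from e x t < l e x))"
  "Inr \<omega> \<in> end_nbhd F C l \<longleftrightarrow> \<omega> \<in> edge_ends_in V E F C"
  by (auto simp: end_nbhd_def)

lemma openin_end_nbhd:
  assumes "F \<in> fin_edges E" "C \<in> CE F" "\<And>e x. 0 < l e x \<and> l e x < 1"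
  shows "openin (edge_end_pretopology V E) (end_nbhd F C l)"
  unfolding edge_end_pretopology_def
  using assms by (intro topology_generated_by_Basis UnI2) (unfold edge_end_nbhds_eq, blast)

lemma openin_end_inner:
  "e \<in> E \<Longrightarrow> open T \<Longrightarrow> T \<subseteq> {0<..<1} \<Longrightarrow> openin (edge_end_pretopology V E) (Inl ` Inner e ` T)"
  unfolding edge_end_pretopology_def
  by (intro topology_generated_by_Basis UnI1) (auto simp: inner_opens_def)

lemma topspace_edge_end: "topspace (edge_end_pretopology V E) = points (edge_ends V E)"
proof
  show "topspace (edge_end_pretopology V E) \<subseteq> points (edge_ends V E)"
  proof
    fix x assume "x \<in> topspace (edge_end_pretopology V E)"
    then have "x \<in> \<Union>{Inl ` W | W. W \<in> inner_opens E} \<or> x \<in> \<Union>(edge_end_nbhds V E)"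
      unfolding edge_end_pretopology_def topology_generated_by_topspace by blast
    then show "x \<in> points (edge_ends V E)"
    proof
      assume "x \<in> \<Union>{Inl ` W | W. W \<in> inner_opens E}"
      then obtain W where W: "W \<in> inner_opens E" "x \<in> Inl ` W" by blast
      then have "W \<subseteq> graph_points V E" by (auto simp: inner_opens_def)
      then show ?thesis using W by blast
    next
      assume "x \<in> \<Union>(edge_end_nbhds V E)"
      then obtain F C l where F: "F \<in> fin_edges E" "C \<in> CE F" "x \<in> end_nbhd F C l"
        unfolding edge_end_nbhds_eq by blast
      show ?thesis
      proof (cases x)
        case (Inl y)
        then show ?thesis using F CE_subset[OF F(2)]
          by (cases y) (auto simp: fin_edges_def)
      next
        case (Inr \<omega>)
        then show ?thesis using F by (simp add: edge_ends_in_iff)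
      qed
    qed
  qed
  show "points (edge_ends V E) \<subseteq> topspace (edge_end_pretopology V E)"
  proof
    fix x assume x: "x \<in> points (edge_ends V E)"
    have "\<exists>W. openin (edge_end_pretopology V E) W \<and> x \<in> W"
    proof (cases "\<exists>e t. x = Inl (Inner e t)")
      case True
      then obtain e t where et: "x = Inl (Inner e t)" by blast
      then show ?thesis using x openin_end_inner[of e "{0<..<1}"]
        by (intro exI[of _ "Inl ` Inner e ` {0<..<1}"]) auto
    next
      case False
      then have x': "x \<in> Inl ` Vert ` V \<union> Inr ` edge_ends V E"
        using x by (auto simp: graph_points_def inner_edge_def)
      let ?C = "pcomp endK x {}"
      have C: "?C \<in> CE {}" using pcomp_in[OF endK_lives x' empty_fin_edges] .
      have "x \<in> end_nbhd {} ?C (\<lambda>_ _. 1/2)"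
        using x' C by (auto simp: pcomp_def in_compE edge_ends_in_iff empty_fin_edges)
      then show ?thesis using openin_end_nbhd[OF empty_fin_edges C, of "\<lambda>_ _. 1/2"] by auto
    qed
    then show "x \<in> topspace (edge_end_pretopology V E)" using openin_subset by blast
  qed
qed

lemma openin_inverse_limit_coord:
  assumes "F \<in> fin_edges E" "openin (contraction V E F) B"
  shows "openin (inverse_limit V E) {p \<in> topspace (inverse_limit V E). p F \<in> B}"
proof -
  have "continuous_map (inverse_limit V E) (contraction V E F) (\<lambda>p. p F)"
    unfolding inverse_limit_def
    using assms(1) by (intro continuous_map_from_subtopology continuous_map_product_projection)
  then show ?thesis using assms(2) by (rule openin_continuous_map_preimage)
qed

lemma openin_contraction_half_edge:
  "e \<in> E \<Longrightarrow> openin (contraction V E F) (half_edge e x r)"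
  unfolding half_edge_def by (intro openin_contraction_inner open_half_edge_times) auto

text \<open>The coordinate at \<open>F\<close> alone already sees the set. The edges of
  \<open>F\<close> inside \<open>C\<close> are loops of G.F, and every non-loop at \<open>C\<close>
  belongs to \<open>F\<close>. A basic neighbourhood in G.F has one radius per edge where
  \<open>l\<close> allows one per end, so \<open>B\<close> is a small basic neighbourhood of the
  vertex \<open>C\<close> enlarged by the open half-edges that \<open>end_nbhd\<close>
  prescribes.\<close>

lemma end_nbhd_pulled_back:
  assumes F: "F \<in> fin_edges E" and C: "C \<in> CE F" and l: "\<And>e x. 0 < l e x \<and> l e x < 1"
  shows "\<exists>B. openin (contraction V E F) B \<and>
    (\<forall>x\<in>points (edge_ends V E). x \<in> end_nbhd F C l \<longleftrightarrow> lift_coord endK F x \<in> B)"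
proof -
  \<comment> \<open>\<open>r e\<close> is the smaller of the radii at the two ends, with a default
    outside \<open>E\<close> because the parameters must be bounded for every \<open>e\<close>. The
    bound 1/2 on \<open>a\<close> ensures \<open>a e \<le> b e\<close>.\<close>
  define r where "r e = (if e \<in> E then Min (l e ` e) else 1/2)" for e
  define a where "a e = min (1/2) (r e)" for e
  define b where "b e = 1 - a e" for e
  have fe: "finite e \<and> e \<noteq> {}" if "e \<in> E" for e using edgeE[OF that] by (metis finite.emptyI finite_insert insert_not_empty)
  have r_le: "r e \<le> l e x" if "e \<in> E" "x \<in> e" for e x using that fe[of e] by (simp add: r_def)
  have r: "0 < r e \<and> r e < 1" for e
  proof (cases "e \<in> E")
    case True
    then have "r e \<in> l e ` e" using fe[of e] by (simp add: r_def)
    then show ?thesis using l by auto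
  qed (simp add: r_def)
  define L where "L = {e \<in> F. e \<subseteq> C}"
  have FE: "F \<subseteq> E" "finite F" using F by (auto simp: fin_edges_def)
  have L: "L \<subseteq> loops E C" using FE by (auto simp: L_def loops_def)
  have data: "nbhd_data C r L a b"
    using r L FE by (auto simp: nbhd_data_def L_def a_def b_def min_def)
  define B where "B = contraction_nbhd E C r L a b \<union> (\<Union>e\<in>F. \<Union>x\<in>e \<inter> C. half_edge e x (l e x))"
  have "openin (contraction V E F) B"
    unfolding B_def using openin_contraction_nbhd[OF C data] FE
    by (intro openin_Un openin_Union) (auto intro!: openin_contraction_half_edge)
  moreover have "x \<in> end_nbhd F C l \<longleftrightarrow> lift_coord endK F x \<in> B" if x: "x \<in> points (edge_ends V E)" for x
  proof (cases x)
    case (Inr \<omega>)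
    then show ?thesis using x edge_ends_in_iff[OF F C] by (auto simp: B_def)
  next
    case (Inl y)
    show ?thesis
    proof (cases y)
      case (Vert v)
      then have v: "v \<in> V" using x Inl by auto
      have "v \<in> C \<longleftrightarrow> compE F v = C" using compE_eq[OF C] in_compE[OF v] by auto
      then show ?thesis using Inl Vert by (auto simp: B_def)
    next
      case (Inner e t)
      then have et: "e \<in> E" "0 < t" "t < 1" using x Inl by auto
      have N: "Inner e t \<in> contraction_nbhd E C r L a b \<longleftrightarrow>
         (if e \<subseteq> C then e \<in> L \<longrightarrow> t < a e \<or> b e < t else \<exists>x\<in>e \<inter> C. dist_from e x t < r e)"
        using Inner_in_contraction_nbhd[OF L] et by simp
      let ?P = "e \<in> F \<and> (\<exists>x\<in>e \<inter> C. dist_from e x t < l e x)"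
      have "e \<notin> F \<and> e \<subseteq> C \<or> ?P" if nb: "Inner e t \<in> contraction_nbhd E C r L a b"
      proof (cases "e \<subseteq> C")
        case True
        show ?thesis
        proof (cases "e \<in> F")
          case True
          then have "e \<in> L" using \<open>e \<subseteq> C\<close> by (simp add: L_def)
          then have "t < a e \<or> b e < t" using nb N \<open>e \<subseteq> C\<close> by simp
          obtain u v where uv: "e = {u, v}" "u \<noteq> v" "u \<in> V" "v \<in> V" using edgeE[OF et(1)] .
          \<comment> \<open>\<open>t\<close> is the distance from \<open>edge_origin e\<close> and
            \<open>1 - t\<close> that from the other end; as \<open>b e = 1 - a e\<close>, lying
            outside the removed interval means being near one of the ends.\<close>
          have "\<exists>x\<in>e. dist_from e x t < a e"
          proof -
            have "edge_origin e = u \<or> edge_origin e = v" using edge_origin_in[OF et(1)] uv by auto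
            then show ?thesis using \<open>t < a e \<or> b e < t\<close> uv unfolding b_def dist_from_def by auto
          qed
          then obtain x where "x \<in> e" "dist_from e x t < a e" by blast
          moreover have "a e \<le> l e x" using r_le[OF et(1) \<open>x \<in> e\<close>] by (simp add: a_def)
          ultimately show ?thesis using \<open>e \<in> F\<close> \<open>e \<subseteq> C\<close> by force
        qed (use True in simp)
      next
        case False
        then obtain x where x: "x \<in> e \<inter> C" "dist_from e x t < r e" using nb N by auto
        then have "e \<in> F" using CE_edge[OF C et(1), of x] False by blast
        then show ?thesis using x r_le[OF et(1), of x] by force
      qed
      moreover have "Inner e t \<in> contraction_nbhd E C r L a b" if "e \<notin> F" "e \<subseteq> C"
        using that N by (simp add: L_def)
      ultimately show ?thesis using Inl Inner et by (auto simp: B_def)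
    qed
  qed
  ultimately show ?thesis by blast
qed

text \<open>A basic neighbourhood in G.F restricts the finitely many loops in \<open>L\<close>, on
  which a neighbourhood of \<open>x\<close> formed with \<open>F\<close> alone has no control. With
  \<open>L\<close> deleted as well, these edges contribute only half-edges of prescribed
  length.\<close>

lemma lift_endK_continuous:
  "continuous_map (edge_end_pretopology V E) (inverse_limit V E) (lift endK)"
proof (rule lift_continuous[OF endK_lives topspace_edge_end openin_end_inner])
  fix F x j L a b
  assume F: "F \<in> fin_edges E" and x: "x \<in> Inl ` Vert ` V \<union> Inr ` edge_ends V E"
    and data: "nbhd_data (pcomp endK x F) j L a b"
  define d where "d = pcomp endK x F"
  have L: "finite L" "L \<subseteq> loops E d" "L \<subseteq> E" and jab: "\<And>e. 0 < j e \<and> j e < 1 \<and> 0 < a e \<and> a e \<le> b e \<and> b e < 1"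
    using data by (auto simp: nbhd_data_def d_def loops_def)
  let ?F = "F \<union> L"
  have F': "?F \<in> fin_edges E" using F L by (auto simp: fin_edges_def)
  define C where "C = pcomp endK x ?F"
  have C: "C \<in> CE ?F" unfolding C_def by (rule pcomp_in[OF endK_lives x F'])
  have d: "d \<in> CE F" unfolding d_def by (rule pcomp_in[OF endK_lives x F])
  have Cd: "C \<subseteq> d" unfolding C_def d_def by (rule pcomp_mono[OF endK_lives x F F']) simp
  \<comment> \<open>Bounded by \<open>j\<close> for the non-loops; bounded by \<open>a\<close> and
    \<open>1 - b\<close> so that a half-edge from either end stays clear of the removed
    interval.\<close>
  define l where "l e x = min (j e) (min (a e) (1 - b e))" for e and x :: 'a
  have l: "0 < l e x \<and> l e x < 1" for e x using jab[of e] by (auto simp: l_def)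
  have "lift_coord endK F y \<in> contraction_nbhd E d j L a b" if y: "y \<in> end_nbhd ?F C l" for y
  proof (cases "\<exists>e t. y = Inl (Inner e t)")
    case True
    then obtain e t where et: "y = Inl (Inner e t)" by blast
    with y consider "e \<in> E - ?F" "e \<subseteq> C" "0 < t" "t < 1"
      | u where "e \<in> ?F" "u \<in> e" "u \<in> C" "dist_from e u t < l e u" "0 < t" "t < 1" by auto
    then show ?thesis
    proof cases
      case 1
      then show ?thesis using et Cd by (auto simp: Inner_in_contraction_nbhd[OF L(2)])
    next
      case 2
      have "t < a e \<or> b e < t" using 2(4) by (auto simp: l_def dist_from_def split: if_splits)
      moreover have "dist_from e u t < j e" using 2(4) by (simp add: l_def)
      moreover have "e \<in> E" using 2(1) F L by (auto simp: fin_edges_def)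
      ultimately show ?thesis using et 2 Cd by (auto simp: Inner_in_contraction_nbhd[OF L(2)])
    qed
  next
    case False
    have "y \<in> points (edge_ends V E)"
      using y openin_subset[OF openin_end_nbhd[OF F' C, of l]] l topspace_edge_end by blast
    then have y': "y \<in> Inl ` Vert ` V \<union> Inr ` edge_ends V E"
      using False by (auto simp: graph_points_def inner_edge_def)
    have "pcomp endK y ?F = C"
      using y' y C by (auto simp: pcomp_def edge_ends_in_iff[OF F' C] compE_eq)
    then have "pcomp endK y F = d" using Cd by (intro pcomp_eqI[OF endK_lives y' F F' _ d]) auto
    then show ?thesis using lift_coord_pcomp[OF y'] by simp
  qed
  moreover have "x \<in> end_nbhd ?F C l"
    using x C by (auto simp: C_def pcomp_def edge_ends_in_iff[OF F'] in_compE)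
  ultimately show "\<exists>W. openin (edge_end_pretopology V E) W \<and> x \<in> W \<and>
      lift_coord endK F ` W \<subseteq> contraction_nbhd E (pcomp endK x F) j L a b"
    using openin_end_nbhd[OF F' C l] unfolding d_def[symmetric]
    by (intro exI[of _ "end_nbhd ?F C l"]) auto
qed

theorem edge_end_space_homeomorphic_inverse_limit:
  "edge_end_space V E homeomorphic_space inverse_limit V E"
  unfolding edge_end_space_def edge_end_pretopology_def
proof (rule indistinguishable_quotient_homeomorphic_space)
  let ?S = "{Inl ` W | W. W \<in> inner_opens E} \<union> edge_end_nbhds V E"
  have T: "topology_generated_by ?S = edge_end_pretopology V E" by (simp add: edge_end_pretopology_def)
  show "continuous_map (topology_generated_by ?S) (inverse_limit V E) (lift endK)"
    unfolding T by (rule lift_endK_continuous)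
  show "lift endK ` topspace (topology_generated_by ?S) = topspace (inverse_limit V E)"
    unfolding T topspace_edge_end by (rule lift_surj[OF endK_lives endK_rays])
  show "Hausdorff_space (inverse_limit V E)" by (rule Hausdorff_inverse_limit)
  fix A assume A: "A \<in> ?S"
  then have sub: "A \<subseteq> points (edge_ends V E)"
    using openin_subset[OF topology_generated_by_Basis[OF A]] by (simp add: T topspace_edge_end)
  have "\<exists>F\<in>fin_edges E. \<exists>B. openin (contraction V E F) B \<and>
    (\<forall>x\<in>points (edge_ends V E). x \<in> A \<longleftrightarrow> lift_coord endK F x \<in> B)"
    using A
  proof
    assume "A \<in> {Inl ` W | W. W \<in> inner_opens E}"
    then obtain e T where eT: "e \<in> E" "open T" "T \<subseteq> {0<..<1}" "A = Inl ` Inner e ` T"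
      by (auto simp: inner_opens_def)
    \<comment> \<open>Inner edge points are unchanged in all coordinates, so any finite edge set
      will do, here the empty one.\<close>
    have "x \<in> A \<longleftrightarrow> lift_coord endK {} x \<in> Inner e ` T" for x
      using eT(4) by (cases x; cases "projl x") auto
    then show ?thesis using openin_contraction_inner[OF eT(1-3), of "{}"] empty_fin_edges by blast
  next
    assume "A \<in> edge_end_nbhds V E"
    then obtain F C l where F: "F \<in> fin_edges E" "C \<in> CE F" and l: "\<And>e x. 0 < l e x \<and> l e x < 1"
      and A_eq: "A = end_nbhd F C l" unfolding edge_end_nbhds_eq by blast
    show ?thesis unfolding A_eq by (rule bexI[of _ F]; (rule end_nbhd_pulled_back F l)+)
  qed
  then obtain F B where F: "F \<in> fin_edges E" and B: "openin (contraction V E F) B"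
    and AB: "\<And>x. x \<in> points (edge_ends V E) \<Longrightarrow> x \<in> A \<longleftrightarrow> lift_coord endK F x \<in> B" by blast
  have "A = {x \<in> topspace (topology_generated_by ?S). lift endK x \<in> {p \<in> topspace (inverse_limit V E). p F \<in> B}}"
    unfolding T topspace_edge_end
  proof (intro set_eqI iffI)
    fix x assume x: "x \<in> A"
    then have "x \<in> points (edge_ends V E)" using sub by (rule subsetD[rotated])
    then show "x \<in> {x \<in> points (edge_ends V E).
        lift endK x \<in> {p \<in> topspace (inverse_limit V E). p F \<in> B}}"
      using AB x F lift_in_inverse_limit[OF endK_lives] by (simp add: lift_def)
  next
    fix x assume "x \<in> {x \<in> points (edge_ends V E).
        lift endK x \<in> {p \<in> topspace (inverse_limit V E). p F \<in> B}}"
    then show "x \<in> A" using AB F by (simp add: lift_def)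
  qed
  then show "\<exists>B. openin (inverse_limit V E) B \<and> A = {x \<in> topspace (topology_generated_by ?S). lift endK x \<in> B}"
    using openin_inverse_limit_coord[OF F B] by blast
qed

section \<open>Ultrafilter families and the components they live in\<close>

abbreviation "UF \<equiv> ultra_families V E"

lemma UF_ultrafilter: "U \<in> UF \<Longrightarrow> X \<in> fin_verts V \<Longrightarrow> ultrafilter_on (CX X) (U X)"
  by (auto simp: ultra_families_def)

lemma UF_compatible:
  "U \<in> UF \<Longrightarrow> X \<in> fin_verts V \<Longrightarrow> X' \<in> fin_verts V \<Longrightarrow> X \<subseteq> X' \<Longrightarrow> ultra_map V E X (U X') = U X"
  by (simp add: ultra_families_def)

lemma UF_push:
  assumes "U \<in> UF" "X \<in> fin_verts V" "X' \<in> fin_verts V" "X \<subseteq> X'"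
    and "\<C>' \<in> U X'" "comp_map V E X ` \<C>' \<subseteq> \<C>" "\<C> \<subseteq> CX X"
  shows "\<C> \<in> U X"
proof -
  have "\<C> \<in> ultra_map V E X (U X')" unfolding ultra_map_def using assms(5-7) by blast
  then show ?thesis using UF_compatible[OF assms(1-4)] by simp
qed

text \<open>Without the full preimage of \<open>\<C>\<close>, its complement would be a member of
  \<open>U X'\<close>, and pushing that forward would put the complement of \<open>\<C>\<close> into
  \<open>U X\<close>.\<close>

lemma UF_pull:
  assumes U: "U \<in> UF" and X: "X \<in> fin_verts V" "X' \<in> fin_verts V" "X \<subseteq> X'" and C: "\<C> \<in> U X"
  shows "{c \<in> CX X'. comp_map V E X c \<in> \<C>} \<in> U X'"
proof (rule ccontr)
  assume n: "{c \<in> CX X'. comp_map V E X c \<in> \<C>} \<notin> U X'"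
  have uf: "ultrafilter_on (CX X') (U X')" using U X by (intro UF_ultrafilter)
  have "CX X' - {c \<in> CX X'. comp_map V E X c \<in> \<C>} \<in> U X'"
    using uf n unfolding ultrafilter_on_def by (metis (no_types, lifting) mem_Collect_eq subsetI)
  moreover have "comp_map V E X ` (CX X' - {c \<in> CX X'. comp_map V E X c \<in> \<C>}) \<subseteq> CX X - \<C>"
    using comp_map_in[OF _ X(3)] by blast
  ultimately have "CX X - \<C> \<in> U X" by (intro UF_push[OF U X]) auto
  then show False using ultrafilter_on_Int_nonempty[OF UF_ultrafilter[OF U X(1)] C] by blast
qed

section \<open>Sets in which an ultrafilter family lives\<close>

text \<open>The boundary edges of \<open>W\<close> have both ends in \<open>X\<close>, so that no
  component of G - X has vertices both in \<open>W\<close> and outside. Components of G - F and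
  sides of finite cuts are of this kind when \<open>X\<close> consists of the ends of the deleted or
  cut edges.\<close>

definition clean :: "'a set \<Rightarrow> 'a set \<Rightarrow> bool" where
  "clean X W \<longleftrightarrow> W \<subseteq> V \<and> (\<forall>e\<in>E. e \<inter> W \<noteq> {} \<and> \<not> e \<subseteq> W \<longrightarrow> e \<subseteq> X)"

definition lives :: "('a set \<Rightarrow> 'a set set set) \<Rightarrow> 'a set \<Rightarrow> 'a set \<Rightarrow> bool" where
  "lives U X W \<longleftrightarrow> {c \<in> CX X. c \<subseteq> W} \<in> U X"

lemma clean_comp:
  assumes "clean X W" "c \<in> CX X" "v \<in> c" "v \<in> W"
  shows "c \<subseteq> W"
proof (rule comps_subset_closed[of c "V - X" "{e \<in> E. e \<inter> X = {}}" v])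
  fix u w assume u: "u \<in> W" and uw: "{u, w} \<in> {e \<in> E. e \<inter> X = {}}"
  have "\<forall>e\<in>E. e \<inter> W \<noteq> {} \<and> \<not> e \<subseteq> W \<longrightarrow> e \<subseteq> X" using assms(1) by (simp add: clean_def)
  from bspec[OF this, of "{u, w}"] show "w \<in> W" using u uw by auto
qed (use assms Union_edges_avoiding_subset in \<open>auto simp: comps_del_verts_def\<close>)

lemma lives_mono:
  assumes "U \<in> UF" "X \<in> fin_verts V" "lives U X W" "W \<subseteq> W'"
  shows "lives U X W'"
  unfolding lives_def
  by (rule ultrafilter_on_superset[OF UF_ultrafilter[OF assms(1,2)] assms(3)[unfolded lives_def]])
     (use assms(4) in auto)

lemma lives_disjoint:
  assumes "U \<in> UF" "X \<in> fin_verts V" "lives U X W" "lives U X W'"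
  shows "W \<inter> W' \<noteq> {}"
proof -
  have "{c \<in> CX X. c \<subseteq> W} \<inter> {c \<in> CX X. c \<subseteq> W'} \<noteq> {}"
    using ultrafilter_on_Int_nonempty[OF UF_ultrafilter[OF assms(1,2)]] assms(3,4) by (simp add: lives_def)
  then obtain c where "c \<in> CX X" "c \<subseteq> W" "c \<subseteq> W'" by blast
  then show ?thesis using CX_nonempty by blast
qed

lemma lives_or:
  assumes U: "U \<in> UF" and X: "X \<in> fin_verts V" and W: "clean X W"
  shows "lives U X W \<or> lives U X (V - W)"
proof (rule disjCI)
  assume "\<not> lives U X (V - W)"
  moreover have "CX X - {c \<in> CX X. c \<subseteq> W} \<subseteq> {c \<in> CX X. c \<subseteq> V - W}"
    using clean_comp[OF W] CX_subset by blast
  ultimately have "CX X - {c \<in> CX X. c \<subseteq> W} \<notin> U X"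
    unfolding lives_def using ultrafilter_on_superset[OF UF_ultrafilter[OF U X]] by blast
  moreover have "{c \<in> CX X. c \<subseteq> W} \<subseteq> CX X" by blast
  ultimately show "lives U X W"
    using UF_ultrafilter[OF U X] unfolding ultrafilter_on_def lives_def by blast
qed

text \<open>From \<open>X\<close> up to \<open>Y\<close> the components are pulled back. From
  \<open>Y\<close> down to \<open>X\<close>, a component of G - X that contains one of G - Y inside
  \<open>W\<close> meets \<open>W\<close>, and by cleanness it lies in \<open>W\<close>. This allows
  comparing different edge sets, and passing to a larger vertex set when an arbitrary neighbourhood
  is given.\<close>

lemma lives_indep:
  assumes U: "U \<in> UF" and X: "X \<in> fin_verts V" "Y \<in> fin_verts V" "X \<subseteq> Y" and W: "clean X W"
  shows "lives U Y W \<longleftrightarrow> lives U X W"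
proof
  assume l: "lives U Y W"
  have "comp_map V E X c \<subseteq> W" if c: "c \<in> CX Y" "c \<subseteq> W" for c
  proof -
    obtain v where "v \<in> c" using CX_nonempty[OF c(1)] by blast
    then show ?thesis using clean_comp[OF W, of "comp_map V E X c" v] comp_map_in[OF c(1) X(3)] c(2) by blast
  qed
  then show "lives U X W"
    using l comp_map_in[OF _ X(3)] unfolding lives_def
    by (intro UF_push[OF U X, of "{c \<in> CX Y. c \<subseteq> W}"]) auto
next
  assume "lives U X W"
  then have "{c \<in> CX Y. comp_map V E X c \<in> {c \<in> CX X. c \<subseteq> W}} \<in> U Y"
    unfolding lives_def by (rule UF_pull[OF U X])
  moreover have "{c \<in> CX Y. comp_map V E X c \<in> {c \<in> CX X. c \<subseteq> W}} \<subseteq> {c \<in> CX Y. c \<subseteq> W}"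
    using comp_map_in[OF _ X(3)] by blast
  ultimately show "lives U Y W"
    unfolding lives_def using ultrafilter_on_superset[OF UF_ultrafilter[OF U X(2)]] by blast
qed

lemma clean_CE: "C \<in> CE F \<Longrightarrow> clean (\<Union>F) C"
  unfolding clean_def using CE_edge CE_subset by blast

definition tanK :: "('a set \<Rightarrow> 'a set set set) \<Rightarrow> 'a set set \<Rightarrow> 'a set" where
  "tanK U F = (THE C. C \<in> CE F \<and> lives U (\<Union>F) C)"

lemma tanK_eq:
  assumes U: "U \<in> UF" and F: "F \<in> fin_edges E" and C: "C \<in> CE F" "lives U (\<Union>F) C"
  shows "tanK U F = C"
  unfolding tanK_def
proof (rule the_equality)
  fix D assume D: "D \<in> CE F \<and> lives U (\<Union>F) D"
  then have "D \<inter> C \<noteq> {}" using lives_disjoint[OF U fin_edges_Union[OF F]] C by blast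
  then show "D = C" using CE_disjoint C D by blast
qed (use C in simp)

text \<open>With \<open>\<Union>F\<close> deleted, each component lies in one of the finitely many
  components of G - F. This divides the set on which \<open>U (\<Union>F)\<close> is an ultrafilter
  into finitely many parts, one of which is a member.\<close>

lemma tanK:
  assumes U: "U \<in> UF" and F: "F \<in> fin_edges E"
  shows "tanK U F \<in> CE F" and "lives U (\<Union>F) (tanK U F)"
proof -
  let ?X = "\<Union>F"
  have X: "?X \<in> fin_verts V" by (rule fin_edges_Union[OF F])
  have "\<Union>((\<lambda>C. {c \<in> CX ?X. c \<subseteq> C}) ` CE F) = CX ?X"
  proof
    show "CX ?X \<subseteq> \<Union>((\<lambda>C. {c \<in> CX ?X. c \<subseteq> C}) ` CE F)"
    proof
      fix c assume c: "c \<in> CX ?X"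
      obtain v where v: "v \<in> c" "v \<in> V" using CX_nonempty[OF c] CX_subset[OF c] by blast
      then have "c \<subseteq> compE F v" using CX_subset_CE[OF c compE_in, of v F v] in_compE by blast
      then show "c \<in> \<Union>((\<lambda>C. {c \<in> CX ?X. c \<subseteq> C}) ` CE F)" using c compE_in[OF v(2)] by blast
    qed
  qed blast
  then have "\<exists>A\<in>(\<lambda>C. {c \<in> CX ?X. c \<subseteq> C}) ` CE F. A \<in> U ?X"
    using finite_CE[OF F] by (intro ultrafilter_on_finite_Union[OF UF_ultrafilter[OF U X]]) auto
  then obtain C where "C \<in> CE F" "lives U ?X C" unfolding lives_def by blast
  then show "tanK U F \<in> CE F" "lives U (\<Union>F) (tanK U F)" using tanK_eq[OF U F] by auto
qed

lemma tanK_lives: "lives_in_comps UF tanK"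
  unfolding lives_in_comps_def
proof (intro ballI conjI impI)
  fix U F assume U: "U \<in> UF" and F: "F \<in> fin_edges E"
  show "tanK U F \<in> CE F" by (rule tanK(1)[OF U F])
  fix F' assume F': "F' \<in> fin_edges E" "F \<subseteq> F'"
  obtain D where D: "D \<in> CE F" "tanK U F' \<subseteq> D" using CE_supercomponent[OF tanK(1)[OF U F'(1)] F'(2)] by blast
  have X: "\<Union>F \<in> fin_verts V" "\<Union>F' \<in> fin_verts V" "\<Union>F \<subseteq> \<Union>F'"
    using fin_edges_Union F F' by auto
  have "lives U (\<Union>F') D" by (rule lives_mono[OF U X(2) tanK(2)[OF U F'(1)] D(2)])
  then have "lives U (\<Union>F) D" using lives_indep[OF U X clean_CE[OF D(1)]] by simp
  then have "tanK U F = D" by (rule tanK_eq[OF U F D(1)])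
  then show "tanK U F' \<subseteq> tanK U F" using D by simp
qed

text \<open>For every \<open>X\<close> take the principal ultrafilter at the component of G - X that
  contains a tail of the ray.\<close>

lemma tanK_rays:
  assumes R: "ray V E R"
  shows "\<exists>U\<in>UF. \<forall>F\<in>fin_edges E. tanK U F = tailE R F"
proof -
  define U where "U = (\<lambda>X\<in>fin_verts V. {\<C>. \<C> \<subseteq> CX X \<and> tailX R X \<in> \<C>})"
  have UX: "U X = {\<C>. \<C> \<subseteq> CX X \<and> tailX R X \<in> \<C>}" if "X \<in> fin_verts V" for X
    using that by (simp add: U_def)
  have cm: "comp_map V E X (tailX R X') = tailX R X"
    if X: "X \<in> fin_verts V" "X' \<in> fin_verts V" "X \<subseteq> X'" for X X'
  proof -
    obtain m where m: "\<forall>i\<ge>m. R i \<in> tailX R X" using tailX(2)[OF R X(1)] by blast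
    obtain n where n: "\<forall>i\<ge>n. R i \<in> tailX R X'" using tailX(2)[OF R X(2)] by blast
    show ?thesis
      using comp_map_eq[OF tailX(1)[OF R X(2)] tailX(1)[OF R X(1)] X(3)] tails_meet[OF m n] by blast
  qed
  have "U \<in> UF"
    unfolding ultra_families_def
  proof (intro CollectI conjI ballI impI)
    have "ultrafilter_on (CX X) (U X)" if "X \<in> fin_verts V" for X
      unfolding UX[OF that] ultrafilter_on_def using tailX(1)[OF R that] by auto
    then show "U \<in> (\<Pi>\<^sub>E X\<in>fin_verts V. {W. ultrafilter_on (CX X) W})" by (auto simp: U_def)
    fix X X' assume X: "X \<in> fin_verts V" "X' \<in> fin_verts V" "X \<subseteq> X'"
    show "ultra_map V E X (U X') = U X"
    proof (intro set_eqI iffI)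
      fix \<C> assume "\<C> \<in> ultra_map V E X (U X')"
      then show "\<C> \<in> U X" using cm[OF X] unfolding ultra_map_def UX[OF X(1)] UX[OF X(2)] by blast
    next
      fix \<C> assume C: "\<C> \<in> U X"
      have "{tailX R X'} \<in> U X'" using tailX(1)[OF R X(2)] by (simp add: UX[OF X(2)])
      moreover have "comp_map V E X ` {tailX R X'} \<subseteq> \<C>" "\<C> \<subseteq> CX X" using C cm[OF X] by (auto simp: UX[OF X(1)])
      ultimately show "\<C> \<in> ultra_map V E X (U X')" unfolding ultra_map_def by blast
    qed
  qed
  moreover have "tanK U F = tailE R F" if F: "F \<in> fin_edges E" for F
  proof (rule tanK_eq[OF \<open>U \<in> UF\<close> F tailE(1)[OF R F]])
    have X: "\<Union>F \<in> fin_verts V" by (rule fin_edges_Union[OF F])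
    obtain m where m: "\<forall>i\<ge>m. R i \<in> tailX R (\<Union>F)" using tailX(2)[OF R X] by blast
    obtain n where n: "\<forall>i\<ge>n. R i \<in> tailE R F" using tailE(2)[OF R F] by blast
    have "tailX R (\<Union>F) \<subseteq> tailE R F"
      using CX_subset_CE[OF tailX(1)[OF R X] tailE(1)[OF R F] order_refl] tails_meet[OF m n] by blast
    then show "lives U (\<Union>F) (tailE R F)" using tailX(1)[OF R X] by (simp add: lives_def UX[OF X])
  qed
  ultimately show ?thesis by blast
qed

section \<open>The tangle compactification\<close>

definition vertex_nbhd :: "'a \<Rightarrow> ('a set \<Rightarrow> real) \<Rightarrow> ('a, 'a) cpoint set" where
  "vertex_nbhd u j = insert (Vert u) (\<Union>e\<in>{e \<in> E. u \<in> e}. half_edge e u (j e))"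

lemma in_vertex_nbhd [simp]:
  "Vert v \<in> vertex_nbhd u j \<longleftrightarrow> v = u"
  "Inner e t \<in> vertex_nbhd u j \<longleftrightarrow> e \<in> E \<and> u \<in> e \<and> 0 < t \<and> t < 1 \<and> dist_from e u t < j e"
  by (auto simp: vertex_nbhd_def)

lemma vertex_nbhds_eq:
  "vertex_nbhds V E = {vertex_nbhd u j | u j. u \<in> V \<and> (\<forall>e. 0 < j e \<and> j e < 1)}"
  unfolding vertex_nbhds_def vertex_nbhd_def by (rule refl)

lemma topspace_one_complex: "topspace (one_complex V E) = graph_points V E"
proof
  show "topspace (one_complex V E) \<subseteq> graph_points V E"
  proof
    fix x assume "x \<in> topspace (one_complex V E)"
    then have "x \<in> \<Union>(inner_opens E) \<or> x \<in> \<Union>(vertex_nbhds V E)"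
      unfolding one_complex_def topology_generated_by_topspace by blast
    then show "x \<in> graph_points V E"
    proof
      assume "x \<in> \<Union>(inner_opens E)"
      then show ?thesis by (auto simp: inner_opens_def)
    next
      assume "x \<in> \<Union>(vertex_nbhds V E)"
      then obtain u j where "u \<in> V" "x \<in> vertex_nbhd u j" unfolding vertex_nbhds_eq by blast
      then show ?thesis by (cases x) auto
    qed
  qed
  show "graph_points V E \<subseteq> topspace (one_complex V E)"
  proof
    fix x :: "('a, 'a) cpoint" assume x: "x \<in> graph_points V E"
    have "\<exists>W\<in>inner_opens E \<union> vertex_nbhds V E. x \<in> W"
    proof (cases x)
      case (Vert v)
      then have "vertex_nbhd v (\<lambda>_. 1/2) \<in> vertex_nbhds V E" using x unfolding vertex_nbhds_eq by force
      then show ?thesis using Vert by (intro bexI[of _ "vertex_nbhd v (\<lambda>_. 1/2)"]) auto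
    next
      case (Inner e t)
      then have "Inner e ` {0<..<1} \<in> inner_opens E"
        using x unfolding inner_opens_def by (intro CollectI exI[of _ e] exI[of _ "{0<..<1}"]) auto
      then show ?thesis using Inner x by (intro bexI[of _ "Inner e ` {0<..<1}"]) auto
    qed
    then show "x \<in> topspace (one_complex V E)"
      unfolding one_complex_def topology_generated_by_topspace by blast
  qed
qed

lemma openin_tangle_complex:
  "openin (one_complex V E) W \<Longrightarrow> openin (tangle_space V E) (Inl ` W)"
  unfolding tangle_space_def by (intro topology_generated_by_Basis) blast

lemma openin_tangle_nbhd:
  "X \<in> fin_verts V \<Longrightarrow> \<C> \<subseteq> CX X \<Longrightarrow> openin (tangle_space V E) (tangle_nbhd V E X \<C>)"
  unfolding tangle_space_def by (intro topology_generated_by_Basis) blast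

lemma openin_tangle_vertex:
  assumes "u \<in> V" "\<And>e. 0 < j e \<and> j e < 1"
  shows "openin (tangle_space V E) (Inl ` vertex_nbhd u j)"
proof (rule openin_tangle_complex)
  have "vertex_nbhd u j \<in> vertex_nbhds V E" unfolding vertex_nbhds_eq using assms by blast
  then show "openin (one_complex V E) (vertex_nbhd u j)"
    unfolding one_complex_def by (intro topology_generated_by_Basis) blast
qed

lemma openin_tangle_inner:
  "e \<in> E \<Longrightarrow> open T \<Longrightarrow> T \<subseteq> {0<..<1} \<Longrightarrow> openin (tangle_space V E) (Inl ` Inner e ` T)"
  by (intro openin_tangle_complex, unfold one_complex_def, intro topology_generated_by_Basis UnI1)
     (auto simp: inner_opens_def)

lemma edge_meets_cases:
  assumes "c \<in> CX X" "e \<in> E" "x \<in> e" "x \<in> c"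
  shows "e \<subseteq> c \<or> e \<inter> X \<noteq> {}"
  using CX_edge[OF assms(1,2)] assms by blast

lemma in_Inl_Un_Inr:
  "Inl y \<in> Inl ` A \<union> Inr ` B \<longleftrightarrow> y \<in> A"
  "Inr z \<in> Inl ` A \<union> Inr ` B \<longleftrightarrow> z \<in> B"
  by auto

lemma in_tangle_nbhd:
  "Inl (Vert v) \<in> tangle_nbhd V E X \<C> \<longleftrightarrow> v \<in> \<Union>\<C>"
  "Inr U \<in> tangle_nbhd V E X \<C> \<longleftrightarrow> U \<in> UF \<and> \<C> \<in> U X"
  unfolding tangle_nbhd_def in_Inl_Un_Inr by simp_all

text \<open>An edge that meets a component of G - X either lies in it or has its other end in
  \<open>X\<close>. So the edges inside \<open>\<Union>\<C>\<close> and those between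
  \<open>X\<close> and \<open>\<Union>\<C>\<close> are together just the edges meeting
  \<open>\<Union>\<C>\<close>.\<close>

lemma Inner_in_tangle_nbhd:
  assumes "\<C> \<subseteq> CX X"
  shows "Inl (Inner e t) \<in> tangle_nbhd V E X \<C> \<longleftrightarrow> e \<in> E \<and> 0 < t \<and> t < 1 \<and> e \<inter> \<Union>\<C> \<noteq> {}"
proof -
  have "Inl (Inner e t) \<in> tangle_nbhd V E X \<C> \<longleftrightarrow>
      e \<in> E \<and> 0 < t \<and> t < 1 \<and> (e \<subseteq> \<Union>\<C> \<or> e \<inter> X \<noteq> {} \<and> e \<inter> \<Union>\<C> \<noteq> {})"
    unfolding tangle_nbhd_def in_Inl_Un_Inr
    unfolding Un_iff Inner_in_graph_points UN_iff Inner_in_inner_edge mem_Collect_eq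
    by blast
  moreover have "(e \<subseteq> \<Union>\<C> \<or> e \<inter> X \<noteq> {} \<and> e \<inter> \<Union>\<C> \<noteq> {}) \<longleftrightarrow> e \<inter> \<Union>\<C> \<noteq> {}" if e: "e \<in> E"
  proof
    assume "e \<inter> \<Union>\<C> \<noteq> {}"
    then obtain x c where "x \<in> e" "x \<in> c" "c \<in> \<C>" by blast
    then show "e \<subseteq> \<Union>\<C> \<or> e \<inter> X \<noteq> {} \<and> e \<inter> \<Union>\<C> \<noteq> {}"
      using edge_meets_cases[of c X e x] e assms by blast
  next
    assume "e \<subseteq> \<Union>\<C> \<or> e \<inter> X \<noteq> {} \<and> e \<inter> \<Union>\<C> \<noteq> {}"
    moreover have "e \<noteq> {}" using edge_origin_in[OF e] by blast
    ultimately show "e \<inter> \<Union>\<C> \<noteq> {}" by blast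
  qed
  ultimately show ?thesis by blast
qed

lemma tangle_nbhd_subset:
  assumes "\<C> \<subseteq> CX X"
  shows "tangle_nbhd V E X \<C> \<subseteq> points UF"
proof
  fix x assume x: "x \<in> tangle_nbhd V E X \<C>"
  show "x \<in> points UF"
  proof (cases x)
    case (Inl y)
    have "\<Union>\<C> \<subseteq> V" using assms CX_subset by blast
    then show ?thesis using x Inl assms by (cases y) (auto simp: in_tangle_nbhd Inner_in_tangle_nbhd)
  next
    case (Inr U)
    then show ?thesis using x by (simp add: in_tangle_nbhd)
  qed
qed

lemma topspace_tangle: "topspace (tangle_space V E) = points UF"
proof
  show "topspace (tangle_space V E) \<subseteq> points UF"
  proof
    fix x assume "x \<in> topspace (tangle_space V E)"
    then have "x \<in> \<Union>{Inl ` W | W. openin (one_complex V E) W} \<or>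
        x \<in> \<Union>{tangle_nbhd V E X \<C> | X \<C>. X \<in> fin_verts V \<and> \<C> \<subseteq> CX X}"
      unfolding tangle_space_def topology_generated_by_topspace by blast
    then show "x \<in> points UF"
    proof
      assume "x \<in> \<Union>{Inl ` W | W. openin (one_complex V E) W}"
      then obtain W where "openin (one_complex V E) W" "x \<in> Inl ` W" by blast
      then show ?thesis using openin_subset topspace_one_complex by blast
    next
      assume "x \<in> \<Union>{tangle_nbhd V E X \<C> | X \<C>. X \<in> fin_verts V \<and> \<C> \<subseteq> CX X}"
      then show ?thesis using tangle_nbhd_subset by blast
    qed
  qed
  have "openin (tangle_space V E) (Inl ` graph_points V E)"
    using openin_tangle_complex[OF openin_topspace] by (simp add: topspace_one_complex)
  moreover have "Inr U \<in> topspace (tangle_space V E)" if "U \<in> UF" for U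
  proof -
    have X: "{} \<in> fin_verts V" by (simp add: fin_verts_def)
    have "CX {} \<in> U {}" using UF_ultrafilter[OF that X] by (simp add: ultrafilter_on_def)
    then have "Inr U \<in> tangle_nbhd V E {} (CX {})" using that by (simp add: in_tangle_nbhd)
    then show ?thesis using openin_subset[OF openin_tangle_nbhd[OF X order_refl]] by blast
  qed
  ultimately show "points UF \<subseteq> topspace (tangle_space V E)" using openin_subset by blast
qed

text \<open>At a vertex short half-edges suffice. At an ultrafilter family, delete the set
  \<open>X\<close> of all ends of \<open>F\<close> and of the restricted loops \<open>L\<close>: an
  edge that meets one of the chosen components of G - X is in neither set, so it lies inside
  \<open>d\<close> and nothing has been removed from it.\<close>

lemma lift_tanK_continuous:
  "continuous_map (tangle_space V E) (inverse_limit V E) (lift tanK)"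
proof (rule lift_continuous[OF tanK_lives topspace_tangle openin_tangle_inner])
  fix F x j L a b
  assume F: "F \<in> fin_edges E" and x: "x \<in> Inl ` Vert ` V \<union> Inr ` UF"
    and data: "nbhd_data (pcomp tanK x F) j L a b"
  define d where "d = pcomp tanK x F"
  have L: "finite L" "L \<subseteq> loops E d" "L \<subseteq> E" and jab: "\<And>e. 0 < j e \<and> j e < 1 \<and> 0 < a e \<and> a e \<le> b e \<and> b e < 1"
    using data by (auto simp: nbhd_data_def d_def loops_def)
  have d: "d \<in> CE F" unfolding d_def by (rule pcomp_in[OF tanK_lives x F])
  have "\<exists>W. openin (tangle_space V E) W \<and> x \<in> W \<and>
      (\<forall>y\<in>W. lift_coord tanK F y \<in> contraction_nbhd E d j L a b)"
    using x
  proof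
    assume "x \<in> Inl ` Vert ` V"
    then obtain v where v: "v \<in> V" "x = Inl (Vert v)" by blast
    then have dv: "d = compE F v" by (simp add: d_def pcomp_def)
    \<comment> \<open>Short enough for the non-loops, and clear of the removed interval from
      whichever end of the edge \<open>v\<close> is.\<close>
    define l where "l e = min (j e) (min (a e) (1 - b e))" for e
    have l: "0 < l e \<and> l e < 1" for e using jab[of e] by (auto simp: l_def)
    have "lift_coord tanK F y \<in> contraction_nbhd E d j L a b" if "y \<in> Inl ` vertex_nbhd v l" for y
    proof -
      obtain z where z: "y = Inl z" "z \<in> vertex_nbhd v l" using \<open>y \<in> Inl ` vertex_nbhd v l\<close> by blast
      show ?thesis
      proof (cases z)
        case (Vert u)
        then show ?thesis using z dv by simp
      next
        case (Inner e t)
        then have et: "e \<in> E" "v \<in> e" "0 < t" "t < 1" "dist_from e v t < l e" using z by auto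
        have "t < a e \<or> b e < t" using et(5) by (auto simp: l_def dist_from_def split: if_splits)
        moreover have "dist_from e v t < j e" using et(5) by (simp add: l_def)
        moreover have "v \<in> d" using dv in_compE[OF v(1)] by simp
        ultimately show ?thesis using z Inner et by (auto simp: Inner_in_contraction_nbhd[OF L(2)])
      qed
    qed
    moreover have "x \<in> Inl ` vertex_nbhd v l" using v by auto
    moreover have "openin (tangle_space V E) (Inl ` vertex_nbhd v l)" using v(1) l by (rule openin_tangle_vertex)
    ultimately show ?thesis
      by (intro exI[of _ "Inl ` vertex_nbhd v l"] conjI ballI)
  next
    assume "x \<in> Inr ` UF"
    then obtain U where U: "U \<in> UF" "x = Inr U" by blast
    then have dU: "d = tanK U F" by (simp add: d_def pcomp_def)
    define X where "X = \<Union>(F \<union> L)"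
    have FL: "F \<union> L \<in> fin_edges E" using F L by (auto simp: fin_edges_def)
    have X: "\<Union>F \<in> fin_verts V" "X \<in> fin_verts V" "\<Union>F \<subseteq> X"
      unfolding X_def using fin_edges_Union[OF F] fin_edges_Union[OF FL] by auto
    define \<C> where "\<C> = {c \<in> CX X. c \<subseteq> d}"
    have C: "\<C> \<subseteq> CX X" "\<Union>\<C> \<subseteq> d" "\<Union>\<C> \<inter> X = {}" using CX_subset by (auto simp: \<C>_def)
    \<comment> \<open>For a family, being in the neighbourhood given by \<open>\<C>\<close> amounts
      to having \<open>d\<close> as its component: enlarging \<open>\<Union>F\<close> to
      \<open>X\<close> does not change whether it lives in \<open>d\<close>.\<close>
    have liv: "\<C> \<in> U' X \<longleftrightarrow> tanK U' F = d" if U': "U' \<in> UF" for U'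
    proof -
      have "\<C> \<in> U' X \<longleftrightarrow> lives U' (\<Union>F) d"
        using lives_indep[OF U' X clean_CE[OF d]] by (simp add: lives_def \<C>_def)
      then show ?thesis using tanK_eq[OF U' F d] tanK[OF U' F] by auto
    qed
    have "lift_coord tanK F y \<in> contraction_nbhd E d j L a b" if y: "y \<in> tangle_nbhd V E X \<C>" for y
    proof (cases y)
      case (Inr U')
      then show ?thesis using y liv[of U'] by (simp add: in_tangle_nbhd)
    next
      case (Inl z)
      show ?thesis
      proof (cases z)
        case (Vert v)
        then have "v \<in> d" using y Inl C(2) by (auto simp: in_tangle_nbhd)
        then show ?thesis using Inl Vert compE_eq[OF d] by simp
      next
        case (Inner e t)
        then have et: "e \<in> E" "0 < t" "t < 1" "e \<inter> \<Union>\<C> \<noteq> {}"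
          using y Inl Inner_in_tangle_nbhd[OF C(1)] by auto
        then obtain u where u: "u \<in> e" "u \<in> d" "u \<notin> X" using C by blast
        then have "e \<notin> F \<union> L" unfolding X_def by blast
        moreover from this have "e \<subseteq> d" using CE_edge[OF d et(1) _ u(1,2)] by blast
        ultimately show ?thesis using Inl Inner et by (simp add: Inner_in_contraction_nbhd[OF L(2)])
      qed
    qed
    moreover have "x \<in> tangle_nbhd V E X \<C>" using U liv[OF U(1)] dU by (simp add: in_tangle_nbhd)
    ultimately show ?thesis using openin_tangle_nbhd[OF X(2) C(1)]
      by (intro exI[of _ "tangle_nbhd V E X \<C>"] conjI ballI)
  qed
  then show "\<exists>W. openin (tangle_space V E) W \<and> x \<in> W \<and>
      lift_coord tanK F ` W \<subseteq> contraction_nbhd E (pcomp tanK x F) j L a b"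
    unfolding d_def[symmetric] by (simp add: image_subset_iff)
qed

section \<open>Compactness of the tangle compactification\<close>

text \<open>A closed edge is the image of the unit interval. Continuity is shown on generators,
  first into the 1-complex and from there into \<open>tangle_space\<close>, whose generators include
  all open sets of the 1-complex.\<close>

lemma compactin_closed_edge:
  assumes e: "e \<in> E"
  shows "compactin (tangle_space V E) (Inl ` (Vert ` e \<union> inner_edge e))"
proof -
  define p where "p = edge_origin e"
  obtain u v where uv: "e = {u, v}" "u \<noteq> v" "u \<in> V" "v \<in> V" using edgeE[OF e] .
  have "p = u \<or> p = v" using edge_origin_in[OF e] uv by (auto simp: p_def)
  then obtain q where q: "e = {p, q}" "p \<noteq> q" "p \<in> V" "q \<in> V" using uv by auto
  \<comment> \<open>Constant outside the unit interval, so that the path is defined on the whole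
    line and its preimages can be tested for openness there.\<close>
  define \<gamma> :: "real \<Rightarrow> ('a, 'a) cpoint" where
    "\<gamma> t = (if t \<le> 0 then Vert p else if 1 \<le> t then Vert q else Inner e t)" for t
  \<comment> \<open>A preimage is open if its part strictly between 0 and 1 is open and if it
    contains a one-sided neighbourhood of each end of the unit interval whose image vertex belongs
    to \<open>P\<close>.\<close>
  have open_vimage: "open (\<gamma> -` P)"
    if A: "open {t. 0 < t \<and> t < 1 \<and> Inner e t \<in> P}"
      and p: "Vert p \<in> P \<Longrightarrow> \<exists>\<delta>>0. \<delta> \<le> 1 \<and> (\<forall>t. 0 < t \<and> t < \<delta> \<longrightarrow> Inner e t \<in> P)"
      and q: "Vert q \<in> P \<Longrightarrow> \<exists>\<delta><1. 0 \<le> \<delta> \<and> (\<forall>t. \<delta> < t \<and> t < 1 \<longrightarrow> Inner e t \<in> P)" for P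
  proof -
    have "\<exists>B. open B \<and> B \<subseteq> \<gamma> -` P \<and> (Vert p \<in> P \<longrightarrow> {..0} \<subseteq> B)"
    proof (cases "Vert p \<in> P")
      case True
      then obtain \<delta> where "\<delta> > 0" "\<delta> \<le> 1" "\<And>t. 0 < t \<and> t < \<delta> \<Longrightarrow> Inner e t \<in> P" using p by blast
      then show ?thesis using True by (intro exI[of _ "{..<\<delta>}"]) (auto simp: \<gamma>_def)
    qed auto
    then obtain B where B: "open B" "B \<subseteq> \<gamma> -` P" "Vert p \<in> P \<Longrightarrow> {..0} \<subseteq> B" by blast
    have "\<exists>D. open D \<and> D \<subseteq> \<gamma> -` P \<and> (Vert q \<in> P \<longrightarrow> {1..} \<subseteq> D)"
    proof (cases "Vert q \<in> P")
      case True
      then obtain \<delta> where "\<delta> < 1" "0 \<le> \<delta>" "\<And>t. \<delta> < t \<and> t < 1 \<Longrightarrow> Inner e t \<in> P" using q by blast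
      then show ?thesis using True by (intro exI[of _ "{\<delta><..}"]) (auto simp: \<gamma>_def)
    qed auto
    then obtain D where D: "open D" "D \<subseteq> \<gamma> -` P" "Vert q \<in> P \<Longrightarrow> {1..} \<subseteq> D" by blast
    have "\<gamma> -` P = {t. 0 < t \<and> t < 1 \<and> Inner e t \<in> P} \<union> B \<union> D" (is "_ = ?A \<union> B \<union> D")
    proof
      show "?A \<union> B \<union> D \<subseteq> \<gamma> -` P" using B(2) D(2) by (auto simp: \<gamma>_def)
      show "\<gamma> -` P \<subseteq> ?A \<union> B \<union> D"
      proof
        fix t assume t: "t \<in> \<gamma> -` P"
        consider "t \<le> 0" | "1 \<le> t" | "0 < t" "t < 1" by linarith
        then show "t \<in> ?A \<union> B \<union> D"
        proof cases
          case 1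
          then have "Vert p \<in> P" using t by (simp add: \<gamma>_def)
          then show ?thesis using B(3) 1 by blast
        next
          case 2
          then have "Vert q \<in> P" using t by (simp add: \<gamma>_def)
          then show ?thesis using D(3) 2 by blast
        next
          case 3
          then show ?thesis using t by (simp add: \<gamma>_def)
        qed
      qed
    qed
    then show ?thesis using A B(1) D(1) by (simp add: open_Un)
  qed
  have dp: "dist_from e p t = t" for t by (simp add: dist_from_def p_def)
  have dq: "dist_from e q t = 1 - t" for t using q by (simp add: dist_from_def p_def)
  have cont: "continuous_map euclideanreal (one_complex V E) \<gamma>"
    unfolding one_complex_def
  proof (rule continuous_on_generated_topo)
    fix P assume "P \<in> inner_opens E \<union> vertex_nbhds V E"
    then have "open (\<gamma> -` P)"
    proof
      assume "P \<in> inner_opens E"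
      then obtain e' T where eT: "P = Inner e' ` T" "open T" "T \<subseteq> {0<..<1}" by (auto simp: inner_opens_def)
      then have "{t. 0 < t \<and> t < 1 \<and> Inner e t \<in> P} = (if e' = e then T else {})" by auto
      then show ?thesis using eT by (intro open_vimage) auto
    next
      assume "P \<in> vertex_nbhds V E"
      then obtain w j where P: "P = vertex_nbhd w j" and j: "\<forall>e. 0 < j e \<and> j e < 1"
        unfolding vertex_nbhds_eq by blast
      show ?thesis
      proof (rule open_vimage)
        have "{t. 0 < t \<and> t < 1 \<and> Inner e t \<in> P} = (if w \<in> e then {t \<in> {0<..<1}. dist_from e w t < j e} else {})"
          using e by (auto simp: P)
        then show "open {t. 0 < t \<and> t < 1 \<and> Inner e t \<in> P}" using open_half_edge_times[of e w "j e"] by simp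
        show "\<exists>\<delta>>0. \<delta> \<le> 1 \<and> (\<forall>t. 0 < t \<and> t < \<delta> \<longrightarrow> Inner e t \<in> P)" if "Vert p \<in> P"
        proof -
          have "p = w" "p \<in> e" using that q by (auto simp: P)
          then show ?thesis using e dp j[rule_format, of e] by (intro exI[of _ "j e"]) (auto simp: P)
        qed
        show "\<exists>\<delta><1. 0 \<le> \<delta> \<and> (\<forall>t. \<delta> < t \<and> t < 1 \<longrightarrow> Inner e t \<in> P)" if "Vert q \<in> P"
        proof -
          have "q = w" "q \<in> e" using that q by (auto simp: P)
          then show ?thesis using e dq j[rule_format, of e] by (intro exI[of _ "1 - j e"]) (auto simp: P)
        qed
      qed
    qed
    then show "openin euclideanreal (\<gamma> -` P \<inter> topspace euclideanreal)" by simp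
  next
    have "\<gamma> t \<in> topspace (one_complex V E)" for t
      unfolding topspace_one_complex using e q by (auto simp: \<gamma>_def)
    then show "\<gamma> ` topspace euclideanreal \<subseteq> \<Union>(inner_opens E \<union> vertex_nbhds V E)"
      unfolding one_complex_def topology_generated_by_topspace by blast
  qed
  have "continuous_map euclideanreal (tangle_space V E) (\<lambda>t. Inl (\<gamma> t))"
    unfolding tangle_space_def
  proof (rule continuous_on_generated_topo)
    fix Q assume "Q \<in> {Inl ` W | W. openin (one_complex V E) W} \<union>
        {tangle_nbhd V E X \<C> | X \<C>. X \<in> fin_verts V \<and> \<C> \<subseteq> CX X}"
    then have "open ((\<lambda>t. Inl (\<gamma> t)) -` Q)"
    proof
      assume "Q \<in> {Inl ` W | W. openin (one_complex V E) W}"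
      then obtain W where W: "Q = Inl ` W" "openin (one_complex V E) W" by blast
      have "open {t. \<gamma> t \<in> W}" using openin_continuous_map_preimage[OF cont W(2)] by simp
      moreover have "(\<lambda>t. Inl (\<gamma> t)) -` Q = {t. \<gamma> t \<in> W}" using W(1) by auto
      ultimately show ?thesis by simp
    next
      assume "Q \<in> {tangle_nbhd V E X \<C> | X \<C>. X \<in> fin_verts V \<and> \<C> \<subseteq> CX X}"
      then obtain X \<C> where Q: "Q = tangle_nbhd V E X \<C>" "\<C> \<subseteq> CX X" by blast
      define P :: "('a, 'a) cpoint set" where "P = {y. Inl y \<in> Q}"
      \<comment> \<open>A tangle neighbourhood contains all inner points of \<open>e\<close> or
        none, so the one-sided conditions hold with the extreme values 1 and 0.\<close>
      have IP: "Inner e t \<in> P \<longleftrightarrow> 0 < t \<and> t < 1 \<and> e \<inter> \<Union>\<C> \<noteq> {}" for t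
        using e Inner_in_tangle_nbhd[OF Q(2), of e t] by (simp add: P_def Q(1))
      have VP: "Vert x \<in> P \<Longrightarrow> x \<in> e \<Longrightarrow> e \<inter> \<Union>\<C> \<noteq> {}" for x
        unfolding P_def Q(1) mem_Collect_eq in_tangle_nbhd by blast
      have "open (\<gamma> -` P)"
      proof (rule open_vimage)
        have "{t. 0 < t \<and> t < 1 \<and> Inner e t \<in> P} = (if e \<inter> \<Union>\<C> = {} then {} else {0<..<1})"
          unfolding IP by auto
        then show "open {t. 0 < t \<and> t < 1 \<and> Inner e t \<in> P}" by simp
        show "\<exists>\<delta>>0. \<delta> \<le> 1 \<and> (\<forall>t. 0 < t \<and> t < \<delta> \<longrightarrow> Inner e t \<in> P)" if "Vert p \<in> P"
          unfolding IP using VP[OF that] q(1) by (intro exI[of _ 1]) auto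
        show "\<exists>\<delta><1. 0 \<le> \<delta> \<and> (\<forall>t. \<delta> < t \<and> t < 1 \<longrightarrow> Inner e t \<in> P)" if "Vert q \<in> P"
          unfolding IP using VP[OF that] q(1) by (intro exI[of _ 0]) auto
      qed
      moreover have "(\<lambda>t. Inl (\<gamma> t)) -` Q = \<gamma> -` P" by (auto simp: P_def)
      ultimately show ?thesis by simp
    qed
    then show "openin euclideanreal ((\<lambda>t. Inl (\<gamma> t)) -` Q \<inter> topspace euclideanreal)" by simp
  next
    have "Inl (\<gamma> t) \<in> topspace (tangle_space V E)" for t
      unfolding topspace_tangle using e q by (auto simp: \<gamma>_def)
    then show "(\<lambda>t. Inl (\<gamma> t)) ` topspace euclideanreal \<subseteq>
        \<Union>({Inl ` W | W. openin (one_complex V E) W} \<union>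
        {tangle_nbhd V E X \<C> | X \<C>. X \<in> fin_verts V \<and> \<C> \<subseteq> CX X})"
      unfolding tangle_space_def topology_generated_by_topspace by blast
  qed
  then have "compactin (tangle_space V E) ((\<lambda>t. Inl (\<gamma> t)) ` {0..1})"
    by (intro image_compactin) auto
  moreover have "(\<lambda>t. Inl (\<gamma> t)) ` {0..1} = (Inl ` (Vert ` e \<union> inner_edge e) :: 'a tpoint set)"
  proof -
    have "\<gamma> ` {0..1} = Vert ` e \<union> inner_edge e"
    proof (intro set_eqI iffI)
      fix y assume "y \<in> \<gamma> ` {0..1}"
      then show "y \<in> Vert ` e \<union> inner_edge e" using q(1) by (auto simp: \<gamma>_def)
    next
      fix y :: "('a, 'a) cpoint" assume "y \<in> Vert ` e \<union> inner_edge e"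
      then show "y \<in> \<gamma> ` {0..1}"
      proof
        assume "y \<in> Vert ` e"
        then have "y = \<gamma> 0 \<or> y = \<gamma> 1" using q(1) by (auto simp: \<gamma>_def)
        then show ?thesis by auto
      next
        assume "y \<in> inner_edge e"
        then obtain t where t: "y = Inner e t" "0 < t" "t < 1" by (auto simp: inner_edge_def)
        then have "y = \<gamma> t" by (simp add: \<gamma>_def)
        then show ?thesis using t by auto
      qed
    qed
    then show ?thesis by (metis image_image)
  qed
  ultimately show ?thesis by simp
qed

lemma compactin_induced:
  assumes X: "X \<in> fin_verts V"
  shows "compactin (tangle_space V E) (Inl ` graph_points X {e \<in> E. e \<subseteq> X})"
proof -
  have fin: "finite X" "X \<subseteq> V" using X by (auto simp: fin_verts_def)
  have "finite {e \<in> E. e \<subseteq> X}" using finite_subset[of "{e \<in> E. e \<subseteq> X}" "Pow X"] fin by auto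
  then have "compactin (tangle_space V E) (\<Union>((\<lambda>e. Inl ` (Vert ` e \<union> inner_edge e)) ` {e \<in> E. e \<subseteq> X}))"
    by (intro compactin_Union) (auto intro: compactin_closed_edge)
  moreover have "compactin (tangle_space V E) (Inl ` Vert ` X)"
    using fin by (intro finite_imp_compactin) (auto simp: topspace_tangle)
  ultimately have "compactin (tangle_space V E)
      (Inl ` Vert ` X \<union> \<Union>((\<lambda>e. Inl ` (Vert ` e \<union> inner_edge e)) ` {e \<in> E. e \<subseteq> X}))"
    by (intro compactin_Un)
  moreover have "Inl ` Vert ` X \<union> \<Union>((\<lambda>e. Inl ` (Vert ` e \<union> inner_edge e)) ` {e \<in> E. e \<subseteq> X}) =
      (Inl ` graph_points X {e \<in> E. e \<subseteq> X} :: 'a tpoint set)"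
    unfolding graph_points_def by blast
  ultimately show ?thesis by simp
qed

text \<open>An ultrafilter on the points that omits the compact subgraph induced by \<open>X\<close>
  therefore contains this neighbourhood; that is how \<open>CX X\<close> becomes a member of the
  induced ultrafilter.\<close>

lemma tangle_nbhd_all:
  assumes X: "X \<in> fin_verts V"
  shows "tangle_nbhd V E X (CX X) = points UF - Inl ` graph_points X {e \<in> E. e \<subseteq> X}"
proof (intro set_eqI)
  fix x show "x \<in> tangle_nbhd V E X (CX X) \<longleftrightarrow> x \<in> points UF - Inl ` graph_points X {e \<in> E. e \<subseteq> X}"
  proof (cases x)
    case (Inr U)
    have "CX X \<in> U X" if "U \<in> UF" using UF_ultrafilter[OF that X] by (simp add: ultrafilter_on_def)
    then show ?thesis using Inr by (auto simp: in_tangle_nbhd)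
  next
    case (Inl y)
    show ?thesis
    proof (cases y)
      case (Vert v)
      then show ?thesis using Inl X by (auto simp: in_tangle_nbhd Union_CX)
    next
      case (Inner e t)
      have "e \<inter> (V - X) \<noteq> {} \<longleftrightarrow> \<not> e \<subseteq> X" if "e \<in> E" using edge_subset[OF that] by blast
      then show ?thesis using Inl Inner by (auto simp: Inner_in_tangle_nbhd Union_CX)
    qed
  qed
qed

text \<open>The point to check is that an edge meeting both \<open>\<Union>\<C>\<close> and
  \<open>\<Union>\<D>\<close> meets the same component in both: an edge with both ends outside
  \<open>X\<close> lies within one component of G - X.\<close>

lemma tangle_nbhd_Int:
  assumes X: "X \<in> fin_verts V" and C: "\<C> \<subseteq> CX X" "\<D> \<subseteq> CX X"
  shows "tangle_nbhd V E X \<C> \<inter> tangle_nbhd V E X \<D> \<subseteq> tangle_nbhd V E X (\<C> \<inter> \<D>)"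
proof
  fix x assume x: "x \<in> tangle_nbhd V E X \<C> \<inter> tangle_nbhd V E X \<D>"
  have CD: "\<C> \<inter> \<D> \<subseteq> CX X" using C by blast
  show "x \<in> tangle_nbhd V E X (\<C> \<inter> \<D>)"
  proof (cases x)
    case (Inr U)
    then have U: "U \<in> UF" "\<C> \<in> U X" "\<D> \<in> U X" using x by (auto simp: in_tangle_nbhd)
    then have "\<C> \<inter> \<D> \<in> U X" using UF_ultrafilter[OF U(1) X] unfolding ultrafilter_on_def by blast
    then show ?thesis using Inr U by (simp add: in_tangle_nbhd)
  next
    case (Inl y)
    show ?thesis
    proof (cases y)
      case (Vert v)
      then obtain c c' where "v \<in> c" "c \<in> \<C>" "v \<in> c'" "c' \<in> \<D>" using x Inl by (auto simp: in_tangle_nbhd)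
      moreover from this have "c = c'" using C CX_disjoint by blast
      ultimately show ?thesis using Inl Vert by (auto simp: in_tangle_nbhd)
    next
      case (Inner e t)
      then have et: "e \<in> E" "0 < t" "t < 1" "e \<inter> \<Union>\<C> \<noteq> {}" "e \<inter> \<Union>\<D> \<noteq> {}"
        using x Inl by (auto simp: Inner_in_tangle_nbhd[OF C(1)] Inner_in_tangle_nbhd[OF C(2)])
      then obtain y c z c' where yz: "y \<in> e" "y \<in> c" "c \<in> \<C>" "z \<in> e" "z \<in> c'" "c' \<in> \<D>" by blast
      have cc: "c \<in> CX X" "c' \<in> CX X" using yz C by auto
      have "c = c'"
      proof (cases "y = z")
        case True
        then show ?thesis using CX_disjoint[OF cc, of y] yz by simp
      next
        case False
        then have "e = {y, z}" using edgeE[OF et(1)] yz(1,4) by (metis insertE insert_commute singletonD)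
        moreover have "y \<notin> X" "z \<notin> X" using CX_subset[OF cc(1)] CX_subset[OF cc(2)] yz by auto
        ultimately have "e \<subseteq> c" using CX_edge[OF cc(1) et(1) _ yz(1,2)] by simp
        then show ?thesis using CX_disjoint[OF cc, of z] yz by blast
      qed
      then have "e \<inter> \<Union>(\<C> \<inter> \<D>) \<noteq> {}" using yz by blast
      then show ?thesis using Inl Inner et Inner_in_tangle_nbhd[OF CD] by simp
    qed
  qed
qed

lemma tangle_nbhd_mono:
  assumes X: "X \<in> fin_verts V" "X' \<in> fin_verts V" "X \<subseteq> X'"
    and C: "\<C>' \<subseteq> CX X'" "comp_map V E X ` \<C>' \<subseteq> \<C>" "\<C> \<subseteq> CX X"
  shows "tangle_nbhd V E X' \<C>' \<subseteq> tangle_nbhd V E X \<C>"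
proof
  fix x assume x: "x \<in> tangle_nbhd V E X' \<C>'"
  have sub: "\<Union>\<C>' \<subseteq> \<Union>\<C>"
  proof
    fix v assume "v \<in> \<Union>\<C>'"
    then obtain c where c: "c \<in> \<C>'" "v \<in> c" by blast
    then have "v \<in> comp_map V E X c" using comp_map_in[of c X' X] C(1) X(3) by blast
    then show "v \<in> \<Union>\<C>" using c C(2) by blast
  qed
  show "x \<in> tangle_nbhd V E X \<C>"
  proof (cases x)
    case (Inr U)
    then show ?thesis using x UF_push[OF _ X _ C(2,3)] by (simp add: in_tangle_nbhd)
  next
    case (Inl y)
    show ?thesis
    proof (cases y)
      case (Vert v)
      then show ?thesis using x Inl sub unfolding Inl Vert in_tangle_nbhd by blast
    next
      case (Inner e t)
      then show ?thesis
        using x sub unfolding Inl Inner Inner_in_tangle_nbhd[OF C(1)] Inner_in_tangle_nbhd[OF C(3)] by blast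
    qed
  qed
qed

lemma comp_map_same: "c \<in> CX X \<Longrightarrow> comp_map V E X c = c"
  using comp_map_eq[of c X c X] CX_nonempty[of c X] by blast

text \<open>
  An ultrafilter containing no compact set induces an ultrafilter on the components of \<open>G - X\<close> for
  every finite \<open>X\<close>; these are compatible, and the resulting point is its limit.
\<close>

lemma tangle_ultrafilter_limit:
  assumes FF: "ultrafilter_on (points UF) \<FF>"
    and noK: "\<And>X. X \<in> fin_verts V \<Longrightarrow> Inl ` graph_points X {e \<in> E. e \<subseteq> X} \<notin> \<FF>"
  shows "\<exists>U\<in>UF. \<forall>W. openin (tangle_space V E) W \<and> Inr U \<in> W \<longrightarrow> (\<exists>N\<in>\<FF>. N \<subseteq> W)"
proof -
  let ?nb = "tangle_nbhd V E"
  define U where "U = (\<lambda>X\<in>fin_verts V. {\<C>. \<C> \<subseteq> CX X \<and> ?nb X \<C> \<in> \<FF>})"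
  have UX: "\<C> \<in> U X \<longleftrightarrow> \<C> \<subseteq> CX X \<and> ?nb X \<C> \<in> \<FF>" if "X \<in> fin_verts V" for X \<C>
    using that by (simp add: U_def)
  have up: "B \<in> \<FF>" if "A \<in> \<FF>" "A \<subseteq> B" "B \<subseteq> points UF" for A B
    using ultrafilter_on_superset[OF FF that] .
  have uf: "ultrafilter_on (CX X) (U X)" if X: "X \<in> fin_verts V" for X
    unfolding ultrafilter_on_def
  proof (intro conjI ballI allI impI)
    let ?K = "Inl ` graph_points X {e \<in> E. e \<subseteq> X} :: 'a tpoint set"
    show "U X \<subseteq> Pow (CX X)" using UX[OF X] by blast
    have "?K \<subseteq> points UF" using compactin_subset_topspace[OF compactin_induced[OF X]] by (simp add: topspace_tangle)
    then have "points UF - ?K \<in> \<FF>" using FF noK[OF X] unfolding ultrafilter_on_def by blast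
    then show "CX X \<in> U X" unfolding UX[OF X] tangle_nbhd_all[OF X] by simp
    have "?nb X {} = {}"
    proof -
      have "x \<notin> ?nb X {}" for x
      proof (cases x)
        case (Inr W)
        then show ?thesis using UF_ultrafilter[of W X] X by (auto simp: in_tangle_nbhd ultrafilter_on_def)
      next
        case (Inl y)
        then show ?thesis by (cases y) (auto simp: in_tangle_nbhd Inner_in_tangle_nbhd)
      qed
      then show ?thesis by blast
    qed
    then show "{} \<notin> U X" using FF by (simp add: UX[OF X] ultrafilter_on_def)
    fix \<C>
    show "\<C> \<inter> \<D> \<in> U X" if "\<C> \<in> U X" "\<D> \<in> U X" for \<D>
    proof -
      have C: "\<C> \<subseteq> CX X" "\<D> \<subseteq> CX X" "?nb X \<C> \<in> \<FF>" "?nb X \<D> \<in> \<FF>" using that by (auto simp: UX[OF X])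
      then have "?nb X \<C> \<inter> ?nb X \<D> \<in> \<FF>" using FF unfolding ultrafilter_on_def by blast
      moreover have sub: "\<C> \<inter> \<D> \<subseteq> CX X" using C by blast
      ultimately have "?nb X (\<C> \<inter> \<D>) \<in> \<FF>"
        using up tangle_nbhd_Int[OF X C(1,2)] tangle_nbhd_subset[OF sub] by blast
      then show ?thesis using sub by (simp add: UX[OF X])
    qed
    show "\<D> \<in> U X" if "\<C> \<in> U X" "\<C> \<subseteq> \<D> \<and> \<D> \<subseteq> CX X" for \<D>
    proof -
      have C: "\<C> \<subseteq> CX X" "?nb X \<C> \<in> \<FF>" using that by (auto simp: UX[OF X])
      have "comp_map V E X ` \<C> \<subseteq> \<D>" using comp_map_same C that(2) by (auto simp: subset_iff)
      then have "?nb X \<C> \<subseteq> ?nb X \<D>" using that(2) C by (intro tangle_nbhd_mono[OF X X order_refl]) auto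
      then have "?nb X \<D> \<in> \<FF>" using up[OF C(2)] tangle_nbhd_subset that(2) by blast
      then show ?thesis using that(2) by (simp add: UX[OF X])
    qed
    show "\<C> \<in> U X \<or> CX X - \<C> \<in> U X" if C: "\<C> \<subseteq> CX X"
    proof -
      have C': "CX X - \<C> \<subseteq> CX X" by blast
      \<comment> \<open>The three sets cover the space, so one of them is in \<open>\<FF>\<close>;
        the subgraph on \<open>X\<close> is excluded by hypothesis.\<close>
      have "\<Union>{?K, ?nb X \<C>, ?nb X (CX X - \<C>)} = points UF"
      proof
        show "\<Union>{?K, ?nb X \<C>, ?nb X (CX X - \<C>)} \<subseteq> points UF"
          using \<open>?K \<subseteq> points UF\<close> tangle_nbhd_subset[OF C] tangle_nbhd_subset[OF C'] by blast
        have "x \<in> ?nb X \<C> \<or> x \<in> ?nb X (CX X - \<C>)" if x: "x \<in> ?nb X (CX X)" for x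
        proof (cases x)
          case (Inr W)
          then have W: "W \<in> UF" using x by (simp add: in_tangle_nbhd)
          then have "\<C> \<in> W X \<or> CX X - \<C> \<in> W X"
            using UF_ultrafilter[OF W X] C unfolding ultrafilter_on_def by blast
          then show ?thesis using Inr W by (auto simp: in_tangle_nbhd)
        next
          case (Inl y)
          have un: "\<Union>(CX X) = \<Union>\<C> \<union> \<Union>(CX X - \<C>)" using C by blast
          show ?thesis
          proof (cases y)
            case (Vert v)
            then show ?thesis using x un unfolding Inl Vert in_tangle_nbhd by blast
          next
            case (Inner e t)
            then show ?thesis using x un
              unfolding Inl Inner Inner_in_tangle_nbhd[OF order_refl] Inner_in_tangle_nbhd[OF C]
                Inner_in_tangle_nbhd[OF C'] by blast
          qed
        qed
        then show "points UF \<subseteq> \<Union>{?K, ?nb X \<C>, ?nb X (CX X - \<C>)}"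
          unfolding tangle_nbhd_all[OF X] by blast
      qed
      then have "\<exists>A\<in>{?K, ?nb X \<C>, ?nb X (CX X - \<C>)}. A \<in> \<FF>"
        by (intro ultrafilter_on_finite_Union[OF FF]) auto
      then show ?thesis using noK[OF X] C by (auto simp: UX[OF X])
    qed
  qed
  have sub: "\<C> \<in> U X" if X: "X \<in> fin_verts V" "X' \<in> fin_verts V" "X \<subseteq> X'"
    and C: "\<C>' \<in> U X'" "comp_map V E X ` \<C>' \<subseteq> \<C>" "\<C> \<subseteq> CX X" for X X' \<C> \<C>'
  proof -
    have C': "\<C>' \<subseteq> CX X'" "?nb X' \<C>' \<in> \<FF>" using C(1) by (auto simp: UX[OF X(2)])
    have "?nb X' \<C>' \<subseteq> ?nb X \<C>" using tangle_nbhd_mono[OF X C'(1) C(2,3)] .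
    then have "?nb X \<C> \<in> \<FF>" using up[OF C'(2)] tangle_nbhd_subset[OF C(3)] by blast
    then show ?thesis using C(3) by (simp add: UX[OF X(1)])
  qed
  have "U \<in> UF"
    unfolding ultra_families_def
  proof (intro CollectI conjI ballI impI)
    show "U \<in> (\<Pi>\<^sub>E X\<in>fin_verts V. {W. ultrafilter_on (CX X) W})" using uf by (auto simp: U_def)
    fix X X' assume X: "X \<in> fin_verts V" "X' \<in> fin_verts V" "X \<subseteq> X'"
    show "ultra_map V E X (U X') = U X"
    proof (intro set_eqI iffI)
      fix \<C> assume "\<C> \<in> ultra_map V E X (U X')"
      then show "\<C> \<in> U X" unfolding ultra_map_def using sub[OF X] by blast
    next
      fix \<C> assume C: "\<C> \<in> U X"
      then have CX: "\<C> \<subseteq> CX X" by (simp add: UX[OF X(1)])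
      \<comment> \<open>The argument of \<open>UF_pull\<close>, repeated because \<open>U\<close> is
        not yet known to be an ultrafilter family.\<close>
      define \<C>' where "\<C>' = {c \<in> CX X'. comp_map V E X c \<in> \<C>}"
      have "\<C>' \<in> U X'"
      proof (rule ccontr)
        assume "\<C>' \<notin> U X'"
        moreover have "\<C>' \<subseteq> CX X'" by (auto simp: \<C>'_def)
        ultimately have "CX X' - \<C>' \<in> U X'" using uf[OF X(2)] unfolding ultrafilter_on_def by blast
        moreover have "comp_map V E X ` (CX X' - \<C>') \<subseteq> CX X - \<C>"
          using comp_map_in[OF _ X(3)] by (auto simp: \<C>'_def)
        ultimately have "CX X - \<C> \<in> U X" using sub[OF X] by blast
        then show False using ultrafilter_on_Int_nonempty[OF uf[OF X(1)] C] by blast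
      qed
      moreover have "comp_map V E X ` \<C>' \<subseteq> \<C>" by (auto simp: \<C>'_def)
      ultimately show "\<C> \<in> ultra_map V E X (U X')" unfolding ultra_map_def using CX by blast
    qed
  qed
  moreover have "\<exists>N\<in>\<FF>. N \<subseteq> W" if W: "openin (tangle_space V E) W" "Inr U \<in> W" for W
  proof -
    have "generate_topology_on ({Inl ` W | W. openin (one_complex V E) W} \<union>
      {?nb X \<C> | X \<C>. X \<in> fin_verts V \<and> \<C> \<subseteq> CX X}) W"
      using W(1) by (simp add: tangle_space_def openin_topology_generated_by_iff)
    then show ?thesis using W(2)
    proof induction
      case (Int A B)
      then obtain N M where "N \<in> \<FF>" "N \<subseteq> A" "M \<in> \<FF>" "M \<subseteq> B" by blast
      moreover from this have "N \<inter> M \<in> \<FF>" using FF unfolding ultrafilter_on_def by blast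
      ultimately show ?case by blast
    next
      case (UN \<K>)
      then obtain k where k: "k \<in> \<K>" "Inr U \<in> k" by blast
      from UN.IH[OF k] obtain N where "N \<in> \<FF>" "N \<subseteq> k" by blast
      then show ?case using k(1) by blast
    next
      case (Basis s)
      \<comment> \<open>Of the generators, only tangle neighbourhoods contain the point
        \<open>Inr U\<close>.\<close>
      then obtain X \<C> where X: "X \<in> fin_verts V" and s: "s = ?nb X \<C>" by blast
      have "\<C> \<in> U X" using Basis(2) by (simp add: s in_tangle_nbhd)
      then show ?case by (auto simp: s UX[OF X])
    qed simp
  qed
  ultimately show ?thesis by blast
qed

lemma compact_tangle_space: "compact_space (tangle_space V E)"
proof (rule compact_space_ultrafilterI)
  fix \<FF> assume FF: "ultrafilter_on (topspace (tangle_space V E)) \<FF>"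
    and noK: "\<And>K. compactin (tangle_space V E) K \<Longrightarrow> K \<notin> \<FF>"
  have "\<exists>U\<in>UF. \<forall>W. openin (tangle_space V E) W \<and> Inr U \<in> W \<longrightarrow> (\<exists>N\<in>\<FF>. N \<subseteq> W)"
    by (rule tangle_ultrafilter_limit[OF FF[unfolded topspace_tangle]]) (rule noK[OF compactin_induced])
  then obtain U where "U \<in> UF" "\<forall>W. openin (tangle_space V E) W \<and> Inr U \<in> W \<longrightarrow> (\<exists>N\<in>\<FF>. N \<subseteq> W)"
    by (elim bexE)
  moreover from this have "Inr U \<in> topspace (tangle_space V E)" by (simp add: topspace_tangle)
  ultimately show "\<exists>x\<in>topspace (tangle_space V E).
      \<forall>W. openin (tangle_space V E) W \<and> x \<in> W \<longrightarrow> (\<exists>N\<in>\<FF>. N \<subseteq> W)"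
    by (intro bexI[of _ "Inr U"])
qed

section \<open>Finite separability\<close>

abbreviation "VT \<equiv> verts_and_tangles V E"

lemma VT_eq: "VT = Inl ` Vert ` V \<union> Inr ` UF"
  by (simp add: verts_and_tangles_def)

lemma finite_cut_sides_sym: "finite_cut_sides V E V1 V2 \<Longrightarrow> finite_cut_sides V E V2 V1"
  by (auto simp: finite_cut_sides_def cut_edges_def conj_commute)

lemma cut_edges_sym: "cut_edges E V1 V2 = cut_edges E V2 V1"
  by (auto simp: cut_edges_def)

lemma cut_fin_edges: "finite_cut_sides V E V1 V2 \<Longrightarrow> cut_edges E V1 V2 \<in> fin_edges E"
  by (auto simp: finite_cut_sides_def cut_edges_def fin_edges_def)

lemma cut_clean:
  assumes "finite_cut_sides V E V1 V2"
  shows "clean (\<Union>(cut_edges E V1 V2)) V1"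
proof -
  have "e \<in> cut_edges E V1 V2" if "e \<in> E" "e \<inter> V1 \<noteq> {}" "\<not> e \<subseteq> V1" for e
    using assms that edge_subset[OF that(1)] by (auto simp: finite_cut_sides_def cut_edges_def)
  then show ?thesis using assms by (auto simp: clean_def finite_cut_sides_def)
qed

lemma cut_comp_subset:
  assumes cut: "finite_cut_sides V E V1 V2" and C: "C \<in> CE (cut_edges E V1 V2)" and v: "v \<in> C" "v \<in> V1"
  shows "C \<subseteq> V1"
proof (rule comps_subset_closed[of C V "E - cut_edges E V1 V2" v])
  fix u w assume u: "u \<in> V1" and uw: "{u, w} \<in> E - cut_edges E V1 V2"
  have "w \<in> V" using uw edge_subset by blast
  moreover have "w \<notin> V2" using u uw by (auto simp: cut_edges_def)
  ultimately show "w \<in> V1" using cut by (auto simp: finite_cut_sides_def)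
qed (use C v Union_edges_subset in \<open>auto simp: comps_del_edges_def\<close>)

text \<open>Open sets are accessible only through the way they are generated. For closures it is
  enough to find vertices in them, and vertices come in blocks \<open>\<Union>\<C>\<close> with
  \<open>\<C>\<close> in the family; for an intersection, both blocks are refined over the union of
  the two vertex sets.\<close>

lemma tangle_open_contains_vertices:
  assumes U: "U \<in> UF" and W: "openin (tangle_space V E) W" "Inr U \<in> W"
  shows "\<exists>Y\<in>fin_verts V. \<exists>\<C>\<in>U Y. Inl ` Vert ` \<Union>\<C> \<subseteq> W"
proof -
  have "generate_topology_on ({Inl ` W | W. openin (one_complex V E) W} \<union>
      {tangle_nbhd V E X \<C> | X \<C>. X \<in> fin_verts V \<and> \<C> \<subseteq> CX X}) W"
    using W(1) by (simp add: tangle_space_def openin_topology_generated_by_iff)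
  then show ?thesis using W(2)
  proof induction
    case (Int A B)
    then obtain X \<C> Y \<D> where X: "X \<in> fin_verts V" "\<C> \<in> U X" "Inl ` Vert ` \<Union>\<C> \<subseteq> A"
      and Y: "Y \<in> fin_verts V" "\<D> \<in> U Y" "Inl ` Vert ` \<Union>\<D> \<subseteq> B" by auto
    have XY: "X \<union> Y \<in> fin_verts V" using X(1) Y(1) by (simp add: fin_verts_def)
    define \<C>' where "\<C>' = {c \<in> CX (X \<union> Y). comp_map V E X c \<in> \<C>}"
    define \<D>' where "\<D>' = {c \<in> CX (X \<union> Y). comp_map V E Y c \<in> \<D>}"
    have "\<C>' \<in> U (X \<union> Y)" unfolding \<C>'_def by (rule UF_pull[OF U X(1) XY _ X(2)]) simp
    moreover have "\<D>' \<in> U (X \<union> Y)" unfolding \<D>'_def by (rule UF_pull[OF U Y(1) XY _ Y(2)]) simp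
    ultimately have "\<C>' \<inter> \<D>' \<in> U (X \<union> Y)"
      using UF_ultrafilter[OF U XY] unfolding ultrafilter_on_def by blast
    moreover have "\<Union>(\<C>' \<inter> \<D>') \<subseteq> \<Union>\<C> \<inter> \<Union>\<D>"
    proof
      fix v assume "v \<in> \<Union>(\<C>' \<inter> \<D>')"
      then obtain c where c: "v \<in> c" "c \<in> CX (X \<union> Y)" "comp_map V E X c \<in> \<C>" "comp_map V E Y c \<in> \<D>"
        by (auto simp: \<C>'_def \<D>'_def)
      then show "v \<in> \<Union>\<C> \<inter> \<Union>\<D>" using comp_map_in[OF c(2), of X] comp_map_in[OF c(2), of Y] by auto
    qed
    then have "Inl ` Vert ` \<Union>(\<C>' \<inter> \<D>') \<subseteq> A \<inter> B" using X(3) Y(3) by (meson Int_greatest image_mono le_inf_iff order_trans)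
    ultimately show ?case using XY by (intro bexI[of _ "X \<union> Y"] bexI[of _ "\<C>' \<inter> \<D>'"])
  next
    case (UN \<K>)
    then obtain k where k: "k \<in> \<K>" "Inr U \<in> k" by blast
    have "k \<subseteq> \<Union>\<K>" using k(1) by blast
    with UN.IH[OF k] show ?case by (meson order_trans)
  next
    case (Basis s)
    then obtain X \<C> where X: "X \<in> fin_verts V" and s: "s = tangle_nbhd V E X \<C>" by blast
    have "\<C> \<in> U X" using Basis(2) by (simp add: s in_tangle_nbhd)
    moreover have "Inl ` Vert ` \<Union>\<C> \<subseteq> s" by (auto simp: s in_tangle_nbhd)
    ultimately show ?case using X by blast
  qed simp
qed

section \<open>Closures of the sides of a finite cut\<close>

text \<open>The ends of the cut edges form a set X at which \<open>U\<close> has to choose a side.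
  If it chooses \<open>V2\<close>, the neighbourhood formed by the components of G - X inside
  \<open>V2\<close> misses the subgraph on \<open>V1\<close>, as all its edges have an end in
  \<open>V2\<close>. If it chooses \<open>V1\<close>, it does so at every larger finite vertex set
  too, and hence every neighbourhood of \<open>U\<close> contains vertices of
  \<open>V1\<close>.\<close>

lemma tangle_in_closure_iff:
  assumes cut: "finite_cut_sides V E V1 V2" and U: "U \<in> UF"
  shows "Inr U \<in> induced_closure V E V1 \<longleftrightarrow> lives U (\<Union>(cut_edges E V1 V2)) V1"
proof -
  let ?X = "\<Union>(cut_edges E V1 V2)"
  have X: "?X \<in> fin_verts V" by (rule fin_edges_Union[OF cut_fin_edges[OF cut]])
  have V12: "V1 \<inter> V2 = {}" "V - V1 = V2" using cut by (auto simp: finite_cut_sides_def)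
  show ?thesis
  proof
    assume cl: "Inr U \<in> induced_closure V E V1"
    show "lives U ?X V1"
    proof (rule ccontr)
      assume "\<not> lives U ?X V1"
      then have l: "lives U ?X V2" using lives_or[OF U X cut_clean[OF cut]] V12 by simp
      define \<C> where "\<C> = {c \<in> CX ?X. c \<subseteq> V2}"
      have C: "\<C> \<subseteq> CX ?X" "\<Union>\<C> \<subseteq> V2" by (auto simp: \<C>_def)
      have "Inr U \<in> tangle_nbhd V E ?X \<C>" using U l by (simp add: in_tangle_nbhd lives_def \<C>_def)
      then obtain y where y: "y \<in> Inl ` graph_points V1 {e \<in> E. e \<subseteq> V1}" "y \<in> tangle_nbhd V E ?X \<C>"
        using cl openin_tangle_nbhd[OF X C(1)] unfolding induced_closure_def in_closure_of by blast
      then obtain z where z: "y = Inl z" "z \<in> graph_points V1 {e \<in> E. e \<subseteq> V1}" by blast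
      show False
      proof (cases z)
        case (Vert v)
        then have "v \<in> V1" "v \<in> \<Union>\<C>" using y z unfolding Vert by (simp_all add: in_tangle_nbhd)
        then show False using C(2) V12 by blast
      next
        case (Inner e t)
        then have "e \<subseteq> V1" "e \<inter> \<Union>\<C> \<noteq> {}" using y z unfolding Inner by (simp_all add: Inner_in_tangle_nbhd[OF C(1)])
        then show False using C(2) V12 by blast
      qed
    qed
  next
    assume l: "lives U ?X V1"
    show "Inr U \<in> induced_closure V E V1"
      unfolding induced_closure_def in_closure_of
    proof (intro conjI allI impI)
      show "Inr U \<in> topspace (tangle_space V E)" using U by (simp add: topspace_tangle)
      fix W assume W: "Inr U \<in> W \<and> openin (tangle_space V E) W"
      then obtain Y \<C> where Y: "Y \<in> fin_verts V" "\<C> \<in> U Y" "Inl ` Vert ` \<Union>\<C> \<subseteq> W"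
        using tangle_open_contains_vertices[OF U, of W] by auto
      \<comment> \<open>Over \<open>?X \<union> Y\<close> the components inside \<open>V1\<close>
        and those inside members of \<open>\<C>\<close> both form members of the ultrafilter, so
        some component is of both kinds.\<close>
      have XY: "?X \<union> Y \<in> fin_verts V" using X Y(1) by (simp add: fin_verts_def)
      have "lives U (?X \<union> Y) V1" using lives_indep[OF U X XY _ cut_clean[OF cut]] l by simp
      moreover have "{c \<in> CX (?X \<union> Y). comp_map V E Y c \<in> \<C>} \<in> U (?X \<union> Y)"
        by (rule UF_pull[OF U Y(1) XY _ Y(2)]) simp
      ultimately have "{c \<in> CX (?X \<union> Y). c \<subseteq> V1} \<inter> {c \<in> CX (?X \<union> Y). comp_map V E Y c \<in> \<C>} \<noteq> {}"
        unfolding lives_def by (rule ultrafilter_on_Int_nonempty[OF UF_ultrafilter[OF U XY]])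
      then obtain c where c: "c \<in> CX (?X \<union> Y)" "c \<subseteq> V1" "comp_map V E Y c \<in> \<C>" by blast
      obtain v where v: "v \<in> c" using CX_nonempty[OF c(1)] by blast
      then have "v \<in> \<Union>\<C>" using comp_map_in[OF c(1), of Y] c(3) by auto
      then have "Inl (Vert v) \<in> W" using Y(3) by blast
      moreover have "Inl (Vert v) \<in> (Inl ` graph_points V1 {e \<in> E. e \<subseteq> V1} :: 'a tpoint set)"
        using v c(2) by auto
      ultimately show "\<exists>y. y \<in> Inl ` graph_points V1 {e \<in> E. e \<subseteq> V1} \<and> y \<in> W"
        by (intro exI[of _ "Inl (Vert v)"] conjI)
    qed
  qed
qed

text \<open>An inner point close to \<open>v\<close> lies on an edge at \<open>v\<close>; if that
  edge belongs to the subgraph induced by \<open>V1\<close>, then so does \<open>v\<close>.\<close>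

lemma vertex_in_closure_iff:
  assumes v: "v \<in> V" and V1: "V1 \<subseteq> V"
  shows "Inl (Vert v) \<in> induced_closure V E V1 \<longleftrightarrow> v \<in> V1"
proof
  assume cl: "Inl (Vert v) \<in> induced_closure V E V1"
  let ?N = "Inl ` vertex_nbhd v (\<lambda>_. 1/2) :: 'a tpoint set"
  have "openin (tangle_space V E) ?N" by (rule openin_tangle_vertex[OF v]) simp
  moreover have "Inl (Vert v) \<in> ?N" by simp
  ultimately obtain y where y: "y \<in> Inl ` graph_points V1 {e \<in> E. e \<subseteq> V1}" "y \<in> ?N"
    using cl unfolding induced_closure_def in_closure_of by blast
  then obtain z where z: "z \<in> graph_points V1 {e \<in> E. e \<subseteq> V1}" "z \<in> vertex_nbhd v (\<lambda>_. 1/2)" by blast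
  then show "v \<in> V1" by (cases z) auto
next
  assume "v \<in> V1"
  then have "Inl (Vert v) \<in> (Inl ` graph_points V1 {e \<in> E. e \<subseteq> V1} :: 'a tpoint set)" by simp
  moreover have "Inl ` graph_points V1 {e \<in> E. e \<subseteq> V1} \<subseteq> topspace (tangle_space V E)"
    using V1 by (auto simp: topspace_tangle graph_points_def)
  ultimately show "Inl (Vert v) \<in> induced_closure V E V1"
    unfolding induced_closure_def using closure_of_subset by blast
qed

text \<open>Puts vertices and ultrafilter families on the same footing: membership in the closure is
  read off from the component in which the point lives once the edges of the cut are
  deleted.\<close>

lemma in_closure_iff:
  assumes cut: "finite_cut_sides V E V1 V2" and x: "x \<in> VT"
  shows "x \<in> induced_closure V E V1 \<longleftrightarrow> pcomp tanK x (cut_edges E V1 V2) \<subseteq> V1"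
proof -
  let ?F = "cut_edges E V1 V2"
  have F: "?F \<in> fin_edges E" by (rule cut_fin_edges[OF cut])
  have V12: "V1 \<inter> V2 = {}" "V1 \<union> V2 = V" using cut by (auto simp: finite_cut_sides_def)
  from x show ?thesis
    unfolding VT_eq
  proof
    assume "x \<in> Inl ` Vert ` V"
    then obtain v where v: "v \<in> V" "x = Inl (Vert v)" by blast
    have "v \<in> V1 \<longleftrightarrow> compE ?F v \<subseteq> V1"
      using cut_comp_subset[OF cut compE_in[OF v(1)] in_compE[OF v(1)]] in_compE[OF v(1)] by blast
    then show ?thesis using vertex_in_closure_iff[OF v(1), of V1] V12 v(2) by (auto simp: pcomp_def)
  next
    assume "x \<in> Inr ` UF"
    then obtain U where U: "U \<in> UF" "x = Inr U" by blast
    let ?C = "tanK U ?F" and ?X = "\<Union>?F"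
    have X: "?X \<in> fin_verts V" by (rule fin_edges_Union[OF F])
    have C: "?C \<in> CE ?F" "lives U ?X ?C" using tanK[OF U(1) F] by auto
    have "lives U ?X V1 \<longleftrightarrow> ?C \<subseteq> V1"
    proof
      assume "lives U ?X V1"
      then have "?C \<inter> V1 \<noteq> {}" using lives_disjoint[OF U(1) X C(2)] by blast
      then show "?C \<subseteq> V1" using cut_comp_subset[OF cut C(1)] by blast
    qed (rule lives_mono[OF U(1) X C(2)])
    then show ?thesis using tangle_in_closure_iff[OF cut U(1)] U(2) by (simp add: pcomp_def)
  qed
qed

text \<open>If the points are separated by a cut, its edge set is the required \<open>F\<close>.
  Conversely, a component \<open>C\<close> of G - F is one side of a cut, and the cut is finite
  since every edge leaving \<open>C\<close> belongs to \<open>F\<close>.\<close>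

lemma finitely_separable_iff:
  assumes x: "x \<in> VT" and y: "y \<in> VT"
  shows "finitely_separable V E x y \<longleftrightarrow> (\<exists>F\<in>fin_edges E. pcomp tanK x F \<noteq> pcomp tanK y F)"
proof
  assume "finitely_separable V E x y"
  then obtain V1 V2 where cut: "finite_cut_sides V E V1 V2"
    and "x \<in> induced_closure V E V1" "y \<in> induced_closure V E V2"
    unfolding finitely_separable_def by blast
  then have "pcomp tanK x (cut_edges E V1 V2) \<subseteq> V1" "pcomp tanK y (cut_edges E V1 V2) \<subseteq> V2"
    using in_closure_iff[OF cut x] in_closure_iff[OF finite_cut_sides_sym[OF cut] y] cut_edges_sym[of V2 V1]
    by auto
  moreover have "pcomp tanK x (cut_edges E V1 V2) \<noteq> {}"
    using CE_nonempty[OF pcomp_in[OF tanK_lives x[unfolded VT_eq] cut_fin_edges[OF cut]]] .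
  moreover have "V1 \<inter> V2 = {}" using cut by (simp add: finite_cut_sides_def)
  ultimately have "pcomp tanK x (cut_edges E V1 V2) \<noteq> pcomp tanK y (cut_edges E V1 V2)" by blast
  then show "\<exists>F\<in>fin_edges E. pcomp tanK x F \<noteq> pcomp tanK y F" using cut_fin_edges[OF cut] by blast
next
  assume "\<exists>F\<in>fin_edges E. pcomp tanK x F \<noteq> pcomp tanK y F"
  then obtain F where F: "F \<in> fin_edges E" and ne: "pcomp tanK x F \<noteq> pcomp tanK y F" by blast
  define C where "C = pcomp tanK x F"
  define D where "D = pcomp tanK y F"
  have C: "C \<in> CE F" unfolding C_def by (rule pcomp_in[OF tanK_lives x[unfolded VT_eq] F])
  have D: "D \<in> CE F" unfolding D_def by (rule pcomp_in[OF tanK_lives y[unfolded VT_eq] F])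
  have "D \<inter> C = {}" using CE_disjoint[OF C D] ne unfolding C_def D_def by blast
  then have DC: "D \<subseteq> V - C" using CE_subset[OF D] by blast
  let ?F = "cut_edges E C (V - C)"
  have FF: "?F \<subseteq> F"
  proof
    fix e assume e: "e \<in> ?F"
    then obtain u where "e \<in> E" "u \<in> e" "u \<in> C" "\<not> e \<subseteq> C" by (auto simp: cut_edges_def)
    then show "e \<in> F" using CE_edge[OF C] by blast
  qed
  have cut: "finite_cut_sides V E C (V - C)"
    unfolding finite_cut_sides_def
    using CE_nonempty[OF C] CE_nonempty[OF D] DC CE_subset[OF C] finite_subset[OF FF] F
    by (auto simp: fin_edges_def)
  have F': "?F \<in> fin_edges E" by (rule cut_fin_edges[OF cut])
  \<comment> \<open>Restoring the edges of \<open>F\<close> that do not leave \<open>C\<close> can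
    only enlarge the component of \<open>x\<close>, which cannot grow beyond \<open>C\<close>
    because all edges leaving \<open>C\<close> are still deleted. On the other side, the component
    of \<open>y\<close> likewise stays outside \<open>C\<close>.\<close>
  have "C \<subseteq> pcomp tanK x ?F"
    using pcomp_mono[OF tanK_lives x[unfolded VT_eq] F' F FF] by (simp add: C_def)
  then have "pcomp tanK x ?F \<subseteq> C"
    using cut_comp_subset[OF cut pcomp_in[OF tanK_lives x[unfolded VT_eq] F']] CE_nonempty[OF C] by blast
  then have 1: "x \<in> induced_closure V E C" using in_closure_iff[OF cut x] by simp
  have "D \<subseteq> pcomp tanK y ?F"
    using pcomp_mono[OF tanK_lives y[unfolded VT_eq] F' F FF] by (simp add: D_def)
  then have "pcomp tanK y ?F \<subseteq> V - C"
    using cut_comp_subset[OF finite_cut_sides_sym[OF cut], of "pcomp tanK y ?F"] DC CE_nonempty[OF D]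
      pcomp_in[OF tanK_lives y[unfolded VT_eq] F'] cut_edges_sym[of "V - C" C] by auto
  then have 2: "y \<in> induced_closure V E (V - C)"
    using in_closure_iff[OF finite_cut_sides_sym[OF cut] y] cut_edges_sym[of "V - C" C] by simp
  show "finitely_separable V E x y" unfolding finitely_separable_def using cut 1 2 by blast
qed

lemma insep_rel_kernel:
  assumes x: "x \<in> points UF"
  shows "insep_rel V E `` {x} = {y \<in> points UF. lift tanK y = lift tanK x}"
proof (cases "\<exists>e t. x = Inl (Inner e t)")
  case True
  then obtain e t where et: "x = Inl (Inner e t)" by blast
  \<comment> \<open>An inner point can be read off from any coordinate of its lift, so its class is
    a singleton.\<close>
  have "y = x" if "lift tanK y = lift tanK x" for y
  proof -
    have "lift_coord tanK {} y = Inner e t"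
      using fun_cong[OF that, of "{}"] empty_fin_edges by (simp add: lift_def et)
    then show ?thesis using et by (cases y; cases "projl y") auto
  qed
  then have "{y \<in> points UF. lift tanK y = lift tanK x} = {x}" using x by blast
  moreover have "insep_rel V E `` {x} = {x}"
    using x by (auto simp: et insep_rel_def verts_and_tangles_def)
  ultimately show ?thesis by simp
next
  case False
  then have xVT: "x \<in> VT" using x by (auto simp: VT_eq graph_points_def inner_edge_def)
  have VTsub: "VT \<subseteq> points UF" by (auto simp: VT_eq)
  have nin: "x \<notin> Inl ` (\<Union>e\<in>E. inner_edge e)" using False by (auto simp: inner_edge_def)
  have "insep_rel V E `` {x} = {y \<in> VT. \<not> finitely_separable V E x y}"
    using xVT nin by (auto simp: insep_rel_def)
  also have "\<dots> = {y \<in> points UF. lift tanK y = lift tanK x}"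
  proof (intro set_eqI iffI)
    fix y assume y: "y \<in> {y \<in> VT. \<not> finitely_separable V E x y}"
    then have "pcomp tanK x F = pcomp tanK y F" if "F \<in> fin_edges E" for F
      using finitely_separable_iff[OF xVT, of y] that by blast
    then have "lift tanK y = lift tanK x"
      using y lift_coord_pcomp[OF xVT[unfolded VT_eq], of tanK] lift_coord_pcomp[of y UF tanK]
      by (auto simp: lift_def VT_eq intro!: restrict_ext)
    then show "y \<in> {y \<in> points UF. lift tanK y = lift tanK x}" using y VTsub by blast
  next
    fix y assume y: "y \<in> {y \<in> points UF. lift tanK y = lift tanK x}"
    then have yx: "lift tanK y = lift tanK x" by simp
    have eq: "lift_coord tanK F y = Vert (pcomp tanK x F)" if "F \<in> fin_edges E" for F
      using that fun_cong[OF yx, of F] lift_coord_pcomp[OF xVT[unfolded VT_eq], of tanK F]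
      by (simp add: lift_def)
    have "y \<noteq> Inl (Inner e t)" for e t using eq[OF empty_fin_edges] by auto
    then have yVT: "y \<in> VT" using y by (auto simp: VT_eq graph_points_def inner_edge_def)
    then have "pcomp tanK x F = pcomp tanK y F" if "F \<in> fin_edges E" for F
      using eq[OF that] lift_coord_pcomp[of y UF tanK F] by (simp add: VT_eq)
    then show "y \<in> {y \<in> VT. \<not> finitely_separable V E x y}"
      using finitely_separable_iff[OF xVT yVT] yVT by simp
  qed
  finally show ?thesis .
qed

theorem tangle_quotient_homeomorphic_inverse_limit:
  "tangle_quotient V E homeomorphic_space inverse_limit V E"
  unfolding tangle_quotient_def
proof (rule quotient_topology_homeomorphic_space)
  show "quotient_map (tangle_space V E) (inverse_limit V E) (lift tanK)"
  proof (rule continuous_closed_imp_quotient_map)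
    show "continuous_map (tangle_space V E) (inverse_limit V E) (lift tanK)" by (rule lift_tanK_continuous)
    then show "closed_map (tangle_space V E) (inverse_limit V E) (lift tanK)"
      by (intro continuous_imp_closed_map compact_tangle_space Hausdorff_inverse_limit)
    show "lift tanK ` topspace (tangle_space V E) = topspace (inverse_limit V E)"
      unfolding topspace_tangle by (rule lift_surj[OF tanK_lives tanK_rays])
  qed
  show "insep_rel V E `` {x} = {y \<in> topspace (tangle_space V E). lift tanK y = lift tanK x}"
    if "x \<in> topspace (tangle_space V E)" for x
    using that unfolding topspace_tangle by (rule insep_rel_kernel)
qed

end

theorem theorem3p4p14:
  fixes V :: "'a set" and E :: "'a set set"
  assumes "sgraph V E" and "connected_sgraph V E"
  shows "inverse_limit V E homeomorphic_space tangle_quotient V E \<and>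
         tangle_quotient V E homeomorphic_space edge_end_space V E"
proof -
  interpret conn_graph V E using assms by unfold_locales
  have "inverse_limit V E homeomorphic_space tangle_quotient V E"
    by (rule homeomorphic_space_sym[THEN iffD1, OF tangle_quotient_homeomorphic_inverse_limit])
  moreover have "tangle_quotient V E homeomorphic_space edge_end_space V E"
    by (rule homeomorphic_space_trans[OF tangle_quotient_homeomorphic_inverse_limit
          homeomorphic_space_sym[THEN iffD1, OF edge_end_space_homeomorphic_inverse_limit]])
  ultimately show ?thesis by (rule conjI)
qed

end
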